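(* Let $g\geqslant1$ and let $\phi\in\mathbb{C}[x]$ be any non-zero polynomial of degree at most $g+1$, vanishing at $0$. Then the Volterra map $\mathcal{V}_g$ is Liouville integrable on $(M_g,\{\cdot,\cdot\}^\phi)$.
   Context: $M_g\cong\mathbb{C}^{3g+1}$ is the affine space of triplets $(\mathcal{P},\mathcal{Q},\mathcal{R})$ of complex polynomials $\mathcal{P}=1+\sum_{i=1}^gp_ix^i$, $\mathcal{Q}=2+\sum_{i=1}^gq_ix^i$, $\mathcal{R}=\sum_{i=1}^{g+1}r_ix^i$. The Volterra map is the birational automorphism $\mathcal{V}_g(\mathcal{P},\mathcal{Q},\mathcal{R})=\big(\mathcal{Q}-\mathcal{P},\ \frac{2\mathcal{P}-\mathcal{Q}+\mathcal{R}}{-wx},\ -wx\mathcal{Q}\big)$, $w=-\frac12(2p_1-q_1+r_1)$. It preserves the functions $H_1,\dots,H_{2g+1}$ defined by $\mathcal{P}^2+\mathcal{Q}\mathcal{R}=1+\sum_{i=1}^{2g+1}H_ix^i$. The Poisson bracket $\{\cdot,\cdot\}^\phi$ on $M_g$ is given in generating function form by $\{\mathcal{P}(x),\mathcal{P}(y)\}^\phi=\{\mathcal{Q}(x),\mathcal{Q}(y)\}^\phi=0$, $\{\mathcal{R}(x),\mathcal{R}(y)\}^\phi=\phi(y)\mathcal{R}(x)-\phi(x)\mathcal{R}(y)$, $\{\mathcal{P}(x),\mathcal{Q}(y)\}^\phi=\frac{\phi(x)y\mathcal{Q}(y)-\phi(y)x\mathcal{Q}(x)}{x-y}$, $\{\mathcal{P}(x),\mathcal{R}(y)\}^\phi=-y\frac{\phi(x)\mathcal{R}(y)-\phi(y)\mathcal{R}(x)}{x-y}$,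 $\{\mathcal{Q}(x),\mathcal{R}(y)\}^\phi=2y\frac{\phi(x)\mathcal{P}(y)-\phi(y)\mathcal{P}(x)}{x-y}-\phi(y)\mathcal{Q}(x)$. A birational map $R$ on an algebraic Poisson manifold of dimension $n$ and (generic) Poisson rank $2r$ is Liouville integrable if (1) $R$ is a Poisson map, and (2) $R$ has $n-r$ functionally independent invariants in involution. *)

theory Defs
  imports "HOL-Analysis.Analysis" "Jordan_Normal_Form.DL_Rank"
begin

unbundle no vec_syntax

section \<open>Birational maps and Poisson structures on affine space\<close>

text \<open>
  The affine space of dimension \<open>n\<close> is \<open>carrier_vec n\<close> with complex entries.
  Since the ground field is infinite, a polynomial in the coordinates is identified with the
  function it defines.
\<close>

type_synonym cfun = "complex Matrix.vec \<Rightarrow> complex"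

inductive_set polyfun :: "nat \<Rightarrow> cfun set" for n :: nat where
  const: "(\<lambda>v. c) \<in> polyfun n"
| coord: "i < n \<Longrightarrow> (\<lambda>v. v $ i) \<in> polyfun n"
| add: "f \<in> polyfun n \<Longrightarrow> h \<in> polyfun n \<Longrightarrow> (\<lambda>v. f v + h v) \<in> polyfun n"
| mult: "f \<in> polyfun n \<Longrightarrow> h \<in> polyfun n \<Longrightarrow> (\<lambda>v. f v * h v) \<in> polyfun n"

text \<open>\<open>S\<close> holds on a non-empty (hence dense) Zariski open subset:\<close>

definition generically :: "nat \<Rightarrow> (complex Matrix.vec \<Rightarrow> bool) \<Rightarrow> bool" where
  "generically n S \<longleftrightarrow>
     (\<exists>d \<in> polyfun n. (\<exists>v \<in> carrier_vec n. d v \<noteq> 0) \<and> (\<forall>v \<in> carrier_vec n. d v \<noteq> 0 \<longrightarrow> S v))"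

text \<open>
  Rational functions and rational maps are represented by total functions whose values outside a
  non-empty Zariski open subset are irrelevant; accordingly, identities between them are
  required to hold generically.
\<close>

definition rational_fun :: "nat \<Rightarrow> cfun \<Rightarrow> bool" where
  "rational_fun n f \<longleftrightarrow>
     (\<exists>a \<in> polyfun n. \<exists>d \<in> polyfun n. (\<exists>v \<in> carrier_vec n. d v \<noteq> 0) \<and>
        (\<forall>v \<in> carrier_vec n. d v \<noteq> 0 \<longrightarrow> f v = a v / d v))"

definition rational_map :: "nat \<Rightarrow> (complex Matrix.vec \<Rightarrow> complex Matrix.vec) \<Rightarrow> bool" where
  "rational_map n T \<longleftrightarrow>
     (\<forall>v \<in> carrier_vec n. T v \<in> carrier_vec n) \<and> (\<forall>i < n. rational_fun n (\<lambda>v. T v $ i))"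

definition birational_map :: "nat \<Rightarrow> (complex Matrix.vec \<Rightarrow> complex Matrix.vec) \<Rightarrow> bool" where
  "birational_map n T \<longleftrightarrow>
     rational_map n T \<and>
     (\<exists>U. rational_map n U \<and> generically n (\<lambda>v. U (T v) = v) \<and> generically n (\<lambda>v. T (U v) = v))"

definition partial_deriv :: "nat \<Rightarrow> cfun \<Rightarrow> cfun" where
  "partial_deriv i f v = deriv (\<lambda>t. f (v + t \<cdot>\<^sub>v unit_vec (dim_vec v) i)) 0"

text \<open>
  The biderivation with \<open>{x\<^sub>i, x\<^sub>j} = \<pi> i j\<close> on the coordinate functions
  (\<open>i, j < n\<close>, counted from \<open>0\<close>).
\<close>

definition bracket :: "nat \<Rightarrow> (nat \<Rightarrow> nat \<Rightarrow> cfun) \<Rightarrow> cfun \<Rightarrow> cfun \<Rightarrow> cfun" where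
  "bracket n \<pi> f h v =
     (\<Sum>i<n. \<Sum>j<n. \<pi> i j v * partial_deriv i f v * partial_deriv j h v)"

definition poisson_structure :: "nat \<Rightarrow> (nat \<Rightarrow> nat \<Rightarrow> cfun) \<Rightarrow> bool" where
  "poisson_structure n \<pi> \<longleftrightarrow>
     (\<forall>i<n. \<forall>j<n. \<exists>a \<in> polyfun n. \<forall>v \<in> carrier_vec n. \<pi> i j v = a v) \<and>
     (\<forall>f \<in> polyfun n. \<forall>h \<in> polyfun n. \<forall>v \<in> carrier_vec n.
        bracket n \<pi> f h v = - bracket n \<pi> h f v) \<and>
     (\<forall>f \<in> polyfun n. \<forall>h \<in> polyfun n. \<forall>k \<in> polyfun n. \<forall>v \<in> carrier_vec n.
        bracket n \<pi> (bracket n \<pi> f h) k v + bracket n \<pi> (bracket n \<pi> h k) f v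
          + bracket n \<pi> (bracket n \<pi> k f) h v = 0)"

definition poisson_rank :: "nat \<Rightarrow> (nat \<Rightarrow> nat \<Rightarrow> cfun) \<Rightarrow> nat \<Rightarrow> bool" where
  "poisson_rank n \<pi> s \<longleftrightarrow>
     generically n (\<lambda>v. vec_space.rank n (mat n n (\<lambda>(i, j). \<pi> i j v)) = s)"

definition poisson_map ::
    "nat \<Rightarrow> (nat \<Rightarrow> nat \<Rightarrow> cfun) \<Rightarrow> (complex Matrix.vec \<Rightarrow> complex Matrix.vec) \<Rightarrow> bool" where
  "poisson_map n \<pi> T \<longleftrightarrow>
     (\<forall>f h. rational_fun n f \<longrightarrow> rational_fun n h \<longrightarrow>
        generically n (\<lambda>v. bracket n \<pi> (f \<circ> T) (h \<circ> T) v = bracket n \<pi> f h (T v)))"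

text \<open>
  The differentials of \<open>F 0, \<dots>, F (m - 1)\<close> are linearly independent at a generic point:
\<close>

definition functionally_independent :: "nat \<Rightarrow> nat \<Rightarrow> (nat \<Rightarrow> cfun) \<Rightarrow> bool" where
  "functionally_independent n m F \<longleftrightarrow>
     generically n (\<lambda>v. \<forall>c :: nat \<Rightarrow> complex.
       (\<forall>i<n. (\<Sum>k<m. c k * partial_deriv i (F k) v) = 0) \<longrightarrow> (\<forall>k<m. c k = 0))"

definition liouville_integrable ::
    "nat \<Rightarrow> (nat \<Rightarrow> nat \<Rightarrow> cfun) \<Rightarrow> (complex Matrix.vec \<Rightarrow> complex Matrix.vec) \<Rightarrow> bool" where
  "liouville_integrable n \<pi> T \<longleftrightarrow>
     poisson_structure n \<pi> \<and> birational_map n T \<and> poisson_map n \<pi> T \<and>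
     (\<exists>r. poisson_rank n \<pi> (2 * r) \<and>
       (\<exists>F. (\<forall>k < n - r. rational_fun n (F k)) \<and>
            (\<forall>k < n - r. generically n (\<lambda>v. F k (T v) = F k v)) \<and>
            (\<forall>k < n - r. \<forall>l < n - r. generically n (\<lambda>v. bracket n \<pi> (F k) (F l) v = 0)) \<and>
            functionally_independent n (n - r) F))"


section \<open>The phase space \<open>M\<^sub>g\<close> and the Volterra map\<close>

text \<open>
  \<open>M\<^sub>g\<close> is identified with \<open>carrier_vec (3 * g + 1)\<close> through the coordinates
  \<open>(p\<^sub>1, \<dots>, p\<^sub>g, q\<^sub>1, \<dots>, q\<^sub>g, r\<^sub>1, \<dots>, r\<^bsub>g+1\<^esub>)\<close>; \<open>triplet\<close> and \<open>coords\<close>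
  are the two directions of this identification.
\<close>

definition poly_P :: "nat \<Rightarrow> complex Matrix.vec \<Rightarrow> complex poly" where
  "poly_P g v = 1 + (\<Sum>i = 1..g. monom (v $ (i - 1)) i)"

definition poly_Q :: "nat \<Rightarrow> complex Matrix.vec \<Rightarrow> complex poly" where
  "poly_Q g v = 2 + (\<Sum>i = 1..g. monom (v $ (g + i - 1)) i)"

definition poly_R :: "nat \<Rightarrow> complex Matrix.vec \<Rightarrow> complex poly" where
  "poly_R g v = (\<Sum>i = 1..g + 1. monom (v $ (2 * g + i - 1)) i)"

definition triplet :: "nat \<Rightarrow> complex Matrix.vec \<Rightarrow> complex poly \<times> complex poly \<times> complex poly" where
  "triplet g v = (poly_P g v, poly_Q g v, poly_R g v)"

fun coords :: "nat \<Rightarrow> complex poly \<times> complex poly \<times> complex poly \<Rightarrow> complex Matrix.vec" where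
  "coords g (P, Q, R) = Matrix.vec (3 * g + 1) (\<lambda>k.
     if k < g then coeff P (k + 1)
     else if k < 2 * g then coeff Q (k - g + 1)
     else coeff R (k - 2 * g + 1))"

text \<open>
  For triplets in \<open>M\<^sub>g\<close> the constant term of \<open>2 * P - Q + R\<close> vanishes, so the
  division by \<open>- w x\<close> is exact as soon as \<open>w \<noteq> 0\<close>.
\<close>

fun volterra ::
    "complex poly \<times> complex poly \<times> complex poly \<Rightarrow> complex poly \<times> complex poly \<times> complex poly" where
  "volterra (P, Q, R) =
     (let w = - (1 / 2) * (2 * coeff P 1 - coeff Q 1 + coeff R 1)
      in (Q - P, (2 * P - Q + R) div [:0, - w:], [:0, - w:] * Q))"

definition volterra_map :: "nat \<Rightarrow> complex Matrix.vec \<Rightarrow> complex Matrix.vec" where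
  "volterra_map g v = coords g (volterra (triplet g v))"


section \<open>The Poisson structures on \<open>M\<^sub>g\<close>\<close>

text \<open>
  Polynomials in \<open>x\<close> and \<open>y\<close> are elements of \<open>complex poly poly\<close>, where \<open>x\<close> is the variable of
  the coefficients and \<open>y\<close> is the outer variable; \<open>in_x f\<close> is \<open>f(x)\<close> and
  \<open>in_y f\<close> is \<open>f(y)\<close>.
\<close>

definition var_x :: "complex poly poly" where "var_x = [:[:0, 1:]:]"
definition var_y :: "complex poly poly" where "var_y = [:0, 1:]"

definition in_x :: "complex poly \<Rightarrow> complex poly poly" where "in_x f = [:f:]"
definition in_y :: "complex poly \<Rightarrow> complex poly poly" where "in_y f = map_poly (\<lambda>c. [:c:]) f"

definition coeff_xy :: "complex poly poly \<Rightarrow> nat \<Rightarrow> nat \<Rightarrow> complex" where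
  "coeff_xy B i j = coeff (coeff B j) i"

text \<open>
  The generating functions of the brackets of the coordinates: for instance
  \<open>{p\<^sub>i, q\<^sub>j}\<close> is the coefficient of \<open>x\<^sup>i y\<^sup>j\<close> in \<open>bracket_PQ\<close>. All numerators
  vanish on \<open>x = y\<close>, so that the divisions are exact.
\<close>

definition bracket_PQ :: "complex poly \<Rightarrow> complex poly \<Rightarrow> complex poly poly" where
  "bracket_PQ \<phi> Q =
     (in_x \<phi> * var_y * in_y Q - in_y \<phi> * var_x * in_x Q) div (var_x - var_y)"

definition bracket_PR :: "complex poly \<Rightarrow> complex poly \<Rightarrow> complex poly poly" where
  "bracket_PR \<phi> R =
     - (var_y * ((in_x \<phi> * in_y R - in_y \<phi> * in_x R) div (var_x - var_y)))"

definition bracket_QR ::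
    "complex poly \<Rightarrow> complex poly \<Rightarrow> complex poly \<Rightarrow> complex poly poly" where
  "bracket_QR \<phi> P Q =
     2 * var_y * ((in_x \<phi> * in_y P - in_y \<phi> * in_x P) div (var_x - var_y)) - in_y \<phi> * in_x Q"

definition bracket_RR :: "complex poly \<Rightarrow> complex poly \<Rightarrow> complex poly poly" where
  "bracket_RR \<phi> R = in_y \<phi> * in_x R - in_x \<phi> * in_y R"

definition volterra_poisson :: "nat \<Rightarrow> complex poly \<Rightarrow> nat \<Rightarrow> nat \<Rightarrow> cfun" where
  "volterra_poisson g \<phi> a b v =
     (let P = poly_P g v; Q = poly_Q g v; R = poly_R g v;
          p = (\<lambda>k. k + 1); q = (\<lambda>k. k - g + 1); r = (\<lambda>k. k - 2 * g + 1)
      in if a < g then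
           (if b < g then 0
            else if b < 2 * g then coeff_xy (bracket_PQ \<phi> Q) (p a) (q b)
            else coeff_xy (bracket_PR \<phi> R) (p a) (r b))
         else if a < 2 * g then
           (if b < g then - coeff_xy (bracket_PQ \<phi> Q) (p b) (q a)
            else if b < 2 * g then 0
            else coeff_xy (bracket_QR \<phi> P Q) (q a) (r b))
         else
           (if b < g then - coeff_xy (bracket_PR \<phi> R) (p b) (r a)
            else if b < 2 * g then - coeff_xy (bracket_QR \<phi> P Q) (q b) (r a)
            else coeff_xy (bracket_RR \<phi> R) (r a) (r b)))"

end

theory Submission
  imports Defs "Jordan_Normal_Form.DL_Rank_Submatrix"
begin

text \<open>
  Write \<open>P = 1 + x p\<close>, \<open>Q = 2 + x q\<close>, \<open>R = x r\<close>, \<open>\<phi> = x f\<close>. The values \<open>p(x), q(x), r(x)\<close> are linear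
  functions whose differentials span the cotangent space as \<open>x\<close> varies, so every identity that is
  multilinear in differentials (Jacobi, invariance of the bracket under the Volterra map, involution)
  only has to be checked on them, at pairwise distinct points, where it is an identity of rational
  functions. The coefficients of \<open>P\<^sup>2 + Q R\<close> are independent because at \<open>P = 1\<close>, \<open>Q = 2 + x\<^sup>g\<close>,
  \<open>R = 0\<close> their differentials with respect to \<open>p\<close> and \<open>r\<close> are triangular. They span an isotropic
  subspace of dimension \<open>2 g + 1\<close>, hence the rank is at most \<open>2 g\<close>; it is at least \<open>2 g\<close> because the
  brackets between \<open>p\<close> and \<open>q\<close> form the Bezoutian of \<open>f\<close> and \<open>Q\<close>, which is invertible for generic \<open>Q\<close>.
\<close>

section \<open>Polynomial functions and gradients\<close>

text \<open>Distinct points are forced by the divided differences: on the diagonal the brackets of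
  p(x), q(y), r(y) would involve derivatives. Leaving out finitely many values costs nothing, since
  a polynomial vanishing off a finite set is zero; 0 is left out as well for the Volterra map, whose
  second component divides by x. Passing to p, q, r removes the constants 1, 2, 0 and turns
  coordinates into coefficients of x^0, x^1, ...; the vanishing of \<phi> at 0 and its degree bound
  then ensure that the divided brackets fit into blocks of g, g and g + 1 coordinates. The Volterra
  map is only rational, and its Jacobian is never computed: p(x), q(x), r(x) composed with it have
  explicit differentials, and since w is a combination of p(0), q(0), r(0), their brackets come from
  the same formulas. Composing a rational function with the map makes sense generically only because
  the map is dominant, which its explicit inverse provides. The rank does not depend on the degree
  of f: for the lower bound Q gets g roots that avoid those of f, even if f is constant.\<close>

lemma polyfun_uminus: "f \<in> polyfun n \<Longrightarrow> (\<lambda>v. - f v) \<in> polyfun n"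
  using polyfun.mult[OF polyfun.const[of "-1"]] by fastforce

lemma polyfun_diff: "f \<in> polyfun n \<Longrightarrow> h \<in> polyfun n \<Longrightarrow> (\<lambda>v. f v - h v) \<in> polyfun n"
  using polyfun.add[OF _ polyfun_uminus] by fastforce

lemma polyfun_sum: "(\<And>i. i \<in> I \<Longrightarrow> f i \<in> polyfun n) \<Longrightarrow> (\<lambda>v. \<Sum>i\<in>I. f i v) \<in> polyfun n"
  by (induction I rule: infinite_finite_induct) (auto intro: polyfun.intros)

lemma polyfun_prod: "(\<And>i. i \<in> I \<Longrightarrow> f i \<in> polyfun n) \<Longrightarrow> (\<lambda>v. \<Prod>i\<in>I. f i v) \<in> polyfun n"
  by (induction I rule: infinite_finite_induct) (auto intro: polyfun.intros)

lemma polyfun_power: "f \<in> polyfun n \<Longrightarrow> (\<lambda>v. f v ^ m) \<in> polyfun n"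
  by (induction m) (auto intro: polyfun.intros)

lemmas polyfun_intros = polyfun.intros polyfun_uminus polyfun_diff polyfun_sum polyfun_prod
  polyfun_power

lemma polyfun_det:
  assumes "\<And>i j. i < m \<Longrightarrow> j < m \<Longrightarrow> a i j \<in> polyfun n"
  shows "(\<lambda>v. det (mat m m (\<lambda>(i, j). a i j v))) \<in> polyfun n"
proof -
  have "(\<lambda>v. \<Sum>p\<in>{p. p permutes {0..<m}}. signof p * (\<Prod>i = 0..<m. a i (p i) v)) \<in> polyfun n"
    using assms by (intro polyfun_intros) (auto simp: permutes_in_image)
  moreover have "det (mat m m (\<lambda>(i, j). a i j v))
      = (\<Sum>p\<in>{p. p permutes {0..<m}}. signof p * (\<Prod>i = 0..<m. a i (p i) v))" for v
    by (subst det_def'[of _ m]) (auto simp: permutes_in_image intro!: sum.cong prod.cong)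
  ultimately show ?thesis by simp
qed

text \<open>Restriction to complex lines replaces Zariski density in n variables by the finiteness
  of the roots of a polynomial in one variable.\<close>

lemma polyfun_on_line:
  assumes "f \<in> polyfun n" "u \<in> carrier_vec n" "v \<in> carrier_vec n"
  shows "\<exists>p. \<forall>t. f (u + t \<cdot>\<^sub>v v) = poly p t"
  using assms(1)
proof induction
  case (const c)
  show ?case by (rule exI[of _ "[:c:]"]) simp
next
  case (coord i)
  show ?case using assms(2,3) coord by (intro exI[of _ "[:u $ i, v $ i:]"]) auto
next
  case (add f h)
  then obtain p q where "\<forall>t. f (u + t \<cdot>\<^sub>v v) = poly p t" "\<forall>t. h (u + t \<cdot>\<^sub>v v) = poly q t"
    by blast
  then show ?case by (intro exI[of _ "p + q"]) simp
next
  case (mult f h)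
  then obtain p q where "\<forall>t. f (u + t \<cdot>\<^sub>v v) = poly p t" "\<forall>t. h (u + t \<cdot>\<^sub>v v) = poly q t"
    by blast
  then show ?case by (intro exI[of _ "p * q"]) simp
qed

text \<open>Irreducibility of affine space: on the line through u and v neither restriction is the
  zero polynomial, as t = 0 and t = 1 show, so their product has only finitely many roots. This
  makes generic conditions stable under conjunction.\<close>

lemma polyfun_mult_nonzero:
  assumes "f \<in> polyfun n" "h \<in> polyfun n"
    and u: "u \<in> carrier_vec n" "f u \<noteq> 0" and v: "v \<in> carrier_vec n" "h v \<noteq> 0"
  shows "\<exists>x \<in> carrier_vec n. f x * h x \<noteq> 0"
proof -
  have 1: "v - u \<in> carrier_vec n" "u + (0::complex) \<cdot>\<^sub>v (v - u) = u" "u + (1::complex) \<cdot>\<^sub>v (v - u) = v"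
    using u v by auto
  obtain p q where p: "\<And>t. f (u + t \<cdot>\<^sub>v (v - u)) = poly p t"
    and q: "\<And>t. h (u + t \<cdot>\<^sub>v (v - u)) = poly q t"
    using polyfun_on_line[OF assms(1) u(1) 1(1)] polyfun_on_line[OF assms(2) u(1) 1(1)] by blast
  have "p \<noteq> 0" "q \<noteq> 0" using p[of 0] q[of 1] u v 1 by auto
  then have "finite {t. poly (p * q) t = 0}" by (intro poly_roots_finite) auto
  then obtain t where "poly (p * q) t \<noteq> 0" using ex_new_if_finite[OF infinite_UNIV_char_0] by blast
  then show ?thesis using p q u(1) 1(1) by (intro bexI[of _ "u + t \<cdot>\<^sub>v (v - u)"]) auto
qed

section \<open>Generic conditions and rational functions\<close>

lemma genericallyI:
  "d \<in> polyfun n \<Longrightarrow> v \<in> carrier_vec n \<Longrightarrow> d v \<noteq> 0 \<Longrightarrow>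
    (\<And>v. v \<in> carrier_vec n \<Longrightarrow> d v \<noteq> 0 \<Longrightarrow> S v) \<Longrightarrow> generically n S"
  unfolding generically_def by blast

lemma generically_all: "(\<And>v. v \<in> carrier_vec n \<Longrightarrow> S v) \<Longrightarrow> generically n S"
  by (rule genericallyI[of "\<lambda>_. 1" _ "0\<^sub>v n"]) (auto intro: polyfun.intros)

lemma generically_mp2:
  assumes "generically n S" "generically n S'"
    and "\<And>v. v \<in> carrier_vec n \<Longrightarrow> S v \<Longrightarrow> S' v \<Longrightarrow> S'' v"
  shows "generically n S''"
proof -
  obtain d where d: "d \<in> polyfun n" "\<exists>v\<in>carrier_vec n. d v \<noteq> 0"
    "\<And>v. v \<in> carrier_vec n \<Longrightarrow> d v \<noteq> 0 \<Longrightarrow> S v" using assms(1) unfolding generically_def by blast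
  obtain e where e: "e \<in> polyfun n" "\<exists>v\<in>carrier_vec n. e v \<noteq> 0"
    "\<And>v. v \<in> carrier_vec n \<Longrightarrow> e v \<noteq> 0 \<Longrightarrow> S' v" using assms(2) unfolding generically_def by blast
  obtain x where "x \<in> carrier_vec n" "d x * e x \<noteq> 0"
    using polyfun_mult_nonzero[OF d(1) e(1)] d(2) e(2) by blast
  then show ?thesis
    using d(3) e(3) assms(3) by (intro genericallyI[OF polyfun.mult[OF d(1) e(1)]]) auto
qed

lemma generically_mp:
  "generically n S \<Longrightarrow> (\<And>v. v \<in> carrier_vec n \<Longrightarrow> S v \<Longrightarrow> S' v) \<Longrightarrow> generically n S'"
  using generically_mp2 by blast

lemma rational_fun_quotient:
  assumes "a \<in> polyfun n" "d \<in> polyfun n" "u \<in> carrier_vec n" "d u \<noteq> 0"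
    and "\<And>v. v \<in> carrier_vec n \<Longrightarrow> d v \<noteq> 0 \<Longrightarrow> f v = a v / d v"
  shows "rational_fun n f"
  using assms unfolding rational_fun_def by blast

lemma rational_fun_polyfun: "f \<in> polyfun n \<Longrightarrow> rational_fun n f"
  by (rule rational_fun_quotient[of f _ "\<lambda>_. 1" "0\<^sub>v n"]) (auto intro: polyfun.intros)

text \<open>
  The gradient is required along arbitrary complex curves rather than along coordinate lines,
  so that the chain rule for maps between affine spaces holds without a topology on vectors.
\<close>

definition has_gradient :: "nat \<Rightarrow> cfun \<Rightarrow> (nat \<Rightarrow> complex) \<Rightarrow> complex Matrix.vec \<Rightarrow> bool" where
  "has_gradient n f D v \<longleftrightarrow> v \<in> carrier_vec n \<and> (\<forall>c c'. (\<forall>t. c t \<in> carrier_vec n) \<longrightarrow> c 0 = v \<longrightarrow>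
     (\<forall>i<n. ((\<lambda>t. c t $ i) has_field_derivative c' i) (at 0)) \<longrightarrow>
     ((\<lambda>t. f (c t)) has_field_derivative (\<Sum>i<n. D i * c' i)) (at (0::complex)))"

lemma has_gradient_carrier: "has_gradient n f D v \<Longrightarrow> v \<in> carrier_vec n"
  by (simp add: has_gradient_def)

lemma has_gradient_const: "v \<in> carrier_vec n \<Longrightarrow> has_gradient n (\<lambda>v. c) (\<lambda>i. 0) v"
  by (simp add: has_gradient_def)

lemma has_gradient_coord:
  "v \<in> carrier_vec n \<Longrightarrow> j < n \<Longrightarrow> has_gradient n (\<lambda>v. v $ j) (\<lambda>i. of_bool (i = j)) v"
  by (auto simp: has_gradient_def of_bool_def if_distrib[of "\<lambda>x. x * _"] sum.delta cong: if_cong)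

lemma has_gradient_add:
  "has_gradient n f D v \<Longrightarrow> has_gradient n h E v \<Longrightarrow>
    has_gradient n (\<lambda>v. f v + h v) (\<lambda>i. D i + E i) v"
  by (auto simp: has_gradient_def ring_distribs sum.distrib intro!: DERIV_add)

lemma has_gradient_mult:
  assumes "has_gradient n f D v" "has_gradient n h E v"
  shows "has_gradient n (\<lambda>v. f v * h v) (\<lambda>i. f v * E i + h v * D i) v"
  unfolding has_gradient_def
proof (intro conjI allI impI)
  fix c c' assume c: "\<forall>t. c t \<in> carrier_vec n" "c 0 = v"
    "\<forall>i<n. ((\<lambda>t. c t $ i) has_field_derivative c' i) (at (0::complex))"
  have "((\<lambda>t. f (c t) * h (c t)) has_field_derivative
      (\<Sum>i<n. D i * c' i) * h (c 0) + (\<Sum>i<n. E i * c' i) * f (c 0)) (at 0)"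
    by (rule DERIV_mult) (use assms c in \<open>auto simp: has_gradient_def\<close>)
  then show "((\<lambda>t. f (c t) * h (c t)) has_field_derivative
      (\<Sum>i<n. (f v * E i + h v * D i) * c' i)) (at 0)"
    using c(2) by (simp add: ring_distribs sum.distrib sum_distrib_left algebra_simps)
qed (use assms in \<open>auto simp: has_gradient_def\<close>)

lemma has_gradient_inverse:
  assumes "has_gradient n f D v" "f v \<noteq> 0"
  shows "has_gradient n (\<lambda>v. inverse (f v)) (\<lambda>i. - D i / (f v)\<^sup>2) v"
  unfolding has_gradient_def
proof (intro conjI allI impI)
  fix c c' assume c: "\<forall>t. c t \<in> carrier_vec n" "c 0 = v"
    "\<forall>i<n. ((\<lambda>t. c t $ i) has_field_derivative c' i) (at (0::complex))"
  have "((\<lambda>t. inverse (f (c t))) has_field_derivative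
      - ((\<Sum>i<n. D i * c' i) * inverse ((f (c 0))\<^sup>2))) (at 0)"
    using DERIV_inverse_fun[of "\<lambda>t. f (c t)" "\<Sum>i<n. D i * c' i" 0 UNIV] assms c
    by (auto simp: has_gradient_def power2_eq_square)
  then show "((\<lambda>t. inverse (f (c t))) has_field_derivative
      (\<Sum>i<n. (- D i / (f v)\<^sup>2) * c' i)) (at 0)"
    using c(2) by (simp add: sum_distrib_left sum_negf divide_inverse algebra_simps)
qed (use assms in \<open>auto simp: has_gradient_def\<close>)

lemma has_gradient_comp:
  assumes f: "has_gradient n f D (T v)" and v: "v \<in> carrier_vec n"
    and T: "\<And>u. u \<in> carrier_vec n \<Longrightarrow> T u \<in> carrier_vec n"
    and DT: "\<And>k. k < n \<Longrightarrow> has_gradient n (\<lambda>u. T u $ k) (DT k) v"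
  shows "has_gradient n (f \<circ> T) (\<lambda>i. \<Sum>k<n. D k * DT k i) v"
  unfolding has_gradient_def
proof (intro conjI allI impI)
  fix c c' assume c: "\<forall>t. c t \<in> carrier_vec n" "c 0 = v"
    "\<forall>i<n. ((\<lambda>t. c t $ i) has_field_derivative c' i) (at (0::complex))"
  have "((\<lambda>t. T (c t) $ k) has_field_derivative (\<Sum>i<n. DT k i * c' i)) (at 0)" if "k < n" for k
    using DT[OF that] c unfolding has_gradient_def by blast
  \<comment> \<open>The image curve is itself an admissible test curve through \<open>T v\<close>,
    so the definition of the gradient of f applies to it directly.\<close>
  then have "((\<lambda>t. f (T (c t))) has_field_derivative (\<Sum>k<n. D k * (\<Sum>i<n. DT k i * c' i))) (at 0)"
    using f c T unfolding has_gradient_def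
    by (elim conjE allE[of _ "\<lambda>t. T (c t)"] allE[of _ "\<lambda>k. \<Sum>i<n. DT k i * c' i"]) auto
  moreover have "(\<Sum>k<n. D k * (\<Sum>i<n. DT k i * c' i)) = (\<Sum>i<n. (\<Sum>k<n. D k * DT k i) * c' i)"
    unfolding sum_distrib_left sum_distrib_right by (subst sum.swap) (simp add: mult.assoc)
  ultimately show "((\<lambda>t. (f \<circ> T) (c t)) has_field_derivative
      (\<Sum>i<n. (\<Sum>k<n. D k * DT k i) * c' i)) (at 0)" by simp
qed (rule v)

lemma polyfun_has_gradient:
  "f \<in> polyfun n \<Longrightarrow> v \<in> carrier_vec n \<Longrightarrow> \<exists>D. has_gradient n f D v"
  by (induction rule: polyfun.induct)
    (blast intro: has_gradient_const has_gradient_coord has_gradient_add has_gradient_mult)+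

text \<open>Along a differentiable curve through v the polynomial d stays non-zero near t = 0, so f
  and h agree there. This gives gradients to functions known by a formula only on a Zariski open
  set.\<close>

lemma has_gradient_cong:
  assumes f: "has_gradient n f D v" and d: "d \<in> polyfun n" "d v \<noteq> 0"
    and eq: "\<And>u. u \<in> carrier_vec n \<Longrightarrow> d u \<noteq> 0 \<Longrightarrow> f u = h u"
  shows "has_gradient n h D v"
  unfolding has_gradient_def
proof (intro conjI allI impI)
  fix c c' assume c: "\<forall>t. c t \<in> carrier_vec n" "c 0 = v"
    "\<forall>i<n. ((\<lambda>t. c t $ i) has_field_derivative c' i) (at (0::complex))"
  have v: "v \<in> carrier_vec n" using f by (simp add: has_gradient_def)
  obtain E where E: "has_gradient n d E v" using polyfun_has_gradient[OF d(1) v] by blast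
  have "isCont (\<lambda>t. d (c t)) 0"
    by (rule DERIV_isCont) (use E c in \<open>auto simp: has_gradient_def\<close>)
  then have "\<forall>\<^sub>F t in nhds 0. d (c t) \<noteq> 0"
    using d(2) c(2) t1_space_nhds[of "d (c 0)" 0] by (auto simp: isCont_def eventually_nhds_conv_at
      intro: tendsto_imp_eventually_ne)
  then have "\<forall>\<^sub>F t in nhds 0. f (c t) = h (c t)"
    by eventually_elim (use c eq in auto)
  moreover have "((\<lambda>t. f (c t)) has_field_derivative (\<Sum>i<n. D i * c' i)) (at 0)"
    using f c by (auto simp: has_gradient_def)
  ultimately show "((\<lambda>t. h (c t)) has_field_derivative (\<Sum>i<n. D i * c' i)) (at 0)"
    by (simp add: DERIV_cong_ev[OF refl _ refl])
qed (use f in \<open>auto simp: has_gradient_def\<close>)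

lemma has_gradient_cong_carrier:
  assumes "has_gradient n f D v" "\<And>u. u \<in> carrier_vec n \<Longrightarrow> f u = h u"
  shows "has_gradient n h D v"
  by (rule has_gradient_cong[OF assms(1), of "\<lambda>_. 1"]) (use assms in \<open>auto intro: polyfun.intros\<close>)

lemma has_gradient_partial_deriv:
  assumes "has_gradient n f D v" "i < n"
  shows "partial_deriv i f v = D i"
proof -
  have v: "v \<in> carrier_vec n" using assms by (simp add: has_gradient_def)
  have "((\<lambda>t. f (v + t \<cdot>\<^sub>v unit_vec n i)) has_field_derivative (\<Sum>j<n. D j * of_bool (j = i))) (at 0)"
    using assms(1) v unfolding has_gradient_def
    by (elim conjE allE[of _ "\<lambda>t. v + t \<cdot>\<^sub>v unit_vec n i"] allE[of _ "\<lambda>j. of_bool (j = i)"])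
      (use assms(2) in \<open>auto intro!: derivative_eq_intros simp: unit_vec_def\<close>)
  then show ?thesis using v assms(2) unfolding partial_deriv_def
    by (auto simp: of_bool_def if_distrib[of "\<lambda>x. _ * x"] sum.delta DERIV_imp_deriv cong: if_cong)
qed

lemma has_gradient_polyfun: "f \<in> polyfun n \<Longrightarrow> v \<in> carrier_vec n \<Longrightarrow>
    has_gradient n f (\<lambda>i. partial_deriv i f v) v"
proof -
  assume "f \<in> polyfun n" "v \<in> carrier_vec n"
  then obtain D where D: "has_gradient n f D v" using polyfun_has_gradient by blast
  have "(\<Sum>i<n. D i * c' i) = (\<Sum>i<n. partial_deriv i f v * c' i)" for c'
    using has_gradient_partial_deriv[OF D] by (intro sum.cong) auto
  then show ?thesis using D unfolding has_gradient_def by simp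
qed

lemma has_gradient_rational:
  assumes "a \<in> polyfun n" "d \<in> polyfun n" "v \<in> carrier_vec n" "d v \<noteq> 0"
    and "\<And>u. u \<in> carrier_vec n \<Longrightarrow> d u \<noteq> 0 \<Longrightarrow> f u = a u / d u"
  obtains D where "has_gradient n f D v"
proof -
  have "has_gradient n (\<lambda>u. a u * inverse (d u)) (\<lambda>i. a v * (- partial_deriv i d v / (d v)\<^sup>2)
      + inverse (d v) * partial_deriv i a v) v"
    using has_gradient_mult[OF has_gradient_polyfun has_gradient_inverse[OF has_gradient_polyfun]]
      assms by blast
  from has_gradient_cong[OF this assms(2,4), of f] show ?thesis
    using that assms(5) by (simp add: divide_inverse)
qed

text \<open>The Jacobi identity differentiates brackets, so the brackets of polynomial functions
  have to be polynomial again.\<close>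

lemma polyfun_partial_deriv:
  assumes "f \<in> polyfun n" "i < n"
  shows "\<exists>a \<in> polyfun n. \<forall>v \<in> carrier_vec n. partial_deriv i f v = a v"
  using assms(1)
proof induction
  case (const c)
  show ?case using has_gradient_partial_deriv[OF has_gradient_const assms(2)]
    by (intro bexI[of _ "\<lambda>_. 0"] ballI) (auto intro: polyfun.intros)
next
  case (coord j)
  show ?case using has_gradient_partial_deriv[OF has_gradient_coord assms(2)] coord
    by (intro bexI[of _ "\<lambda>_. of_bool (i = j)"] ballI) (auto intro: polyfun.intros)
next
  case (add f h)
  then obtain a b where "a \<in> polyfun n" "\<forall>v \<in> carrier_vec n. partial_deriv i f v = a v"
    "b \<in> polyfun n" "\<forall>v \<in> carrier_vec n. partial_deriv i h v = b v" by blast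
  then show ?case using add has_gradient_partial_deriv[OF has_gradient_add[OF
        has_gradient_polyfun has_gradient_polyfun] assms(2), of f _ h]
    by (intro bexI[of _ "\<lambda>v. a v + b v"]) (auto intro: polyfun.intros)
next
  case (mult f h)
  then obtain a b where "a \<in> polyfun n" "\<forall>v \<in> carrier_vec n. partial_deriv i f v = a v"
    "b \<in> polyfun n" "\<forall>v \<in> carrier_vec n. partial_deriv i h v = b v" by blast
  then show ?case using mult has_gradient_partial_deriv[OF has_gradient_mult[OF
        has_gradient_polyfun has_gradient_polyfun] assms(2), of f _ h]
    by (intro bexI[of _ "\<lambda>v. f v * b v + h v * a v"]) (auto intro: polyfun.intros)
qed

section \<open>Brackets defined by a bivector\<close>

text \<open>Members of \<open>polyfun\<close> are fixed total functions, whereas bivector entries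
  and partial derivatives are known to be polynomial only on \<open>carrier_vec n\<close>; this
  closes \<open>polyfun\<close> under agreement there.\<close>

definition poly_on :: "nat \<Rightarrow> cfun \<Rightarrow> bool" where
  "poly_on n f \<longleftrightarrow> (\<exists>a \<in> polyfun n. \<forall>v \<in> carrier_vec n. f v = a v)"

lemma poly_on_polyfun: "f \<in> polyfun n \<Longrightarrow> poly_on n f"
  unfolding poly_on_def by blast

lemma poly_on_cong:
  assumes "poly_on n f" "\<And>v. v \<in> carrier_vec n \<Longrightarrow> h v = f v"
  shows "poly_on n h"
  using assms unfolding poly_on_def by simp

lemma poly_on_add: "poly_on n f \<Longrightarrow> poly_on n h \<Longrightarrow> poly_on n (\<lambda>v. f v + h v)"
  unfolding poly_on_def by (elim bexE, rule_tac x = "\<lambda>v. a v + aa v" in bexI) (auto intro: polyfun_intros)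

lemma poly_on_mult: "poly_on n f \<Longrightarrow> poly_on n h \<Longrightarrow> poly_on n (\<lambda>v. f v * h v)"
  unfolding poly_on_def by (elim bexE, rule_tac x = "\<lambda>v. a v * aa v" in bexI) (auto intro: polyfun_intros)

lemma poly_on_sum: "(\<And>i. i \<in> I \<Longrightarrow> poly_on n (f i)) \<Longrightarrow> poly_on n (\<lambda>v. \<Sum>i\<in>I. f i v)"
  by (induction I rule: infinite_finite_induct)
    (auto intro: poly_on_add poly_on_polyfun polyfun.intros)

lemma partial_deriv_cong:
  assumes "\<And>u. u \<in> carrier_vec n \<Longrightarrow> f u = h u" "v \<in> carrier_vec n"
  shows "partial_deriv i f v = partial_deriv i h v"
  unfolding partial_deriv_def using assms by (intro arg_cong2[where f = deriv]) auto

lemma poly_on_partial_deriv: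
  assumes "poly_on n f" "i < n"
  shows "poly_on n (partial_deriv i f)"
proof -
  obtain a where a: "a \<in> polyfun n" "\<And>u. u \<in> carrier_vec n \<Longrightarrow> f u = a u"
    using assms(1) unfolding poly_on_def by blast
  have "poly_on n (partial_deriv i a)"
    using polyfun_partial_deriv[OF a(1) assms(2)] unfolding poly_on_def .
  then show ?thesis by (rule poly_on_cong) (rule partial_deriv_cong[OF a(2)])
qed

lemma has_gradient_poly_on:
  assumes "poly_on n f" "v \<in> carrier_vec n"
  shows "has_gradient n f (\<lambda>i. partial_deriv i f v) v"
proof -
  obtain a where a: "a \<in> polyfun n" "\<And>u. u \<in> carrier_vec n \<Longrightarrow> f u = a u"
    using assms(1) unfolding poly_on_def by blast
  have "has_gradient n f (\<lambda>i. partial_deriv i a v) v"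
    by (rule has_gradient_cong_carrier[OF has_gradient_polyfun]) (use a assms in auto)
  then show ?thesis using partial_deriv_cong[of n f a, OF a(2) assms(2)] by simp
qed

text \<open>Covectors are arbitrary coefficient functions, so this form is bilinear without any
  differentiability condition; \<open>bracket_eq_pair\<close> connects it with brackets of
  functions.\<close>

definition pair ::
    "nat \<Rightarrow> (nat \<Rightarrow> nat \<Rightarrow> cfun) \<Rightarrow> complex Matrix.vec \<Rightarrow> (nat \<Rightarrow> complex) \<Rightarrow> (nat \<Rightarrow> complex) \<Rightarrow> complex"
  where "pair n \<pi> v \<alpha> \<beta> = (\<Sum>i<n. \<Sum>j<n. \<pi> i j v * \<alpha> i * \<beta> j)"

lemma bracket_eq_pair:
  "has_gradient n f D v \<Longrightarrow> has_gradient n h E v \<Longrightarrow> bracket n \<pi> f h v = pair n \<pi> v D E"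
  unfolding bracket_def pair_def
  by (intro sum.cong refl) (simp add: has_gradient_partial_deriv)

lemma pair_add_left: "pair n \<pi> v (\<lambda>i. \<alpha> i + \<alpha>' i) \<beta> = pair n \<pi> v \<alpha> \<beta> + pair n \<pi> v \<alpha>' \<beta>"
  by (simp add: pair_def ring_distribs sum.distrib)

lemma pair_add_right: "pair n \<pi> v \<alpha> (\<lambda>i. \<beta> i + \<beta>' i) = pair n \<pi> v \<alpha> \<beta> + pair n \<pi> v \<alpha> \<beta>'"
  by (simp add: pair_def ring_distribs sum.distrib)

lemma pair_smult_left: "pair n \<pi> v (\<lambda>i. c * \<alpha> i) \<beta> = c * pair n \<pi> v \<alpha> \<beta>"
  by (simp add: pair_def sum_distrib_left algebra_simps)

lemma pair_smult_right: "pair n \<pi> v \<alpha> (\<lambda>i. c * \<beta> i) = c * pair n \<pi> v \<alpha> \<beta>"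
  by (simp add: pair_def sum_distrib_left algebra_simps)

lemma pair_sum_left: "pair n \<pi> v (\<lambda>i. \<Sum>k\<in>K. c k * \<alpha> k i) \<beta> = (\<Sum>k\<in>K. c k * pair n \<pi> v (\<alpha> k) \<beta>)"
proof (induction K rule: infinite_finite_induct)
  case (insert k K)
  then show ?case by (simp add: pair_add_left pair_smult_left)
qed (simp_all add: pair_def)

lemma pair_sum_right: "pair n \<pi> v \<alpha> (\<lambda>i. \<Sum>k\<in>K. c k * \<beta> k i) = (\<Sum>k\<in>K. c k * pair n \<pi> v \<alpha> (\<beta> k))"
proof (induction K rule: infinite_finite_induct)
  case (insert k K)
  then show ?case by (simp add: pair_add_right pair_smult_right)
qed (simp_all add: pair_def)

lemma pair_of_bool_right:
  "k < n \<Longrightarrow> pair n \<pi> v \<alpha> (\<lambda>i. of_bool (i = k)) = (\<Sum>i<n. \<pi> i k v * \<alpha> i)"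
  by (simp add: pair_def of_bool_def if_distrib[of "\<lambda>x. _ * x"] sum.delta cong: if_cong)

lemma pair_of_bool:
  "i < n \<Longrightarrow> j < n \<Longrightarrow> pair n \<pi> v (\<lambda>k. of_bool (k = i)) (\<lambda>k. of_bool (k = j)) = \<pi> i j v"
  by (subst pair_of_bool_right) (simp_all add: of_bool_def if_distrib[of "\<lambda>x. _ * x"] sum.delta cong: if_cong)

lemma pair_cong:
  assumes "\<And>i. i < n \<Longrightarrow> \<alpha> i = \<alpha>' i" "\<And>i. i < n \<Longrightarrow> \<beta> i = \<beta>' i"
  shows "pair n \<pi> v \<alpha> \<beta> = pair n \<pi> v \<alpha>' \<beta>'"
  unfolding pair_def by (intro sum.cong refl) (use assms in simp)

lemma sum_rotate:
  "(\<Sum>k\<in>C. \<Sum>i\<in>A. \<Sum>j\<in>B. f i j k) = (\<Sum>i\<in>A. \<Sum>j\<in>B. \<Sum>k\<in>C. f i j k)"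
  by (subst sum.swap) (intro sum.cong refl sum.swap)

locale polynomial_bivector =
  fixes n :: nat and \<pi> :: "nat \<Rightarrow> nat \<Rightarrow> cfun"
  assumes entries: "\<And>i j. i < n \<Longrightarrow> j < n \<Longrightarrow> poly_on n (\<pi> i j)"
    and antisym: "\<And>i j v. i < n \<Longrightarrow> j < n \<Longrightarrow> v \<in> carrier_vec n \<Longrightarrow> \<pi> i j v = - \<pi> j i v"
begin

lemma pair_antisym:
  assumes "v \<in> carrier_vec n"
  shows "pair n \<pi> v \<alpha> \<beta> = - pair n \<pi> v \<beta> \<alpha>"
proof -
  have "pair n \<pi> v \<alpha> \<beta> = (\<Sum>j<n. \<Sum>i<n. \<pi> i j v * \<alpha> i * \<beta> j)"
    unfolding pair_def by (rule sum.swap)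
  also have "\<dots> = (\<Sum>j<n. \<Sum>i<n. - (\<pi> j i v * \<beta> j * \<alpha> i))"
  proof (intro sum.cong refl)
    fix i j assume "j \<in> {..<n}" "i \<in> {..<n}"
    then show "\<pi> i j v * \<alpha> i * \<beta> j = - (\<pi> j i v * \<beta> j * \<alpha> i)"
      using antisym[of i j v] assms by simp
  qed
  finally show ?thesis by (simp add: pair_def sum_negf)
qed

lemma pair_self: "v \<in> carrier_vec n \<Longrightarrow> pair n \<pi> v \<alpha> \<alpha> = 0"
  using pair_antisym[of v \<alpha> \<alpha>] by simp

lemma bracket_antisym: "v \<in> carrier_vec n \<Longrightarrow> bracket n \<pi> f h v = - bracket n \<pi> h f v"
  using pair_antisym[of v "\<lambda>i. partial_deriv i f v" "\<lambda>i. partial_deriv i h v"]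
  by (simp add: bracket_def pair_def)

lemma poly_on_bracket: "poly_on n f \<Longrightarrow> poly_on n h \<Longrightarrow> poly_on n (bracket n \<pi> f h)"
  unfolding bracket_def[abs_def]
  by (intro poly_on_sum poly_on_mult poly_on_partial_deriv entries) auto

lemma bracket_cong:
  "(\<And>u. u \<in> carrier_vec n \<Longrightarrow> f u = f' u) \<Longrightarrow> v \<in> carrier_vec n \<Longrightarrow>
    bracket n \<pi> f h v = bracket n \<pi> f' h v"
  unfolding bracket_def using partial_deriv_cong[of n f f' v] by simp

lemma bracket_add:
  assumes "poly_on n f" "poly_on n f'" "poly_on n h" "v \<in> carrier_vec n"
  shows "bracket n \<pi> (\<lambda>v. f v + f' v) h v = bracket n \<pi> f h v + bracket n \<pi> f' h v"
  using bracket_eq_pair[OF has_gradient_add[OF has_gradient_poly_on has_gradient_poly_on]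
      has_gradient_poly_on] bracket_eq_pair[OF has_gradient_poly_on has_gradient_poly_on] assms
  by (simp add: pair_add_left)

lemma bracket_mult:
  assumes "poly_on n f" "poly_on n f'" "poly_on n h" "v \<in> carrier_vec n"
  shows "bracket n \<pi> (\<lambda>v. f v * f' v) h v = f v * bracket n \<pi> f' h v + f' v * bracket n \<pi> f h v"
  using bracket_eq_pair[OF has_gradient_mult[OF has_gradient_poly_on has_gradient_poly_on]
      has_gradient_poly_on] bracket_eq_pair[OF has_gradient_poly_on has_gradient_poly_on] assms
  by (simp add: pair_add_left pair_smult_left)

lemma bracket_const: "v \<in> carrier_vec n \<Longrightarrow> bracket n \<pi> (\<lambda>v. c) h v = 0"
  unfolding bracket_def using has_gradient_partial_deriv[OF has_gradient_const] by simp

section \<open>The Jacobiator as a derivation in each argument\<close>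

definition jacobiator :: "cfun \<Rightarrow> cfun \<Rightarrow> cfun \<Rightarrow> cfun" where
  "jacobiator f h k v = bracket n \<pi> (bracket n \<pi> f h) k v + bracket n \<pi> (bracket n \<pi> h k) f v
     + bracket n \<pi> (bracket n \<pi> k f) h v"

lemma jacobiator_rotate: "jacobiator f h k v = jacobiator h k f v"
  by (simp add: jacobiator_def)

lemma jacobiator_const:
  assumes "poly_on n h" "poly_on n k" "v \<in> carrier_vec n"
  shows "jacobiator (\<lambda>v. c) h k v = 0"
proof -
  have 1: "bracket n \<pi> (\<lambda>v. c) h u = 0" "bracket n \<pi> k (\<lambda>v. c) u = 0" if "u \<in> carrier_vec n" for u
    using that bracket_const bracket_antisym[of u k] by auto
  show ?thesis
    unfolding jacobiator_def using assms(3) 1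
    by (simp add: bracket_cong[of "bracket n \<pi> (\<lambda>v. c) h" "\<lambda>v. 0"] bracket_const
        bracket_cong[of "bracket n \<pi> k (\<lambda>v. c)" "\<lambda>v. 0"]
        bracket_antisym[of v "bracket n \<pi> h k"])
qed

lemma jacobiator_add:
  assumes f: "poly_on n f" "poly_on n f'" and h: "poly_on n h" "poly_on n k"
    and v: "v \<in> carrier_vec n"
  shows "jacobiator (\<lambda>v. f v + f' v) h k v = jacobiator f h k v + jacobiator f' h k v"
proof -
  note p = f h poly_on_bracket poly_on_add
  have "bracket n \<pi> (bracket n \<pi> (\<lambda>v. f v + f' v) h) k v
      = bracket n \<pi> (bracket n \<pi> f h) k v + bracket n \<pi> (bracket n \<pi> f' h) k v"
    using v by (subst bracket_cong[of _ "\<lambda>v. bracket n \<pi> f h v + bracket n \<pi> f' h v"])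
      (simp_all add: bracket_add p)
  moreover have "bracket n \<pi> (bracket n \<pi> k (\<lambda>v. f v + f' v)) h v
      = bracket n \<pi> (bracket n \<pi> k f) h v + bracket n \<pi> (bracket n \<pi> k f') h v"
    using v by (subst bracket_cong[of _ "\<lambda>v. bracket n \<pi> k f v + bracket n \<pi> k f' v"])
      (simp_all add: bracket_add p bracket_antisym[of _ k])
  moreover have "bracket n \<pi> (bracket n \<pi> h k) (\<lambda>v. f v + f' v) v
      = bracket n \<pi> (bracket n \<pi> h k) f v + bracket n \<pi> (bracket n \<pi> h k) f' v"
    using v by (simp add: bracket_add p bracket_antisym[of _ "bracket n \<pi> h k"])
  ultimately show ?thesis by (simp add: jacobiator_def)
qed

text \<open>No nested bracket is a derivation by itself: cross terms such as
  \<open>{f, h} {f', k}\<close> arise. They occur in \<open>{{f f', h}, k}\<close> and in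
  \<open>{{k, f f'}, h}\<close> with opposite signs and cancel in the cyclic sum.\<close>

lemma jacobiator_mult:
  assumes f: "poly_on n f" "poly_on n f'" and h: "poly_on n h" "poly_on n k"
    and v: "v \<in> carrier_vec n"
  shows "jacobiator (\<lambda>v. f v * f' v) h k v = f v * jacobiator f' h k v + f' v * jacobiator f h k v"
proof -
  note p = f h poly_on_bracket poly_on_add poly_on_mult
  have "bracket n \<pi> (bracket n \<pi> (\<lambda>v. f v * f' v) h) k v
      = bracket n \<pi> (\<lambda>v. f v * bracket n \<pi> f' h v + f' v * bracket n \<pi> f h v) k v"
    using v by (intro bracket_cong) (simp_all add: bracket_mult p)
  moreover have "bracket n \<pi> (bracket n \<pi> k (\<lambda>v. f v * f' v)) h v
      = bracket n \<pi> (\<lambda>v. f v * bracket n \<pi> k f' v + f' v * bracket n \<pi> k f v) h v"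
    using v by (intro bracket_cong) (simp_all add: bracket_mult p bracket_antisym[of _ k])
  moreover have "bracket n \<pi> (bracket n \<pi> h k) (\<lambda>v. f v * f' v) v
      = f v * bracket n \<pi> (bracket n \<pi> h k) f' v + f' v * bracket n \<pi> (bracket n \<pi> h k) f v"
    using v by (simp add: bracket_mult p bracket_antisym[of _ "bracket n \<pi> h k"])
  moreover have "bracket n \<pi> k f v = - bracket n \<pi> f k v" "bracket n \<pi> k f' v = - bracket n \<pi> f' k v"
    using v bracket_antisym by blast+
  ultimately show ?thesis using v
    by (simp add: jacobiator_def bracket_add bracket_mult p algebra_simps)
qed

lemma jacobiator_zero_closed:
  assumes "poly_on n h" "poly_on n k" "v \<in> carrier_vec n"
    and "\<And>i. i < n \<Longrightarrow> jacobiator (\<lambda>v. v $ i) h k v = 0" and "f \<in> polyfun n"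
  shows "jacobiator f h k v = 0"
  using assms(5)
  by induction (simp_all add: assms jacobiator_const jacobiator_add jacobiator_mult poly_on_polyfun)

lemma bracket_coord:
  "i < n \<Longrightarrow> j < n \<Longrightarrow> v \<in> carrier_vec n \<Longrightarrow> bracket n \<pi> (\<lambda>v. v $ i) (\<lambda>v. v $ j) v = \<pi> i j v"
  by (simp add: bracket_eq_pair[OF has_gradient_coord has_gradient_coord] pair_of_bool)

text \<open>The components of the Jacobiator on three coordinate functions, which are up to a
  constant factor those of the Schouten bracket of \<pi> with itself.\<close>

definition jac :: "nat \<Rightarrow> nat \<Rightarrow> nat \<Rightarrow> complex Matrix.vec \<Rightarrow> complex" where
  "jac i j k v = (\<Sum>l<n. partial_deriv l (\<pi> i j) v * \<pi> l k v + partial_deriv l (\<pi> j k) v * \<pi> l i v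
     + partial_deriv l (\<pi> k i) v * \<pi> l j v)"

lemma bracket_entry_coord:
  assumes "i < n" "j < n" "k < n" "v \<in> carrier_vec n"
  shows "bracket n \<pi> (bracket n \<pi> (\<lambda>v. v $ i) (\<lambda>v. v $ j)) (\<lambda>v. v $ k) v
    = (\<Sum>l<n. partial_deriv l (\<pi> i j) v * \<pi> l k v)"
proof -
  have "bracket n \<pi> (bracket n \<pi> (\<lambda>v. v $ i) (\<lambda>v. v $ j)) (\<lambda>v. v $ k) v
      = bracket n \<pi> (\<pi> i j) (\<lambda>v. v $ k) v"
    by (rule bracket_cong) (simp_all add: assms bracket_coord)
  also have "\<dots> = (\<Sum>l<n. \<pi> l k v * partial_deriv l (\<pi> i j) v)"
    using assms entries
    by (simp add: bracket_eq_pair[OF has_gradient_poly_on has_gradient_coord] pair_of_bool_right)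
  finally show ?thesis by (simp add: mult.commute)
qed

lemma poisson_structureI:
  assumes "\<And>i j k v. i < n \<Longrightarrow> j < n \<Longrightarrow> k < n \<Longrightarrow> v \<in> carrier_vec n \<Longrightarrow> jac i j k v = 0"
  shows "poisson_structure n \<pi>"
  unfolding poisson_structure_def
proof (intro conjI allI impI ballI)
  fix i j assume "i < n" "j < n"
  then show "\<exists>a\<in>polyfun n. \<forall>v\<in>carrier_vec n. \<pi> i j v = a v"
    using entries unfolding poly_on_def by blast
next
  fix f h :: cfun and v :: "complex Matrix.vec" assume "v \<in> carrier_vec n"
  then show "bracket n \<pi> f h v = - bracket n \<pi> h f v" by (rule bracket_antisym)
next
  fix f h k :: cfun and v :: "complex Matrix.vec" assume f: "f \<in> polyfun n" "h \<in> polyfun n" "k \<in> polyfun n" and v: "v \<in> carrier_vec n"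
  have c: "jacobiator (\<lambda>v. v $ i) (\<lambda>v. v $ j) (\<lambda>v. v $ l) v = 0" if "i < n" "j < n" "l < n" for i j l
    using assms[OF that v] that v by (simp add: jacobiator_def bracket_entry_coord jac_def sum.distrib)
  \<comment> \<open>Each round replaces the coordinate in the first argument by an arbitrary
    polynomial and then rotates the next coordinate into that place.\<close>
  have "jacobiator f (\<lambda>v. v $ j) (\<lambda>v. v $ l) v = 0" if "j < n" "l < n" for j l
    by (rule jacobiator_zero_closed) (use f v c that in \<open>auto intro: poly_on_polyfun polyfun.intros\<close>)
  then have "jacobiator (\<lambda>v. v $ j) (\<lambda>v. v $ l) f v = 0" if "j < n" "l < n" for j l
    using that jacobiator_rotate[of f "\<lambda>v. v $ j" "\<lambda>v. v $ l" v] by simp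
  then have "jacobiator h (\<lambda>v. v $ l) f v = 0" if "l < n" for l
    by - (rule jacobiator_zero_closed, use f v that in \<open>auto intro: poly_on_polyfun polyfun.intros\<close>)
  then have "jacobiator (\<lambda>v. v $ l) f h v = 0" if "l < n" for l
    using that jacobiator_rotate[of h "\<lambda>v. v $ l" f v] by simp
  then have "jacobiator k f h v = 0"
    by - (rule jacobiator_zero_closed, use f v in \<open>auto intro: poly_on_polyfun polyfun.intros\<close>)
  then have "jacobiator f h k v = 0"
    using jacobiator_rotate[of k f h v] by simp
  then show "bracket n \<pi> (bracket n \<pi> f h) k v + bracket n \<pi> (bracket n \<pi> h k) f v
      + bracket n \<pi> (bracket n \<pi> k f) h v = 0"
    by (simp add: jacobiator_def)
qed

lemma partial_deriv_pair:
  assumes "has_gradient n (\<lambda>u. pair n \<pi> u \<alpha> \<beta>) D v" "l < n"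
  shows "D l = (\<Sum>i<n. \<Sum>j<n. partial_deriv l (\<pi> i j) v * \<alpha> i * \<beta> j)"
proof -
  have v: "v \<in> carrier_vec n" using has_gradient_carrier[OF assms(1)] .
  have g: "has_gradient n (\<lambda>u. \<Sum>i\<in>I. f i u) (\<lambda>l. \<Sum>i\<in>I. E i l) v"
    if "\<And>i. i \<in> I \<Longrightarrow> has_gradient n (f i) (E i) v" for I :: "nat set" and f E
    using that by (induction I rule: infinite_finite_induct)
      (auto intro: has_gradient_const[OF v] has_gradient_add)
  have m: "has_gradient n (\<lambda>u. \<pi> i j u * \<alpha> i * \<beta> j) (\<lambda>l. partial_deriv l (\<pi> i j) v * \<alpha> i * \<beta> j) v"
    if "i < n" "j < n" for i j
    using has_gradient_mult[OF has_gradient_poly_on[OF entries[OF that] v]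
        has_gradient_const[OF v, of "\<alpha> i * \<beta> j"]]
    by (simp add: mult_ac)
  have "has_gradient n (\<lambda>u. pair n \<pi> u \<alpha> \<beta>)
      (\<lambda>l. \<Sum>i<n. \<Sum>j<n. partial_deriv l (\<pi> i j) v * \<alpha> i * \<beta> j) v"
    unfolding pair_def by (intro g m) auto
  from has_gradient_partial_deriv[OF this assms(2)] has_gradient_partial_deriv[OF assms]
  show ?thesis by simp
qed

lemma pair_gradient_pair:
  assumes "has_gradient n (\<lambda>u. pair n \<pi> u \<alpha> \<beta>) D v"
  shows "pair n \<pi> v D \<gamma> = (\<Sum>i<n. \<Sum>j<n. \<Sum>k<n. \<alpha> i * \<beta> j * \<gamma> k *
    (\<Sum>l<n. partial_deriv l (\<pi> i j) v * \<pi> l k v))"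
proof -
  have "pair n \<pi> v D \<gamma>
      = (\<Sum>l<n. \<Sum>k<n. \<Sum>i<n. \<Sum>j<n. \<alpha> i * \<beta> j * \<gamma> k * (partial_deriv l (\<pi> i j) v * \<pi> l k v))"
    unfolding pair_def
    by (intro sum.cong refl)
      (simp add: partial_deriv_pair[OF assms] sum_distrib_left sum_distrib_right mult_ac)
  also have "\<dots> = (\<Sum>l<n. \<Sum>i<n. \<Sum>j<n. \<Sum>k<n. \<alpha> i * \<beta> j * \<gamma> k * (partial_deriv l (\<pi> i j) v * \<pi> l k v))"
    by (intro sum.cong refl sum_rotate)
  also have "\<dots> = (\<Sum>i<n. \<Sum>l<n. \<Sum>j<n. \<Sum>k<n. \<alpha> i * \<beta> j * \<gamma> k * (partial_deriv l (\<pi> i j) v * \<pi> l k v))"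
    by (rule sum.swap)
  also have "\<dots> = (\<Sum>i<n. \<Sum>j<n. \<Sum>k<n. \<Sum>l<n. \<alpha> i * \<beta> j * \<gamma> k * (partial_deriv l (\<pi> i j) v * \<pi> l k v))"
    by (intro sum.cong refl sum_rotate)
  finally show ?thesis by (simp only: sum_distrib_left)
qed

text \<open>For constant covectors both sides are the Jacobiator of the three linear functions with
  differentials \<alpha>, \<beta>, \<gamma>. The Jacobi identity thereby becomes the vanishing of a
  trilinear form, which may be tested on any spanning set of covectors.\<close>

lemma jac_trilinear:
  assumes "has_gradient n (\<lambda>u. pair n \<pi> u \<alpha> \<beta>) D1 v"
    and "has_gradient n (\<lambda>u. pair n \<pi> u \<beta> \<gamma>) D2 v"
    and "has_gradient n (\<lambda>u. pair n \<pi> u \<gamma> \<alpha>) D3 v"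
  shows "(\<Sum>i<n. \<Sum>j<n. \<Sum>k<n. \<alpha> i * \<beta> j * \<gamma> k * jac i j k v)
    = pair n \<pi> v D1 \<gamma> + pair n \<pi> v D2 \<alpha> + pair n \<pi> v D3 \<beta>"
proof -
  define t where "t = (\<lambda>i j k. \<Sum>l<n. partial_deriv l (\<pi> i j) v * \<pi> l k v)"
  have 1: "pair n \<pi> v D1 \<gamma> = (\<Sum>i<n. \<Sum>j<n. \<Sum>k<n. \<alpha> i * \<beta> j * \<gamma> k * t i j k)"
    unfolding pair_gradient_pair[OF assms(1)] t_def ..
  have "pair n \<pi> v D2 \<alpha> = (\<Sum>j<n. \<Sum>k<n. \<Sum>i<n. \<alpha> i * \<beta> j * \<gamma> k * t j k i)"
    unfolding pair_gradient_pair[OF assms(2)] t_def by (intro sum.cong refl) (simp only: mult_ac)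
  also have "\<dots> = (\<Sum>i<n. \<Sum>j<n. \<Sum>k<n. \<alpha> i * \<beta> j * \<gamma> k * t j k i)"
    by (rule sum_rotate[symmetric])
  finally have 2: "pair n \<pi> v D2 \<alpha> = \<dots>" .
  have "pair n \<pi> v D3 \<beta> = (\<Sum>k<n. \<Sum>i<n. \<Sum>j<n. \<alpha> i * \<beta> j * \<gamma> k * t k i j)"
    unfolding pair_gradient_pair[OF assms(3)] t_def by (intro sum.cong refl) (simp only: mult_ac)
  also have "\<dots> = (\<Sum>i<n. \<Sum>j<n. \<Sum>k<n. \<alpha> i * \<beta> j * \<gamma> k * t k i j)" by (rule sum_rotate)
  finally have 3: "pair n \<pi> v D3 \<beta> = \<dots>" .
  have "jac i j k v = t i j k + t j k i + t k i j" for i j k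
    by (simp only: jac_def t_def sum.distrib)
  then show ?thesis unfolding 1 2 3 by (simp only: sum.distrib ring_distribs)
qed

end

section \<open>Bivariate generating functions\<close>

lemma coeff_xy_simps [simp]:
  "coeff_xy 0 i j = 0"
  "coeff_xy (A + B) i j = coeff_xy A i j + coeff_xy B i j"
  "coeff_xy (A - B) i j = coeff_xy A i j - coeff_xy B i j"
  "coeff_xy (- A) i j = - coeff_xy A i j"
  by (simp_all add: coeff_xy_def)

lemma coeff_in_y: "coeff (in_y h) j = [:coeff h j:]"
  by (simp add: in_y_def coeff_map_poly)

lemma coeff_xy_in_x_in_y [simp]: "coeff_xy (in_x f * in_y h) i j = coeff f i * coeff h j"
  by (simp add: coeff_xy_def in_x_def coeff_in_y)

lemma coeff_xy_in_y_in_x [simp]: "coeff_xy (in_y h * in_x f) i j = coeff f i * coeff h j"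
  using coeff_xy_in_x_in_y by (simp add: mult.commute)

lemma coeff_xy_var_x: "coeff_xy (var_x * B) i j = (case i of 0 \<Rightarrow> 0 | Suc i \<Rightarrow> coeff_xy B i j)"
  by (simp add: coeff_xy_def var_x_def coeff_pCons split: nat.splits)

lemma coeff_xy_var_y: "coeff_xy (var_y * B) i j = (case j of 0 \<Rightarrow> 0 | Suc j \<Rightarrow> coeff_xy B i j)"
  by (simp add: coeff_xy_def var_y_def coeff_pCons split: nat.splits)

lemma var_diff_nonzero: "var_x - var_y \<noteq> 0"
proof
  assume "var_x - var_y = 0"
  then have "coeff_xy (var_x * 1) 1 0 = coeff_xy (var_y * 1) 1 0" by simp
  then show False unfolding coeff_xy_var_x coeff_xy_var_y by (simp add: coeff_xy_def)
qed

lemma poly_in_y_var: "poly (in_y f) [:0, 1:] = f"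
  by (induction f) (simp_all add: in_y_def map_poly_pCons)

text \<open>The Bezoutian of f and h, out of which the brackets between different blocks are built
  once a factor x y is removed.\<close>

definition bez :: "complex poly \<Rightarrow> complex poly \<Rightarrow> complex poly poly" where
  "bez f h = (in_x f * in_y h - in_y f * in_x h) div (var_x - var_y)"

text \<open>Exactness of the division: substituting x for the outer variable kills the numerator,
  and the linear factor belonging to this root is \<open>var_x - var_y\<close> up to sign.\<close>

lemma bez_mult: "bez f h * (var_x - var_y) = in_x f * in_y h - in_y f * in_x h"
proof -
  have "poly (in_x f * in_y h - in_y f * in_x h) [:0, 1:] = 0"
    by (simp add: poly_in_y_var) (simp add: in_x_def)
  then have "[:- [:0, 1:], 1:] dvd (in_x f * in_y h - in_y f * in_x h)"
    by (rule iffD1[OF poly_eq_0_iff_dvd])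
  moreover have "[:- [:0, 1:], 1:] = - (var_x - var_y)" by (simp add: var_x_def var_y_def)
  ultimately have "var_x - var_y dvd (in_x f * in_y h - in_y f * in_x h)"
    by (metis minus_dvd_iff)
  then show ?thesis by (simp add: bez_def)
qed

lemma div_var_diff: "A = B * (var_x - var_y) \<Longrightarrow> A div (var_x - var_y) = B"
  using var_diff_nonzero by simp

lemma coeff_xy_bez_rec:
  "coeff f i * coeff h j - coeff h i * coeff f j
    = (case i of 0 \<Rightarrow> 0 | Suc i \<Rightarrow> coeff_xy (bez f h) i j) - (case j of 0 \<Rightarrow> 0 | Suc j \<Rightarrow> coeff_xy (bez f h) i j)"
proof -
  have "coeff_xy (bez f h * (var_x - var_y)) i j = coeff f i * coeff h j - coeff h i * coeff f j"
    by (simp add: bez_mult)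
  then show ?thesis
    by (simp add: right_diff_distrib mult.commute[of "bez f h"] coeff_xy_var_x coeff_xy_var_y)
qed

text \<open>The recursion runs along the antidiagonal from (i, j) to (i + 1, j - 1) and telescopes.
  Unlike the quotient, the resulting sum is visibly polynomial in the coefficients of h.\<close>

lemma coeff_xy_bez:
  "coeff_xy (bez f h) i j
    = (\<Sum>k\<le>j. coeff f (Suc (i + k)) * coeff h (j - k) - coeff h (Suc (i + k)) * coeff f (j - k))"
proof (induction j arbitrary: i)
  case 0
  show ?case using coeff_xy_bez_rec[of f "Suc i" h 0] by simp
next
  case (Suc j)
  show ?case
    using coeff_xy_bez_rec[of f "Suc i" h "Suc j"]
    by (subst sum.atMost_Suc_shift) (simp add: Suc algebra_simps)
qed

section \<open>Degree bounds and evaluation in two variables\<close>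

definition bounded_xy :: "nat \<Rightarrow> nat \<Rightarrow> complex poly poly \<Rightarrow> bool" where
  "bounded_xy m m' B \<longleftrightarrow> (\<forall>i j. i \<ge> m \<or> j \<ge> m' \<longrightarrow> coeff_xy B i j = 0)"

lemma bounded_bez:
  assumes "degree f \<le> m" "degree h \<le> m"
  shows "bounded_xy m m (bez f h)"
proof -
  have z: "coeff f i = 0" "coeff h i = 0" if "i > m" for i
    using that assms by (auto intro!: coeff_eq_0)
  have "coeff_xy (bez f h) i j = 0" if "i \<ge> m" for i j
    unfolding coeff_xy_bez using that z by (intro sum.neutral) auto
  \<comment> \<open>The closed form shows only the bound in i. For j the recursion is run in the
    other direction, down to i = 0, at exponents j + 1 > m of y where the numerator has no
    terms.\<close>
  moreover have "coeff_xy (bez f h) i j = 0" if "j \<ge> m" for i j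
    using that
  proof (induction i arbitrary: j)
    case 0
    then show ?case using coeff_xy_bez_rec[of f 0 h "Suc j"] z by simp
  next
    case (Suc i)
    then show ?case using coeff_xy_bez_rec[of f "Suc i" h "Suc j"] z[of "Suc j"] by simp
  qed
  ultimately show ?thesis unfolding bounded_xy_def by blast
qed

lemma bounded_var_y: "bounded_xy m m' B \<Longrightarrow> bounded_xy m (Suc m') (var_y * B)"
  by (auto simp: bounded_xy_def coeff_xy_var_y split: nat.splits)

lemma bounded_mono: "bounded_xy m m' B \<Longrightarrow> m' \<le> k \<Longrightarrow> bounded_xy m k B"
  by (auto simp: bounded_xy_def)

lemma bounded_diff: "bounded_xy m m' A \<Longrightarrow> bounded_xy m m' B \<Longrightarrow> bounded_xy m m' (A - B)"
  by (auto simp: bounded_xy_def)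

lemma bounded_add: "bounded_xy m m' A \<Longrightarrow> bounded_xy m m' B \<Longrightarrow> bounded_xy m m' (A + B)"
  by (auto simp: bounded_xy_def)

lemma bounded_uminus: "bounded_xy m m' B \<Longrightarrow> bounded_xy m m' (- B)"
  by (auto simp: bounded_xy_def)

lemma bounded_prod: "(\<And>i. i \<ge> m \<Longrightarrow> coeff f i = 0) \<Longrightarrow> (\<And>i. i \<ge> m' \<Longrightarrow> coeff h i = 0)
    \<Longrightarrow> bounded_xy m m' (in_x f * in_y h)"
  by (auto simp: bounded_xy_def)

definition poly_xy :: "complex poly poly \<Rightarrow> complex \<Rightarrow> complex \<Rightarrow> complex" where
  "poly_xy B x y = poly (poly B [:y:]) x"

lemma poly_xy_simps [simp]:
  "poly_xy (A + B) x y = poly_xy A x y + poly_xy B x y"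
  "poly_xy (A - B) x y = poly_xy A x y - poly_xy B x y"
  "poly_xy (A * B) x y = poly_xy A x y * poly_xy B x y"
  "poly_xy (- A) x y = - poly_xy A x y"
  "poly_xy (in_x f) x y = poly f x"
  "poly_xy var_x x y = x"
  "poly_xy var_y x y = y"
  by (simp_all add: poly_xy_def in_x_def var_x_def var_y_def)

lemma poly_xy_in_y [simp]: "poly_xy (in_y f) x y = poly f y"
  by (induction f) (simp_all add: poly_xy_def in_y_def map_poly_pCons)

lemma poly_xy_bez:
  "x \<noteq> y \<Longrightarrow> poly_xy (bez f h) x y = (poly f x * poly h y - poly f y * poly h x) / (x - y)"
  using arg_cong[OF bez_mult[of f h], of "\<lambda>B. poly_xy B x y"] by (simp add: field_simps)

lemma poly_altdef_lessThan:
  fixes p :: "'a :: comm_ring_1 poly"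
  assumes "\<And>i. i \<ge> m \<Longrightarrow> coeff p i = 0"
  shows "poly p x = (\<Sum>i<m. coeff p i * x ^ i)"
proof -
  have "poly p x = (\<Sum>i\<le>degree p. coeff p i * x ^ i)" by (rule poly_altdef)
  also have "\<dots> = (\<Sum>i\<in>{..degree p} \<union> {..<m}. coeff p i * x ^ i)"
    by (intro sum.mono_neutral_left) (auto simp: coeff_eq_0)
  also have "\<dots> = (\<Sum>i<m. coeff p i * x ^ i)"
    by (intro sum.mono_neutral_right) (use assms in auto)
  finally show ?thesis .
qed

lemma poly_xy_sum:
  assumes "bounded_xy m m' B"
  shows "poly_xy B x y = (\<Sum>i<m. (\<Sum>j<m'. coeff_xy B i j * y ^ j) * x ^ i)"
proof -
  have "coeff B j = 0" if "j \<ge> m'" for j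
    using assms that by (intro poly_eqI) (simp add: bounded_xy_def coeff_xy_def)
  then have "poly B [:y:] = (\<Sum>j<m'. coeff B j * [:y:] ^ j)"
    by (rule poly_altdef_lessThan)
  then have "poly_xy B x y = (\<Sum>j<m'. poly (coeff B j) x * y ^ j)"
    by (simp add: poly_xy_def poly_sum)
  also have "\<dots> = (\<Sum>j<m'. (\<Sum>i<m. coeff_xy B i j * x ^ i) * y ^ j)"
    using assms unfolding coeff_xy_def bounded_xy_def
    by (intro sum.cong refl arg_cong2[where f = "(*)"] poly_altdef_lessThan) auto
  also have "\<dots> = (\<Sum>i<m. (\<Sum>j<m'. coeff_xy B i j * y ^ j) * x ^ i)"
    unfolding sum_distrib_right by (subst sum.swap) (simp add: mult_ac)
  finally show ?thesis .
qed

section \<open>Coordinate blocks and evaluation covectors\<close>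

datatype block = BP | BQ | BR

fun offset :: "nat \<Rightarrow> block \<Rightarrow> nat" where
  "offset g BP = 0" | "offset g BQ = g" | "offset g BR = 2 * g"

fun len :: "nat \<Rightarrow> block \<Rightarrow> nat" where
  "len g BP = g" | "len g BQ = g" | "len g BR = Suc g"

text \<open>The constant differential of \<open>val g b\<close>, which is (P - 1) / x, (Q - 2) / x
  or R / x according to the block. Positions within a block count from 0, so that they coincide with
  exponents.\<close>

definition ev :: "nat \<Rightarrow> block \<Rightarrow> complex \<Rightarrow> nat \<Rightarrow> complex" where
  "ev g b x k = (if offset g b \<le> k \<and> k < offset g b + len g b then x ^ (k - offset g b) else 0)"

definition val :: "nat \<Rightarrow> block \<Rightarrow> complex Matrix.vec \<Rightarrow> complex \<Rightarrow> complex" where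
  "val g b v x = (\<Sum>i<len g b. v $ (offset g b + i) * x ^ i)"

lemma offset_len: "offset g b + len g b \<le> 3 * g + 1"
  by (cases b) simp_all

lemma sum_ev:
  "(\<Sum>k<3 * g + 1. F k * ev g b x k) = (\<Sum>i<len g b. F (offset g b + i) * x ^ i)"
proof -
  have "(\<Sum>k<3 * g + 1. F k * ev g b x k)
      = (\<Sum>k\<in>{offset g b..<offset g b + len g b}. F k * x ^ (k - offset g b))"
    by (rule sum.mono_neutral_cong_right) (use offset_len[of g b] in \<open>auto simp: ev_def\<close>)
  also have "\<dots> = (\<Sum>i<len g b. F (offset g b + i) * x ^ i)"
    by (rule sum.reindex_bij_witness[of _ "\<lambda>i. offset g b + i" "\<lambda>k. k - offset g b"]) auto
  finally show ?thesis .
qed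

lemma pair_ev:
  "pair (3 * g + 1) \<pi> v (ev g a x) (ev g b y)
    = (\<Sum>i<len g a. (\<Sum>j<len g b. \<pi> (offset g a + i) (offset g b + j) v * y ^ j) * x ^ i)"
proof -
  have "pair (3 * g + 1) \<pi> v (ev g a x) (ev g b y)
      = (\<Sum>i<3 * g + 1. (\<Sum>j<3 * g + 1. \<pi> i j v * ev g b y j) * ev g a x i)"
    unfolding pair_def sum_distrib_right by (intro sum.cong refl) (simp add: mult_ac)
  then show ?thesis unfolding sum_ev .
qed

lemma has_gradient_val:
  assumes "v \<in> carrier_vec (3 * g + 1)"
  shows "has_gradient (3 * g + 1) (\<lambda>v. val g b v x) (ev g b x) v"
proof -
  have "val g b u x = (\<Sum>k<3 * g + 1. u $ k * ev g b x k)" for u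
    unfolding sum_ev val_def ..
  then show ?thesis unfolding has_gradient_def using assms
    by (auto intro!: derivative_eq_intros sum.cong simp: mult_ac)
qed

text \<open>The exceptional set S is what permits identities to be checked only at points where no
  denominator vanishes.\<close>

lemma power_sum_extract:
  fixes a :: "nat \<Rightarrow> complex"
  assumes "finite S" "\<And>x. x \<notin> S \<Longrightarrow> (\<Sum>k<m. a k * x ^ k) = 0" "k < m"
  shows "a k = 0"
proof -
  define p where "p = (\<Sum>i<m. monom (a i) i)"
  have "UNIV - S \<subseteq> {x. poly p x = 0}"
    using assms(2) by (auto simp: p_def poly_sum poly_monom)
  moreover have "infinite (UNIV - S)"
    using assms(1) by (simp add: infinite_UNIV_char_0 Diff_infinite_finite)
  ultimately have "p = 0" using poly_roots_finite finite_subset by blast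
  then have "coeff p k = 0" by simp
  then show ?thesis using assms(3) by (simp add: p_def coeff_sum if_distrib sum.delta cong: if_cong)
qed

text \<open>The evaluation covectors at points outside a finite set span the dual space, because
  powers of infinitely many points separate coefficients in every block.\<close>

lemma ev_extract:
  assumes S: "finite S"
    and z: "\<And>b x. x \<notin> S \<Longrightarrow> (\<Sum>k<3 * g + 1. a k * ev g b x k) = 0"
    and k: "k < 3 * g + 1"
  shows "a k = 0"
proof -
  obtain b where b: "offset g b \<le> k" "k < offset g b + len g b"
  proof (cases "k < g")
    case True
    then show ?thesis using that[of BP] by simp
  next
    case False
    then show ?thesis using that[of BQ] that[of BR] k by (cases "k < 2 * g") auto
  qed
  have "a (offset g b + (k - offset g b)) = 0"
  proof (rule power_sum_extract[OF S, where a = "\<lambda>i. a (offset g b + i)" and m = "len g b"])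
    fix x assume "x \<notin> S"
    from z[OF this, of b] show "(\<Sum>i<len g b. a (offset g b + i) * x ^ i) = 0" unfolding sum_ev .
  qed (use b in simp)
  then show ?thesis using b by simp
qed

lemma poly_P_eq: "poly (poly_P g v) x = 1 + x * val g BP v x"
proof -
  have "(\<Sum>i = 1..g. v $ (i - 1) * x ^ i) = (\<Sum>i<g. v $ i * x ^ Suc i)"
    by (rule sum.reindex_bij_witness[of _ Suc "\<lambda>i. i - 1"]) auto
  then show ?thesis by (simp add: poly_P_def val_def poly_sum poly_monom sum_distrib_left mult_ac)
qed

lemma poly_Q_eq: "poly (poly_Q g v) x = 2 + x * val g BQ v x"
proof -
  have "(\<Sum>i = 1..g. v $ (g + i - 1) * x ^ i) = (\<Sum>i<g. v $ (g + i) * x ^ Suc i)"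
    by (rule sum.reindex_bij_witness[of _ Suc "\<lambda>i. i - 1"]) auto
  then show ?thesis by (simp add: poly_Q_def val_def poly_sum poly_monom sum_distrib_left mult_ac)
qed

lemma poly_R_eq: "poly (poly_R g v) x = x * val g BR v x"
proof -
  have "(\<Sum>i = 1..g + 1. v $ (2 * g + i - 1) * x ^ i) = (\<Sum>i<Suc g. v $ (2 * g + i) * x ^ Suc i)"
    by (rule sum.reindex_bij_witness[of _ Suc "\<lambda>i. i - 1"]) auto
  then show ?thesis by (simp add: poly_R_def val_def poly_sum poly_monom sum_distrib_left algebra_simps)
qed

lemma coeff_poly_P:
  "coeff (poly_P g v) k = (if k = 0 then 1 else if k \<le> g then v $ (k - 1) else 0)"
  by (auto simp: poly_P_def coeff_sum if_distrib sum.delta cong: if_cong)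

lemma coeff_poly_Q:
  "coeff (poly_Q g v) k = (if k = 0 then 2 else if k \<le> g then v $ (g + k - 1) else 0)"
  by (auto simp: poly_Q_def coeff_sum numeral_poly if_distrib sum.delta coeff_pCons
      split: nat.splits cong: if_cong)

lemma coeff_poly_R:
  "coeff (poly_R g v) k = (if k = 0 then 0 else if k \<le> g + 1 then v $ (2 * g + k - 1) else 0)"
  by (auto simp: poly_R_def coeff_sum if_distrib sum.delta cong: if_cong)

section \<open>The brackets in generating form\<close>

lemma in_x_simps:
  "in_x 0 = 0" "in_x 1 = 1" "in_x (pCons c h) = [:[:c:]:] + var_x * in_x h" "in_x (Polynomial.smult c h) = [:[:c:]:] * in_x h"
  by (simp_all add: in_x_def var_x_def one_pCons)

lemma in_y_simps:
  "in_y 1 = 1" "in_y (pCons c h) = [:[:c:]:] + var_y * in_y h" "in_y (Polynomial.smult c h) = [:[:c:]:] * in_y h"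
proof -
  have "in_y [:1:] = [:[:1:]:]" unfolding in_y_def by (simp add: map_poly_pCons)
  then show "in_y 1 = 1" by (simp only: one_pCons)
  show "in_y (pCons c h) = [:[:c:]:] + var_y * in_y h"
    by (simp add: in_y_def var_y_def map_poly_pCons)
  show "in_y (Polynomial.smult c h) = [:[:c:]:] * in_y h"
    by (simp add: in_y_def map_poly_smult)
qed

lemma polyfun_if: "(c \<Longrightarrow> f \<in> polyfun n) \<Longrightarrow> (\<not> c \<Longrightarrow> h \<in> polyfun n) \<Longrightarrow>
    (\<lambda>v. if c then f v else h v) \<in> polyfun n"
  by (cases c) simp_all

lemma polyfun_coeff_bez:
  assumes "\<And>k. (\<lambda>v. coeff (h v) k) \<in> polyfun n"
  shows "(\<lambda>v. coeff_xy (bez f (h v)) i j) \<in> polyfun n"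
  unfolding coeff_xy_bez by (intro polyfun_intros assms)

lemma bracket_PQ_bez: "bracket_PQ (pCons 0 f) h = var_x * (var_y * bez f h)"
proof -
  have "(in_x (pCons 0 f) * var_y * in_y h - in_y (pCons 0 f) * var_x * in_x h)
      = var_x * (var_y * (bez f h * (var_x - var_y)))"
    by (simp only: bez_mult) (simp add: in_x_simps in_y_simps algebra_simps)
  then show ?thesis unfolding bracket_PQ_def by (intro div_var_diff) (simp add: mult.assoc)
qed

lemma bracket_PR_bez: "bracket_PR (pCons 0 f) (pCons 0 h) = var_x * (var_y * - (var_y * bez f h))"
proof -
  have "in_x (pCons 0 f) * in_y (pCons 0 h) - in_y (pCons 0 f) * in_x (pCons 0 h)
      = var_x * (var_y * (bez f h * (var_x - var_y)))"
    by (simp only: bez_mult) (simp add: in_x_simps in_y_simps algebra_simps)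
  then have "(in_x (pCons 0 f) * in_y (pCons 0 h) - in_y (pCons 0 f) * in_x (pCons 0 h))
      div (var_x - var_y) = var_x * (var_y * bez f h)"
    by (intro div_var_diff) (simp add: mult.assoc)
  then show ?thesis by (simp add: bracket_PR_def mult_ac)
qed

text \<open>Neither summand of the bracket need be divisible by x, because P and Q have constant
  terms. As the constant 2 of Q is twice that of P, the two obstructions combine to 2 x y (f(x) -
  f(y)) / (x - y), which is x y times \<open>bez f [:2:]\<close>.\<close>

lemma bracket_QR_bez:
  "bracket_QR (pCons 0 f) (pCons 1 h) (pCons 2 k)
    = var_x * (var_y * (bez f [:2:] + var_y * bez f (Polynomial.smult 2 h) - in_x k * in_y f))"
  (is "?l = ?r")
proof -
  have 1: "[:[:1 :: complex:]:] = 1" by (simp only: one_pCons)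
  have 2: "[:[:2 :: complex:]:] = 2" by (simp add: numeral_poly)
  have c: "in_x [:2:] = 2" "in_y [:2:] = 2"
    "in_x (Polynomial.smult 2 h) = 2 * in_x h" "in_y (Polynomial.smult 2 h) = 2 * in_y h"
    "in_x (pCons 0 h) = var_x * in_x h" "in_y (pCons 0 h) = var_y * in_y h"
    "in_x (pCons 1 h) = 1 + var_x * in_x h" "in_y (pCons 1 h) = 1 + var_y * in_y h"
    "in_x (pCons 2 h) = 2 + var_x * in_x h" for h
    unfolding in_x_simps in_y_simps 1 2 by (simp_all add: in_y_def)
  have "?l = 2 * var_y * bez (pCons 0 f) (pCons 1 h) - in_y (pCons 0 f) * in_x (pCons 2 k)"
    by (simp add: bracket_QR_def bez_def)
  then have "?l * (var_x - var_y)
      = 2 * var_y * (bez (pCons 0 f) (pCons 1 h) * (var_x - var_y))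
        - in_y (pCons 0 f) * in_x (pCons 2 k) * (var_x - var_y)"
    by (simp add: left_diff_distrib mult.assoc)
  also have "\<dots> = var_x * (var_y * (bez f [:2:] * (var_x - var_y)
      + var_y * (bez f (Polynomial.smult 2 h) * (var_x - var_y)) - in_x k * in_y f * (var_x - var_y)))"
    unfolding bez_mult c by (simp add: in_x_simps algebra_simps)
  also have "\<dots> = ?r * (var_x - var_y)"
    by (simp only: left_diff_distrib distrib_right mult.assoc)
  finally show ?thesis using var_diff_nonzero by simp
qed

locale volterra_bracket =
  fixes g :: nat and f :: "complex poly"
  assumes degree_f: "degree f \<le> g"
begin

abbreviation "n \<equiv> 3 * g + 1"
abbreviation "\<pi> \<equiv> volterra_poisson g (pCons 0 f)"
abbreviation "p v \<equiv> poly_shift 1 (poly_P g v)"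
abbreviation "q v \<equiv> poly_shift 1 (poly_Q g v)"
abbreviation "r v \<equiv> poly_shift 1 (poly_R g v)"

lemma poly_P_shift: "poly_P g v = pCons 1 (p v)"
  by (rule poly_eqI) (simp add: coeff_poly_shift coeff_poly_P coeff_pCons split: nat.splits)

lemma poly_Q_shift: "poly_Q g v = pCons 2 (q v)"
  by (rule poly_eqI) (simp add: coeff_poly_shift coeff_poly_Q coeff_pCons split: nat.splits)

lemma poly_R_shift: "poly_R g v = pCons 0 (r v)"
  by (rule poly_eqI) (simp add: coeff_poly_shift coeff_poly_R coeff_pCons split: nat.splits)

lemma poly_p: "poly (p v) x = val g BP v x"
  by (subst poly_altdef_lessThan[of g]) (simp_all add: coeff_poly_shift coeff_poly_P val_def)

lemma poly_q: "poly (q v) x = val g BQ v x"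
  by (subst poly_altdef_lessThan[of g]) (simp_all add: coeff_poly_shift coeff_poly_Q val_def)

lemma poly_r: "poly (r v) x = val g BR v x"
  by (subst poly_altdef_lessThan[of "Suc g"]) (simp_all add: coeff_poly_shift coeff_poly_R val_def)

lemma degrees: "degree (p v) \<le> g" "degree (poly_Q g v) \<le> g" "degree (r v) \<le> g"
  by (auto intro!: degree_le simp: coeff_poly_shift coeff_poly_P coeff_poly_Q coeff_poly_R)

lemma polyfun_coeffs:
  "(\<lambda>v. coeff (poly_P g v) k) \<in> polyfun n" "(\<lambda>v. coeff (poly_Q g v) k) \<in> polyfun n"
  "(\<lambda>v. coeff (poly_R g v) k) \<in> polyfun n" "(\<lambda>v. coeff (p v) k) \<in> polyfun n"
  "(\<lambda>v. coeff (q v) k) \<in> polyfun n" "(\<lambda>v. coeff (r v) k) \<in> polyfun n"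
  "(\<lambda>v. coeff (Polynomial.smult c (p v)) k) \<in> polyfun n"
  unfolding coeff_poly_P coeff_poly_Q coeff_poly_R coeff_poly_shift coeff_smult
  by (intro polyfun_if polyfun.mult polyfun.const polyfun.coord; simp)+

text \<open>
  The generating functions of the brackets, divided by \<open>x y\<close>, so that the coefficient
  of \<open>x\<^sup>i y\<^sup>j\<close> belongs to the coordinates numbered \<open>i\<close> and \<open>j\<close> from \<open>0\<close>.
\<close>

fun red :: "block \<Rightarrow> block \<Rightarrow> complex Matrix.vec \<Rightarrow> complex poly poly" where
  "red BP BQ v = bez f (poly_Q g v)"
| "red BP BR v = - (var_y * bez f (r v))"
| "red BQ BR v = bez f [:2:] + var_y * bez f (Polynomial.smult 2 (p v)) - in_x (q v) * in_y f"
| "red BR BR v = in_x (r v) * in_y f - in_x f * in_y (r v)"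
| "red _ _ v = 0"

lemma bracket_red:
  "bracket_PQ (pCons 0 f) (poly_Q g v) = var_x * (var_y * red BP BQ v)"
  "bracket_PR (pCons 0 f) (poly_R g v) = var_x * (var_y * red BP BR v)"
  "bracket_QR (pCons 0 f) (poly_P g v) (poly_Q g v) = var_x * (var_y * red BQ BR v)"
  using bracket_PQ_bez[of f "poly_Q g v"] bracket_PR_bez[of f "r v"] bracket_QR_bez[of f "p v" "q v"]
  unfolding poly_P_shift[symmetric] poly_Q_shift[symmetric] poly_R_shift[symmetric] red.simps
  by blast+

lemma bracket_RR_red: "coeff_xy (bracket_RR (pCons 0 f) (poly_R g v)) (Suc i) (Suc j)
    = coeff_xy (red BR BR v) i j"
  unfolding bracket_RR_def by (subst (1 2) poly_R_shift) simp

lemma coeff_xy_var_xy: "coeff_xy (var_x * (var_y * B)) (Suc i) (Suc j) = coeff_xy B i j"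
  by (simp add: coeff_xy_var_x coeff_xy_var_y)

text \<open>On these pairs \<open>red\<close> is the true bracket, including the default 0 at
  \<open>(BP, BP)\<close> and \<open>(BQ, BQ)\<close>; on the transposed pairs that default is a
  mere placeholder, and antisymmetry takes its place.\<close>

definition upper :: "(block \<times> block) set" where
  "upper = {(BP, BP), (BQ, BQ), (BP, BQ), (BP, BR), (BQ, BR), (BR, BR)}"

lemma upper_cases: "(a, b) \<in> upper \<or> (b, a) \<in> upper"
  by (cases a; cases b) (auto simp: upper_def)

lemma \<pi>_red:
  assumes "(a, b) \<in> upper" "i < len g a" "j < len g b"
  shows "\<pi> (offset g a + i) (offset g b + j) v = coeff_xy (red a b v) i j"
  using assms unfolding upper_def
  by (auto simp: volterra_poisson_def Let_def bracket_red
      bracket_RR_red coeff_xy_var_xy simp del: red.simps(1-4))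

lemma \<pi>_antisym:
  assumes "i < n" "j < n"
  shows "\<pi> i j v = - \<pi> j i v"
  using assms by (simp add: volterra_poisson_def Let_def bracket_RR_def)

lemma block_exists:
  assumes "k < n"
  obtains b i where "i < len g b" "k = offset g b + i"
proof (cases "k < g")
  case True
  then show ?thesis using that[of k BP] by simp
next
  case False
  then show ?thesis
    using that[of "k - g" BQ] that[of "k - 2 * g" BR] assms by (cases "k < 2 * g") auto
qed

lemma polyfun_red: "(\<lambda>v. coeff_xy (red a b v) i j) \<in> polyfun n"
proof -
  have "(\<lambda>v. coeff_xy (var_y * B v) i j) \<in> polyfun n"
    if "\<And>j. (\<lambda>v. coeff_xy (B v) i j) \<in> polyfun n" for B
    using that by (cases j) (auto simp: coeff_xy_var_y intro: polyfun.const)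
  note * = this polyfun_coeff_bez polyfun_coeffs polyfun_intros
  show ?thesis
    by (cases a; cases b; simp only: red.simps coeff_xy_simps coeff_xy_in_x_in_y; intro *)
qed

sublocale polynomial_bivector n \<pi>
proof
  fix i j assume ij: "i < n" "j < n"
  then obtain a b i' j' where *: "i' < len g a" "i = offset g a + i'" "j' < len g b" "j = offset g b + j'"
    by (metis block_exists)
  show "poly_on n (\<pi> i j)"
  proof (cases "(a, b) \<in> upper")
    case True
    then show ?thesis using * \<pi>_red polyfun_red[of a b i' j'] by (auto simp: poly_on_def)
  next
    case False
    then have "(b, a) \<in> upper" using upper_cases by blast
    then have "\<pi> i j v = - coeff_xy (red b a v) j' i'" for v
      using \<pi>_antisym[OF ij] \<pi>_red[of b a j' i'] * by simp
    then show ?thesis using polyfun_uminus[OF polyfun_red[of b a j' i']] by (auto simp: poly_on_def)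
  qed
qed (rule \<pi>_antisym)

text \<open>This is where \<open>degree_f\<close> matters: no generating function has a term beyond
  the coordinates of its blocks, so pairing two evaluation covectors recovers its whole value at (x,
  y).\<close>

lemma bounded_red: "(a, b) \<in> upper \<Longrightarrow> bounded_xy (len g a) (len g b) (red a b v)"
proof -
  have "coeff f i = 0" if "i > g" for i
    using degree_f that by (simp add: coeff_eq_0)
  then have *: "bounded_xy g (Suc g) (in_x (q v) * in_y f)"
    "bounded_xy (Suc g) (Suc g) (in_x (r v) * in_y f)"
    "bounded_xy (Suc g) (Suc g) (in_x f * in_y (r v))"
    by (intro bounded_prod; simp add: coeff_poly_shift coeff_poly_Q coeff_poly_R)+
  have "degree (Polynomial.smult 2 (p v)) \<le> g" using degrees(1)[of v] by (auto intro: order_trans[OF degree_smult_le])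
  then have b: "bounded_xy g g (bez f (poly_Q g v))" "bounded_xy g g (bez f (r v))"
    "bounded_xy g g (bez f (Polynomial.smult 2 (p v)))" "bounded_xy g g (bez f [:2:])"
    using degrees degree_f by (auto intro!: bounded_bez)
  have "bounded_xy g (Suc g) (red BP BR v)" "bounded_xy g (Suc g) (red BQ BR v)"
    unfolding red.simps
    by (intro bounded_uminus bounded_diff bounded_add bounded_var_y b * bounded_mono[OF b(4)]; simp)+
  then show "(a, b) \<in> upper \<Longrightarrow> bounded_xy (len g a) (len g b) (red a b v)"
    unfolding upper_def using b * bounded_diff[OF *(2,3)]
    by (auto simp del: red.simps(2,3)) (auto simp: bounded_xy_def)
qed

lemma pair_ev_red:
  assumes "(a, b) \<in> upper"
  shows "pair n \<pi> v (ev g a x) (ev g b y) = poly_xy (red a b v) x y"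
  unfolding pair_ev poly_xy_sum[OF bounded_red[OF assms]]
  using \<pi>_red[OF assms] by (intro sum.cong refl arg_cong2[where f = "(*)"]) auto

text \<open>The brackets of the linear functions p(x), q(x), r(x). The Jacobi identity, the
  invariance under the Volterra map and the involution all rest on these six formulas.\<close>

lemma pair_ev_eqs:
  shows "pair n \<pi> v (ev g BP x) (ev g BP y) = 0"
    and "pair n \<pi> v (ev g BQ x) (ev g BQ y) = 0"
    and "pair n \<pi> v (ev g BR x) (ev g BR y) = poly f y * val g BR v x - poly f x * val g BR v y"
    and "x \<noteq> y \<Longrightarrow> pair n \<pi> v (ev g BP x) (ev g BQ y)
      = (poly f x * (2 + y * val g BQ v y) - poly f y * (2 + x * val g BQ v x)) / (x - y)"
    and "x \<noteq> y \<Longrightarrow> pair n \<pi> v (ev g BP x) (ev g BR y)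
      = - y * (poly f x * val g BR v y - poly f y * val g BR v x) / (x - y)"
    and "x \<noteq> y \<Longrightarrow> pair n \<pi> v (ev g BQ x) (ev g BR y)
      = 2 * (poly f x * (1 + y * val g BP v y) - poly f y * (1 + y * val g BP v x)) / (x - y)
        - poly f y * val g BQ v x"
proof -
  have u: "(BP, BP) \<in> upper" "(BQ, BQ) \<in> upper" "(BR, BR) \<in> upper" "(BP, BQ) \<in> upper"
    "(BP, BR) \<in> upper" "(BQ, BR) \<in> upper"
    by (simp_all add: upper_def)
  note v = poly_p poly_q poly_r poly_Q_eq
  show "pair n \<pi> v (ev g BP x) (ev g BP y) = 0" "pair n \<pi> v (ev g BQ x) (ev g BQ y) = 0"
    unfolding u(1,2)[THEN pair_ev_red] by (simp_all add: poly_xy_def)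
  show "pair n \<pi> v (ev g BR x) (ev g BR y) = poly f y * val g BR v x - poly f x * val g BR v y"
    unfolding u(3)[THEN pair_ev_red] red.simps poly_xy_simps poly_xy_in_y v by simp
  assume "x \<noteq> y"
  note b = poly_xy_bez[OF this]
  show "pair n \<pi> v (ev g BP x) (ev g BQ y)
      = (poly f x * (2 + y * val g BQ v y) - poly f y * (2 + x * val g BQ v x)) / (x - y)"
    unfolding u(4)[THEN pair_ev_red] red.simps b v ..
  show "pair n \<pi> v (ev g BP x) (ev g BR y)
      = - y * (poly f x * val g BR v y - poly f y * val g BR v x) / (x - y)"
    unfolding u(5)[THEN pair_ev_red] red.simps poly_xy_simps b v by simp
  show "pair n \<pi> v (ev g BQ x) (ev g BR y)
      = 2 * (poly f x * (1 + y * val g BP v y) - poly f y * (1 + y * val g BP v x)) / (x - y)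
        - poly f y * val g BQ v x"
    unfolding u(6)[THEN pair_ev_red] red.simps poly_xy_simps poly_xy_in_y b v poly_smult
    by (simp add: add_divide_distrib[symmetric] algebra_simps)
qed

section \<open>The Jacobi identity\<close>

text \<open>Brackets of evaluations are affine in v, so their differentials are constant
  combinations of evaluation covectors and a second bracket falls under \<open>pair_ev_eqs\<close>
  again. Only sums of multiples occur, with signs moved into the coefficients, to suit
  \<open>pair_add_left\<close> and \<open>pair_smult_left\<close>.\<close>

fun upper_gradient :: "block \<Rightarrow> block \<Rightarrow> complex \<Rightarrow> complex \<Rightarrow> nat \<Rightarrow> complex" where
  "upper_gradient BP BQ x y = (\<lambda>i. poly f x * y / (x - y) * ev g BQ y i + - (poly f y * x / (x - y)) * ev g BQ x i)"
| "upper_gradient BP BR x y = (\<lambda>i. - (y * poly f x / (x - y)) * ev g BR y i + y * poly f y / (x - y) * ev g BR x i)"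
| "upper_gradient BQ BR x y = (\<lambda>i. 2 * poly f x * y / (x - y) * ev g BP y i + - (2 * poly f y * y / (x - y)) * ev g BP x i
     + - poly f y * ev g BQ x i)"
| "upper_gradient BR BR x y = (\<lambda>i. poly f y * ev g BR x i + - poly f x * ev g BR y i)"
| "upper_gradient _ _ x y = (\<lambda>i. 0)"

definition pair_gradient :: "block \<Rightarrow> block \<Rightarrow> complex \<Rightarrow> complex \<Rightarrow> nat \<Rightarrow> complex" where
  "pair_gradient a b x y =
    (if (a, b) \<in> upper then upper_gradient a b x y else (\<lambda>i. - 1 * upper_gradient b a y x i))"

lemma has_gradient_pair_upper:
  assumes "(a, b) \<in> upper" "x \<noteq> y" and v: "v \<in> carrier_vec n"
  shows "has_gradient n (\<lambda>u. pair n \<pi> u (ev g a x) (ev g b y)) (upper_gradient a b x y) v"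
proof -
  have affine: "has_gradient n (\<lambda>u. c\<^sub>0 + c\<^sub>1 * val g b\<^sub>1 u x\<^sub>1 + c\<^sub>2 * val g b\<^sub>2 u x\<^sub>2 + c\<^sub>3 * val g b\<^sub>3 u x\<^sub>3)
      (\<lambda>i. c\<^sub>1 * ev g b\<^sub>1 x\<^sub>1 i + c\<^sub>2 * ev g b\<^sub>2 x\<^sub>2 i + c\<^sub>3 * ev g b\<^sub>3 x\<^sub>3 i) v"
    for c\<^sub>0 c\<^sub>1 c\<^sub>2 c\<^sub>3 b\<^sub>1 b\<^sub>2 b\<^sub>3 x\<^sub>1 x\<^sub>2 x\<^sub>3
    using has_gradient_add[OF has_gradient_add[OF has_gradient_add[OF has_gradient_const[OF v, of c\<^sub>0]
          has_gradient_mult[OF has_gradient_const[OF v, of c\<^sub>1] has_gradient_val[OF v, of b\<^sub>1 x\<^sub>1]]]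
          has_gradient_mult[OF has_gradient_const[OF v, of c\<^sub>2] has_gradient_val[OF v, of b\<^sub>2 x\<^sub>2]]]
          has_gradient_mult[OF has_gradient_const[OF v, of c\<^sub>3] has_gradient_val[OF v, of b\<^sub>3 x\<^sub>3]]]
    by (simp del: One_nat_def)
  \<comment> \<open>Three slots serve all non-zero brackets; a slot that is left over receives the
    coefficient 0 with the block \<open>BP\<close> and the point 0.\<close>
  have affineI: "has_gradient n F D v"
    if "\<And>u. F u = c\<^sub>0 + c\<^sub>1 * val g b\<^sub>1 u x\<^sub>1 + c\<^sub>2 * val g b\<^sub>2 u x\<^sub>2 + c\<^sub>3 * val g b\<^sub>3 u x\<^sub>3"
      and "\<And>i. D i = c\<^sub>1 * ev g b\<^sub>1 x\<^sub>1 i + c\<^sub>2 * ev g b\<^sub>2 x\<^sub>2 i + c\<^sub>3 * ev g b\<^sub>3 x\<^sub>3 i"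
    for F D c\<^sub>0 c\<^sub>1 c\<^sub>2 c\<^sub>3 b\<^sub>1 b\<^sub>2 b\<^sub>3 x\<^sub>1 x\<^sub>2 x\<^sub>3
  proof -
    have "F = (\<lambda>u. c\<^sub>0 + c\<^sub>1 * val g b\<^sub>1 u x\<^sub>1 + c\<^sub>2 * val g b\<^sub>2 u x\<^sub>2 + c\<^sub>3 * val g b\<^sub>3 u x\<^sub>3)"
      "D = (\<lambda>i. c\<^sub>1 * ev g b\<^sub>1 x\<^sub>1 i + c\<^sub>2 * ev g b\<^sub>2 x\<^sub>2 i + c\<^sub>3 * ev g b\<^sub>3 x\<^sub>3 i)"
      using that by blast+
    then show ?thesis using affine by simp
  qed
  have d: "x - y \<noteq> 0" using \<open>x \<noteq> y\<close> by simp
  show ?thesis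
    using assms(1) unfolding upper_def
  proof (elim insertE emptyE; clarify)
    show "has_gradient n (\<lambda>u. pair n \<pi> u (ev g BP x) (ev g BP y)) (upper_gradient BP BP x y) v"
      using has_gradient_const[OF v] by (simp only: pair_ev_eqs upper_gradient.simps)
    show "has_gradient n (\<lambda>u. pair n \<pi> u (ev g BQ x) (ev g BQ y)) (upper_gradient BQ BQ x y) v"
      using has_gradient_const[OF v] by (simp only: pair_ev_eqs upper_gradient.simps)
    show "has_gradient n (\<lambda>u. pair n \<pi> u (ev g BP x) (ev g BQ y)) (upper_gradient BP BQ x y) v"
      by (rule affineI[of _ "2 * (poly f x - poly f y) / (x - y)" "poly f x * y / (x - y)" BQ y
          "- (poly f y * x / (x - y))" BQ x 0 BP 0]; unfold pair_ev_eqs(4)[OF assms(2)] upper_gradient.simps;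
          insert d; simp add: diff_divide_distrib add_divide_distrib algebra_simps)
    show "has_gradient n (\<lambda>u. pair n \<pi> u (ev g BP x) (ev g BR y)) (upper_gradient BP BR x y) v"
      by (rule affineI[of _ 0 "- (y * poly f x / (x - y))" BR y "y * poly f y / (x - y)" BR x 0 BP 0];
          unfold pair_ev_eqs(5)[OF assms(2)] upper_gradient.simps;
          insert d; simp add: diff_divide_distrib add_divide_distrib algebra_simps)
    show "has_gradient n (\<lambda>u. pair n \<pi> u (ev g BQ x) (ev g BR y)) (upper_gradient BQ BR x y) v"
      by (rule affineI[of _ "2 * (poly f x - poly f y) / (x - y)" "2 * poly f x * y / (x - y)" BP y
          "- (2 * poly f y * y / (x - y))" BP x "- poly f y" BQ x];
          unfold pair_ev_eqs(6)[OF assms(2)] upper_gradient.simps;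
          insert d; simp add: diff_divide_distrib add_divide_distrib algebra_simps)
    show "has_gradient n (\<lambda>u. pair n \<pi> u (ev g BR x) (ev g BR y)) (upper_gradient BR BR x y) v"
      by (rule affineI[of _ 0 "poly f y" BR x "- poly f x" BR y 0 BP 0];
          unfold pair_ev_eqs upper_gradient.simps; simp)
  qed
qed

lemma has_gradient_pair:
  assumes "x \<noteq> y" and v: "v \<in> carrier_vec n"
  shows "has_gradient n (\<lambda>u. pair n \<pi> u (ev g a x) (ev g b y)) (pair_gradient a b x y) v"
proof (cases "(a, b) \<in> upper")
  case True
  then show ?thesis using has_gradient_pair_upper assms by (simp add: pair_gradient_def)
next
  case False
  then have ba: "(b, a) \<in> upper" and p: "pair_gradient a b x y = (\<lambda>i. - 1 * upper_gradient b a y x i)"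
    using upper_cases by (auto simp: pair_gradient_def)
  have "has_gradient n (\<lambda>u. - 1 * pair n \<pi> u (ev g b y) (ev g a x))
      (\<lambda>i. - 1 * upper_gradient b a y x i + pair n \<pi> v (ev g b y) (ev g a x) * 0) v"
    using ba assms by (intro has_gradient_mult has_gradient_const has_gradient_pair_upper) auto
  then show ?thesis unfolding p
    by (elim has_gradient_cong_carrier[THEN back_subst[of "\<lambda>D. has_gradient n _ D v"]])
      (simp_all add: pair_antisym[of _ "ev g a x"] del: One_nat_def)
qed

text \<open>The transposed brackets, with the denominator normalised to x - y so that only one sign
  of each difference appears when denominators are cleared.\<close>

lemma pair_ev_lower:
  assumes v: "v \<in> carrier_vec n" and "x \<noteq> y"
  shows "pair n \<pi> v (ev g BQ x) (ev g BP y)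
      = (poly f y * (2 + x * val g BQ v x) - poly f x * (2 + y * val g BQ v y)) / (x - y)"
    and "pair n \<pi> v (ev g BR x) (ev g BP y)
      = - x * (poly f y * val g BR v x - poly f x * val g BR v y) / (x - y)"
    and "pair n \<pi> v (ev g BR x) (ev g BQ y)
      = 2 * (poly f y * (1 + x * val g BP v x) - poly f x * (1 + x * val g BP v y)) / (x - y)
        + poly f x * val g BQ v y"
proof -
  have xy: "y \<noteq> x" "x - y \<noteq> 0" "y - x \<noteq> 0" using assms by auto
  show "pair n \<pi> v (ev g BQ x) (ev g BP y)
      = (poly f y * (2 + x * val g BQ v x) - poly f x * (2 + y * val g BQ v y)) / (x - y)"
    unfolding pair_antisym[OF v, of "ev g BQ x"] pair_ev_eqs(4)[OF xy(1)] using xy by (simp add: field_simps)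
  show "pair n \<pi> v (ev g BR x) (ev g BP y)
      = - x * (poly f y * val g BR v x - poly f x * val g BR v y) / (x - y)"
    unfolding pair_antisym[OF v, of "ev g BR x"] pair_ev_eqs(5)[OF xy(1)] using xy by (simp add: field_simps)
  show "pair n \<pi> v (ev g BR x) (ev g BQ y)
      = 2 * (poly f y * (1 + x * val g BP v x) - poly f x * (1 + x * val g BP v y)) / (x - y)
        + poly f x * val g BQ v y"
    unfolding pair_antisym[OF v, of "ev g BR x"] pair_ev_eqs(6)[OF xy(1)] using xy by (simp add: field_simps)
qed

lemma jac_ev:
  assumes v: "v \<in> carrier_vec n" and xyz: "x \<noteq> y" "y \<noteq> z" "z \<noteq> x"
  shows "(\<Sum>i<n. \<Sum>j<n. \<Sum>k<n. ev g a x i * ev g b y j * ev g c z k * jac i j k v) = 0"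
  unfolding jac_trilinear[OF xyz[THEN has_gradient_pair[OF _ v]]]
proof -
  have d: "x - y \<noteq> 0" "y - x \<noteq> 0" "y - z \<noteq> 0" "z - y \<noteq> 0" "z - x \<noteq> 0" "x - z \<noteq> 0"
    and xyz': "y \<noteq> x" "z \<noteq> y" "x \<noteq> z" using xyz by auto
  note xyz = xyz xyz'
  have zero: "pair n \<pi> v (\<lambda>i. 0) \<gamma> = 0" for \<gamma> by (simp add: pair_def)
  note expand = pair_gradient_def upper_def insert_iff empty_iff prod.inject block.distinct simp_thms
    if_True if_False upper_gradient.simps zero pair_add_left pair_smult_left pair_ev_eqs xyz
    pair_ev_lower[OF v]
  show "pair n \<pi> v (pair_gradient a b x y) (ev g c z) + pair n \<pi> v (pair_gradient b c y z) (ev g a x) +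
    pair n \<pi> v (pair_gradient c a z x) (ev g b y) = 0"
    \<comment> \<open>In each of the 27 block triples clearing denominators leaves a polynomial
      identity in which x, y, z and the values of f, p, q, r at them are free variables.\<close>
    by (cases a; cases b; cases c; hypsubst; simp only: expand; (use xyz in \<open>simp add: divide_simps\<close>)?; (simp add: algebra_simps)?)
qed

lemma poisson_structure: "poisson_structure n \<pi>"
proof (rule poisson_structureI)
  fix i j k :: nat and v :: "complex Matrix.vec" assume ijk: "i < n" "j < n" "k < n" and v: "v \<in> carrier_vec n"
  \<comment> \<open>The covectors are removed one at a time, z avoiding x and y first, then y
    avoiding x, then x without restriction; at each stage the excluded set is finite.\<close>
  have 1: "(\<Sum>i<n. \<Sum>j<n. ev g a x i * ev g b y j * jac i j k v) = 0" if "y \<notin> {x}" for a x b y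
  proof (rule ev_extract[OF _ _ ijk(3)])
    fix c z assume "z \<notin> {x, y}"
    then have "(\<Sum>i<n. \<Sum>j<n. \<Sum>k<n. ev g a x i * ev g b y j * ev g c z k * jac i j k v) = 0"
      using that by (intro jac_ev[OF v]) auto
    then have "(\<Sum>k<n. \<Sum>i<n. \<Sum>j<n. ev g a x i * ev g b y j * ev g c z k * jac i j k v) = 0"
      by (subst sum_rotate)
    then show "(\<Sum>k<n. (\<Sum>i<n. \<Sum>j<n. ev g a x i * ev g b y j * jac i j k v) * ev g c z k) = 0"
      unfolding sum_distrib_right by (simp only: mult_ac)
  qed simp
  have 2: "(\<Sum>i<n. ev g a x i * jac i j k v) = 0" for a x
  proof (rule ev_extract[OF _ _ ijk(2)])
    fix b y assume "y \<notin> {x}"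
    from 1[OF this, of a b]
    have "(\<Sum>j<n. \<Sum>i<n. ev g a x i * ev g b y j * jac i j k v) = 0" by (subst sum.swap)
    then show "(\<Sum>j<n. (\<Sum>i<n. ev g a x i * jac i j k v) * ev g b y j) = 0"
      unfolding sum_distrib_right by (simp only: mult_ac)
  qed simp
  show "jac i j k v = 0"
    by (rule ev_extract[OF finite.emptyI _ ijk(1)]) (use 2 in \<open>simp only: mult_ac\<close>)
qed

end

section \<open>The Volterra map in coordinates\<close>

lemma coeff_double: "coeff (2 * p) k = 2 * coeff (p :: complex poly) k"
  unfolding mult_2 coeff_add ..

lemma coeff_triplet_coords:
  "coeff (poly_P g (coords g (P, Q, R))) k = (if k = 0 then 1 else if k \<le> g then coeff P k else 0)"
  "coeff (poly_Q g (coords g (P, Q, R))) k = (if k = 0 then 2 else if k \<le> g then coeff Q k else 0)"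
  "coeff (poly_R g (coords g (P, Q, R))) k = (if k = 0 then 0 else if k \<le> g + 1 then coeff R k else 0)"
  by (auto simp: coeff_poly_P coeff_poly_Q coeff_poly_R)

lemma triplet_coords:
  assumes "coeff P 0 = 1" "coeff Q 0 = 2" "coeff R 0 = 0"
    and "\<And>k. k > g \<Longrightarrow> coeff P k = 0" "\<And>k. k > g \<Longrightarrow> coeff Q k = 0" "\<And>k. k > g + 1 \<Longrightarrow> coeff R k = 0"
  shows "poly_P g (coords g (P, Q, R)) = P" "poly_Q g (coords g (P, Q, R)) = Q"
    "poly_R g (coords g (P, Q, R)) = R"
  using assms by (auto intro!: poly_eqI simp: coeff_triplet_coords simp del: coords.simps)

lemma coords_triplet:
  assumes "v \<in> carrier_vec (3 * g + 1)"
  shows "coords g (poly_P g v, poly_Q g v, poly_R g v) = v"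
  using assms by (intro eq_vecI) (auto simp: coeff_poly_P coeff_poly_Q coeff_poly_R)

lemma coords_carrier: "coords g X \<in> carrier_vec (3 * g + 1)"
  by (cases X) simp

context volterra_bracket begin

abbreviation "T \<equiv> volterra_map g"

definition w :: cfun where
  "w v = - (1 / 2) * (2 * coeff (poly_P g v) 1 - coeff (poly_Q g v) 1 + coeff (poly_R g v) 1)"

text \<open>This is (2 P - Q + R) / x. Since w is -1/2 times its constant term, - s / w has the
  constant term 2 that the new Q must have.\<close>

definition s :: "complex Matrix.vec \<Rightarrow> complex poly" where
  "s v = poly_shift 1 (2 * poly_P g v - poly_Q g v + poly_R g v)"

lemma coeff_s: "coeff (s v) k
    = 2 * coeff (poly_P g v) (k + 1) - coeff (poly_Q g v) (k + 1) + coeff (poly_R g v) (k + 1)"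
  by (simp add: s_def coeff_poly_shift coeff_double)

lemma s_shift: "2 * poly_P g v - poly_Q g v + poly_R g v = pCons 0 (s v)"
  by (rule poly_eqI)
    (simp add: coeff_s coeff_double coeff_pCons coeff_poly_P coeff_poly_Q coeff_poly_R split: nat.splits)

lemma w_s: "w v = - (1 / 2) * coeff (s v) 0"
  by (simp add: w_def coeff_s)

lemma T_carrier: "T v \<in> carrier_vec n"
  unfolding volterra_map_def by (rule coords_carrier)

lemma polyfun_w: "w \<in> polyfun n"
  unfolding w_def[abs_def] by (intro polyfun_intros polyfun_coeffs)

lemma T_coords:
  assumes "w v \<noteq> 0"
  shows "T v = coords g (poly_Q g v - poly_P g v, Polynomial.smult (- (1 / w v)) (s v), [:0, - w v:] * poly_Q g v)"
proof -
  have "(2 * poly_P g v - poly_Q g v + poly_R g v) div [:0, - w v:] = Polynomial.smult (- (1 / w v)) (s v)"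
  proof -
    have "2 * poly_P g v - poly_Q g v + poly_R g v = [:0, - w v:] * Polynomial.smult (- (1 / w v)) (s v)"
      using assms by (simp add: s_shift)
    then show ?thesis using assms by (metis nonzero_mult_div_cancel_left pCons_eq_0_iff neg_equal_0_iff_equal)
  qed
  then show ?thesis
    unfolding volterra_map_def triplet_def volterra.simps Let_def w_def[symmetric] by simp
qed

lemma triplet_T:
  assumes "w v \<noteq> 0"
  shows "poly_P g (T v) = poly_Q g v - poly_P g v"
    "poly_Q g (T v) = Polynomial.smult (- (1 / w v)) (s v)"
    "poly_R g (T v) = [:0, - w v:] * poly_Q g v"
proof -
  have "coeff (s v) 0 = - 2 * w v" by (simp add: w_s)
  then have *: "coeff (Polynomial.smult (- (1 / w v)) (s v)) 0 = 2" using assms by simp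
  have c: "coeff (poly_Q g v - poly_P g v) 0 = 1" "coeff ([:0, - w v:] * poly_Q g v) 0 = 0"
    "coeff (poly_Q g v - poly_P g v) k = 0" if "k > g" for k
    using that by (auto simp: coeff_poly_P coeff_poly_Q)
  have d: "coeff (Polynomial.smult (- (1 / w v)) (s v)) k = 0" if "k > g" for k
    using that by (simp add: coeff_s coeff_poly_P coeff_poly_Q coeff_poly_R)
  have e: "coeff ([:0, - w v:] * poly_Q g v) k = 0" if "k > g + 1" for k
    using that by (auto simp: coeff_poly_Q coeff_pCons split: nat.splits)
  show "poly_P g (T v) = poly_Q g v - poly_P g v"
    "poly_Q g (T v) = Polynomial.smult (- (1 / w v)) (s v)"
    "poly_R g (T v) = [:0, - w v:] * poly_Q g v"
    unfolding T_coords[OF assms] by (rule triplet_coords; use * c d e in \<open>auto simp del: coeff_smult\<close>)+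
qed

lemma poly_s: "poly (s v) x = 2 * val g BP v x - val g BQ v x + val g BR v x"
proof -
  have "s v = Polynomial.smult 2 (p v) - q v + r v"
    by (rule poly_eqI) (simp add: coeff_s coeff_poly_shift)
  then show ?thesis by (simp only: poly_add poly_diff poly_smult poly_p poly_q poly_r)
qed

lemma w_val: "w v = - (1 / 2) * (2 * val g BP v 0 - val g BQ v 0 + val g BR v 0)"
  unfolding w_s poly_s[symmetric] by (simp add: poly_0_coeff_0)

lemma val_T:
  assumes "w v \<noteq> 0" "x \<noteq> 0"
  shows "val g BP (T v) x = val g BQ v x - val g BP v x"
    and "val g BQ (T v) x = - (2 * val g BP v x - val g BQ v x + val g BR v x) / (w v * x) - 2 / x"
    and "val g BR (T v) x = - w v * (2 + x * val g BQ v x)"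
proof -
  have "x * val g BP (T v) x = x * (val g BQ v x - val g BP v x)"
    using arg_cong[OF triplet_T(1)[OF assms(1)], of "\<lambda>p. poly p x"]
    by (simp add: poly_P_eq poly_Q_eq algebra_simps)
  then show "val g BP (T v) x = val g BQ v x - val g BP v x" using assms by simp
  have "2 + x * val g BQ (T v) x = - poly (s v) x / w v"
    using arg_cong[OF triplet_T(2)[OF assms(1)], of "\<lambda>p. poly p x"] by (simp add: poly_Q_eq)
  then have "val g BQ (T v) x = (- poly (s v) x / w v - 2) / x"
    using assms by (simp add: field_simps)
  then show "val g BQ (T v) x = - (2 * val g BP v x - val g BQ v x + val g BR v x) / (w v * x) - 2 / x"
    by (simp add: poly_s diff_divide_distrib)
  have "x * val g BR (T v) x = x * (- w v * (2 + x * val g BQ v x))"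
    using arg_cong[OF triplet_T(3)[OF assms(1)], of "\<lambda>p. poly p x"]
    by (simp add: poly_R_eq poly_Q_eq algebra_simps)
  then show "val g BR (T v) x = - w v * (2 + x * val g BQ v x)"
    by (rule mult_left_cancel[THEN iffD1, OF assms(2)])
qed

text \<open>The first and the last block of components are polynomial in v; they carry an artificial
  factor w so that all components share the denominator w.\<close>

lemma T_component:
  assumes "k < n"
  shows "\<exists>a \<in> polyfun n. \<forall>v \<in> carrier_vec n. w v \<noteq> 0 \<longrightarrow> T v $ k = a v / w v"
proof -
  consider "k < g" | "g \<le> k" "k < 2 * g" | "2 * g \<le> k" by linarith
  then show ?thesis
  proof cases
    case 1
    have "(\<lambda>v. (coeff (poly_Q g v) (k + 1) - coeff (poly_P g v) (k + 1)) * w v) \<in> polyfun n"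
      by (intro polyfun_intros polyfun_coeffs polyfun_w)
    then show ?thesis by (rule bexI[rotated]) (use 1 in \<open>simp add: T_coords\<close>)
  next
    case 2
    have "(\<lambda>v. - coeff (s v) (k - g + 1)) \<in> polyfun n"
      unfolding coeff_s by (intro polyfun_intros polyfun_coeffs)
    then show ?thesis by (rule bexI[rotated]) (use 2 in \<open>simp add: T_coords\<close>)
  next
    case 3
    have "(\<lambda>v. - (w v * w v * coeff (poly_Q g v) (k - 2 * g))) \<in> polyfun n"
      by (intro polyfun_intros polyfun_coeffs polyfun_w)
    then show ?thesis by (rule bexI[rotated]) (use 3 assms in \<open>simp add: T_coords\<close>)
  qed
qed

text \<open>Pulling back along T costs only powers of w, and the numerator is the polynomial whose
  non-vanishing decides dominance.\<close>

lemma polyfun_T: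
  assumes "d \<in> polyfun n"
  shows "\<exists>a \<in> polyfun n. \<exists>m. \<forall>v \<in> carrier_vec n. w v \<noteq> 0 \<longrightarrow> d (T v) = a v / w v ^ m"
  using assms
proof induction
  case (const c)
  show ?case by (intro bexI[of _ "\<lambda>v. c"] exI[of _ 0]) (auto intro: polyfun.const)
next
  case (coord i)
  from T_component[OF this] obtain a where "a \<in> polyfun n"
    "\<forall>v \<in> carrier_vec n. w v \<noteq> 0 \<longrightarrow> T v $ i = a v / w v" by blast
  then show ?case by (intro bexI[of _ a] exI[of _ 1]) auto
next
  case (add d h)
  then obtain a b k l where "a \<in> polyfun n" "b \<in> polyfun n"
    "\<forall>v \<in> carrier_vec n. w v \<noteq> 0 \<longrightarrow> d (T v) = a v / w v ^ k"
    "\<forall>v \<in> carrier_vec n. w v \<noteq> 0 \<longrightarrow> h (T v) = b v / w v ^ l" by blast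
  moreover from this have "(\<lambda>v. a v * w v ^ l + b v * w v ^ k) \<in> polyfun n"
    by (intro polyfun_intros polyfun_w)
  ultimately show ?case
    by (intro bexI[of _ "\<lambda>v. a v * w v ^ l + b v * w v ^ k"] exI[of _ "k + l"])
      (auto simp: field_simps power_add)
next
  case (mult d h)
  then obtain a b k l where "a \<in> polyfun n" "b \<in> polyfun n"
    "\<forall>v \<in> carrier_vec n. w v \<noteq> 0 \<longrightarrow> d (T v) = a v / w v ^ k"
    "\<forall>v \<in> carrier_vec n. w v \<noteq> 0 \<longrightarrow> h (T v) = b v / w v ^ l" by blast
  then show ?case
    by (intro bexI[of _ "\<lambda>v. a v * b v"] exI[of _ "k + l"])
      (auto intro!: polyfun_intros simp: field_simps power_add)
qed

text \<open>Solving (P', Q', R') = T (P, Q, R): as R' = - w x Q and Q(0) = 2, the first coefficient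
  of R' is c = - 2 w. Hence Q = (2 / c) R' / x, then P = Q - P', and - w x Q' = 2 P - Q + R gives R
  = (c / 2) x Q' - 2 P + Q.\<close>

definition U :: "complex Matrix.vec \<Rightarrow> complex Matrix.vec" where
  "U v = coords g (let c = coeff (poly_R g v) 1; Q = Polynomial.smult (2 / c) (r v)
     in (Q - poly_P g v, Q, Polynomial.smult (c / 2) (pCons 0 (poly_Q g v)) - 2 * (Q - poly_P g v) + Q))"

lemma U_carrier: "U v \<in> carrier_vec n"
  unfolding U_def by (rule coords_carrier)

lemma triplet_U:
  assumes "coeff (poly_R g v) 1 \<noteq> 0"
  defines "Q \<equiv> Polynomial.smult (2 / coeff (poly_R g v) 1) (r v)"
  shows "poly_P g (U v) = Q - poly_P g v" "poly_Q g (U v) = Q"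
    "poly_R g (U v) = Polynomial.smult (coeff (poly_R g v) 1 / 2) (pCons 0 (poly_Q g v)) - 2 * (Q - poly_P g v) + Q"
proof -
  have 0: "coeff Q 0 = 2" using assms(1) by (simp add: Q_def coeff_poly_shift)
  have Qk: "coeff Q k = 0" if "k > g" for k
    using that by (simp add: Q_def coeff_poly_shift coeff_poly_R)
  show "poly_P g (U v) = Q - poly_P g v" "poly_Q g (U v) = Q"
    "poly_R g (U v) = Polynomial.smult (coeff (poly_R g v) 1 / 2) (pCons 0 (poly_Q g v)) - 2 * (Q - poly_P g v) + Q"
    unfolding U_def Let_def Q_def[symmetric]
    by (rule triplet_coords; use 0 Qk in \<open>auto simp: coeff_poly_P coeff_poly_Q coeff_double coeff_pCons split: nat.splits\<close>)+
qed

lemma w_U: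
  assumes "coeff (poly_R g v) 1 \<noteq> 0"
  shows "w (U v) = - coeff (poly_R g v) 1 / 2"
  unfolding w_def triplet_U[OF assms] by (simp add: coeff_double coeff_poly_Q)

lemma T_U:
  assumes v: "v \<in> carrier_vec n" and r: "coeff (poly_R g v) 1 \<noteq> 0"
  shows "T (U v) = v"
proof -
  have w: "w (U v) \<noteq> 0" using r by (simp add: w_U)
  have "pCons 0 (s (U v)) = Polynomial.smult (coeff (poly_R g v) 1 / 2) (pCons 0 (poly_Q g v))"
    unfolding s_shift[symmetric] triplet_U[OF r] by simp
  then have "s (U v) = Polynomial.smult (coeff (poly_R g v) 1 / 2) (poly_Q g v)" by simp
  then have "poly_Q g (T (U v)) = poly_Q g v"
    using r by (simp add: triplet_T[OF w] w_U[OF r])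
  moreover have "poly_P g (T (U v)) = poly_P g v"
    by (simp add: triplet_T[OF w] triplet_U[OF r])
  moreover have "poly_R g (T (U v)) = poly_R g v"
    using r by (simp add: triplet_T[OF w] w_U[OF r] triplet_U[OF r] poly_R_shift[of v, symmetric] del: One_nat_def)
  ultimately show ?thesis
    using coords_triplet[OF v] coords_triplet[OF T_carrier[of "U v"]] by simp
qed

lemma U_T:
  assumes v: "v \<in> carrier_vec n" and w: "w v \<noteq> 0"
  shows "U (T v) = v"
proof -
  have r: "coeff (poly_R g (T v)) 1 = - 2 * w v"
    by (simp add: triplet_T[OF w] coeff_poly_Q)
  then have r0: "coeff (poly_R g (T v)) 1 \<noteq> 0" using w by simp
  have "r (T v) = Polynomial.smult (- w v) (poly_Q g v)"
    by (simp add: triplet_T[OF w] poly_eq_iff coeff_poly_shift)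
  then have Q: "Polynomial.smult (2 / coeff (poly_R g (T v)) 1) (r (T v)) = poly_Q g v"
    unfolding r using w by simp
  have "poly_P g (U (T v)) = poly_P g v" "poly_Q g (U (T v)) = poly_Q g v"
    unfolding triplet_U[OF r0] Q by (simp_all add: triplet_T[OF w])
  moreover have "poly_R g (U (T v)) = poly_R g v"
    unfolding triplet_U[OF r0] Q unfolding r triplet_T[OF w]
    using w s_shift[of v] by (simp add: coeff_poly_Q algebra_simps)
  ultimately show ?thesis
    using coords_triplet[OF v] coords_triplet[OF U_carrier[of "T v"]] by simp
qed

lemma ex_w_nonzero: "\<exists>v \<in> carrier_vec n. w v \<noteq> 0"
proof -
  \<comment> \<open>Index \<open>2 * g\<close> is the coordinate of the linear coefficient of R,
    which is the denominator of U.\<close>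
  have "w (U (unit_vec n (2 * g))) \<noteq> 0" by (subst w_U) (simp_all add: coeff_poly_R)
  then show ?thesis using U_carrier by blast
qed

lemma generically_w: "generically n (\<lambda>v. w v \<noteq> 0)"
  unfolding generically_def using ex_w_nonzero polyfun_w by blast

lemma birational_map: "birational_map n T"
  unfolding birational_map_def rational_map_def
proof (intro conjI exI[of _ U] ballI allI impI T_carrier U_carrier)
  fix i assume "i < n"
  then obtain a where "a \<in> polyfun n" "\<forall>v\<in>carrier_vec n. w v \<noteq> 0 \<longrightarrow> T v $ i = a v / w v"
    using T_component by blast
  then show "rational_fun n (\<lambda>v. T v $ i)"
    using ex_w_nonzero polyfun_w unfolding rational_fun_def by blast
next
  define c where "c = (\<lambda>v. coeff (poly_R g v) 1)"
  have c: "c \<in> polyfun n" unfolding c_def by (rule polyfun_coeffs)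
  have c0: "c (unit_vec n (2 * g)) \<noteq> 0" by (simp add: c_def coeff_poly_R)
  fix i assume i: "i < n"
  define q' where "q' = (\<lambda>v k. 2 * coeff (poly_R g v) (k + 1))"
  define a where "a = (\<lambda>v. if i < g then q' v (i + 1) - c v * coeff (poly_P g v) (i + 1)
    else if i < 2 * g then q' v (i - g + 1)
    else 1 / 2 * c v * c v * coeff (poly_Q g v) (i - 2 * g) - q' v (i - 2 * g + 1)
      + 2 * c v * coeff (poly_P g v) (i - 2 * g + 1))"
  have "a \<in> polyfun n"
    unfolding a_def q'_def by (intro polyfun_if polyfun_intros polyfun_coeffs c)
  moreover have "U v $ i = a v / c v" if "c v \<noteq> 0" for v
  proof -
    define Q where "Q = Polynomial.smult (2 / c v) (r v)"
    have Q: "coeff Q k = q' v k / c v" for k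
      by (simp add: Q_def q'_def coeff_poly_shift)
    have "U v = coords g (Q - poly_P g v, Q,
        Polynomial.smult (c v / 2) (pCons 0 (poly_Q g v)) - 2 * (Q - poly_P g v) + Q)"
      by (simp only: U_def Let_def c_def Q_def)
    then have "U v $ i = (if i < g then coeff (Q - poly_P g v) (i + 1)
      else if i < 2 * g then coeff Q (i - g + 1)
      else coeff (Polynomial.smult (c v / 2) (pCons 0 (poly_Q g v)) - 2 * (Q - poly_P g v) + Q) (i - 2 * g + 1))"
      using i by simp
    then show ?thesis using that
      by (simp add: a_def Q coeff_double) (simp add: diff_divide_distrib add_divide_distrib algebra_simps)
  qed
  ultimately show "rational_fun n (\<lambda>v. U v $ i)"
    using c c0 by (intro rational_fun_quotient[of a n c "unit_vec n (2 * g)"]) auto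
next
  show "generically n (\<lambda>v. U (T v) = v)"
    by (rule generically_mp[OF generically_w U_T])
  have "generically n (\<lambda>v. coeff (poly_R g v) 1 \<noteq> 0)"
    by (rule genericallyI[of "\<lambda>v. coeff (poly_R g v) 1" n "unit_vec n (2 * g)", OF polyfun_coeffs(3)])
      (simp_all add: coeff_poly_R)
  then show "generically n (\<lambda>v. T (U v) = v)"
    by (rule generically_mp) (rule T_U)
qed

text \<open>\<open>T\<close> is dominant because \<open>U\<close> is a right inverse.\<close>

lemma generically_T:
  assumes "d \<in> polyfun n" "u \<in> carrier_vec n" "d u \<noteq> 0"
  shows "generically n (\<lambda>v. w v \<noteq> 0 \<and> d (T v) \<noteq> 0)"
proof -
  obtain a m where a: "a \<in> polyfun n" "\<And>v. v \<in> carrier_vec n \<Longrightarrow> w v \<noteq> 0 \<Longrightarrow> d (T v) = a v / w v ^ m"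
    using polyfun_T[OF assms(1)] by blast
  \<comment> \<open>At a point x where neither d nor the denominator of U vanishes,
    \<open>d (T (U x)) = d x\<close> shows that the numerator a is non-zero at
    \<open>U x\<close>.\<close>
  obtain x where x: "x \<in> carrier_vec n" "d x * coeff (poly_R g x) 1 \<noteq> 0"
    using polyfun_mult_nonzero[OF assms(1) polyfun_coeffs(3)[of 1] assms(2,3), of "unit_vec n (2 * g)"]
    by (auto simp: coeff_poly_R)
  then have r: "coeff (poly_R g x) 1 \<noteq> 0" by simp
  then have w: "w (U x) \<noteq> 0" by (simp add: w_U)
  have "a (U x) \<noteq> 0"
    using a(2)[OF U_carrier w] x T_U[OF x(1) r] by auto
  then have "generically n (\<lambda>v. a v \<noteq> 0)"
    by (intro genericallyI[OF a(1) U_carrier])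
  then show ?thesis
    by (rule generically_mp2[OF generically_w]) (use a(2) in auto)
qed

section \<open>The Volterra map is Poisson\<close>

text \<open>Since w is a combination of the evaluations at 0, pairing with its differential is a
  case of the known brackets with one point equal to 0; the other point must then be
  non-zero.\<close>

definition dw :: "nat \<Rightarrow> complex" where
  "dw i = - (1 / 2) * (2 * ev g BP 0 i + - 1 * ev g BQ 0 i + ev g BR 0 i)"

lemma has_gradient_w: "v \<in> carrier_vec n \<Longrightarrow> has_gradient n w dw v"
proof -
  assume v: "v \<in> carrier_vec n"
  have "has_gradient n (\<lambda>v. - (1 / 2) * (2 * val g BP v 0 + - 1 * val g BQ v 0 + val g BR v 0)) dw v"
    using has_gradient_mult[OF has_gradient_const[OF v, of "- (1 / 2)"] has_gradient_add[OF has_gradient_add[OF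
          has_gradient_mult[OF has_gradient_const[OF v, of 2] has_gradient_val[OF v, of BP 0]]
          has_gradient_mult[OF has_gradient_const[OF v, of "- 1"] has_gradient_val[OF v, of BQ 0]]]
          has_gradient_val[OF v, of BR 0]]]
    by (simp only: dw_def[abs_def] mult_zero_right add_0_right)
  then show ?thesis by (rule has_gradient_cong_carrier) (simp only: w_val, simp)
qed

text \<open>The values of p, q, r at 0 survive only in the combination w, so the invariance of the
  bracket has to be verified with w as the only unknown belonging to the point 0, besides
  f(0).\<close>

lemma pair_dw:
  assumes v: "v \<in> carrier_vec n" and x: "x \<noteq> 0"
  shows "pair n \<pi> v (ev g BP x) dw = (2 * poly f x - poly f 0 * (2 + x * val g BQ v x)) / (2 * x)"
    and "pair n \<pi> v (ev g BQ x) dw = (poly f x - poly f 0) / x - poly f 0 * val g BQ v x / 2"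
    and "pair n \<pi> v (ev g BR x) dw = poly f 0 * val g BR v x / 2
      + (poly f 0 * (1 + x * val g BP v x) - poly f x) / x + poly f x * w v"
  unfolding dw_def[abs_def] pair_smult_right pair_add_right pair_ev_eqs(1-3) pair_ev_eqs(4-6)[OF x] w_val
    pair_antisym[OF v, of "ev g BQ x" "ev g BP 0"] pair_antisym[OF v, of "ev g BR x" "ev g BP 0"]
    pair_antisym[OF v, of "ev g BR x" "ev g BQ 0"] pair_ev_eqs(4-6)[OF x[symmetric]]
  using x by (simp_all add: field_simps)

text \<open>Product and quotient rule applied to \<open>val_T\<close>; the normalising factor w
  contributes the terms in \<open>dw\<close>, and the coefficients depend on v.\<close>

fun val_T_gradient :: "block \<Rightarrow> complex \<Rightarrow> complex Matrix.vec \<Rightarrow> nat \<Rightarrow> complex" where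
  "val_T_gradient BP x v = (\<lambda>i. ev g BQ x i + - 1 * ev g BP x i)"
| "val_T_gradient BQ x v = (\<lambda>i. - (1 / (w v * x)) * (2 * ev g BP x i + - 1 * ev g BQ x i + ev g BR x i)
     + (2 * val g BP v x - val g BQ v x + val g BR v x) / (w v * w v * x) * dw i)"
| "val_T_gradient BR x v = (\<lambda>i. - w v * x * ev g BQ x i + - (2 + x * val g BQ v x) * dw i)"

lemma has_gradient_val_T:
  assumes v: "v \<in> carrier_vec n" and w: "w v \<noteq> 0" and x: "x \<noteq> 0"
  shows "has_gradient n (\<lambda>u. val g b (T u) x) (val_T_gradient b x v) v"
proof -
  note c = has_gradient_const[OF v]
  note h = has_gradient_val[OF v]
  note m = has_gradient_mult[OF c]
  note cong = has_gradient_cong[OF _ polyfun_w w]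
  note z = mult_zero_right add_0_right add_0_left
  show ?thesis
  proof (cases b)
    case BP
    have "has_gradient n (\<lambda>u. val g BQ u x + - 1 * val g BP u x) (val_T_gradient BP x v) v"
      using has_gradient_add[OF h[of BQ x] m[OF h[of BP x], of "- 1"]]
      by (simp only: z val_T_gradient.simps)
    then show ?thesis unfolding BP by (rule cong) (simp add: val_T x)
  next
    case BQ
    define S where "S = (\<lambda>u. 2 * val g BP u x + - 1 * val g BQ u x + val g BR u x)"
    define dS where "dS = (\<lambda>i. 2 * ev g BP x i + - 1 * ev g BQ x i + ev g BR x i)"
    have S: "has_gradient n S dS v"
      using has_gradient_add[OF has_gradient_add[OF m[OF h[of BP x], of 2] m[OF h[of BQ x], of "- 1"]] h[of BR x]]
      unfolding S_def dS_def by (simp only: z)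
    have "has_gradient n (\<lambda>u. - (2 / x) + - (1 / x) * (S u * inverse (w u))) (val_T_gradient BQ x v) v"
    proof -
      have "val_T_gradient BQ x v = (\<lambda>i. 0 + (- (1 / x) * (S v * (- dw i / (w v)\<^sup>2) + inverse (w v) * dS i)
          + S v * inverse (w v) * 0))"
        using w x unfolding val_T_gradient.simps dS_def[symmetric]
        by (auto simp: S_def dS_def fun_eq_iff field_simps power2_eq_square)
      then show ?thesis
        using has_gradient_add[OF c[of "- (2 / x)"] m[OF has_gradient_mult[OF S
              has_gradient_inverse[OF has_gradient_w[OF v] w]], of "- (1 / x)"]]
        by simp
    qed
    then show ?thesis unfolding BQ
      by (rule cong) (simp add: val_T x S_def, simp add: x field_simps)
  next
    case BR
    have "has_gradient n (\<lambda>u. - 1 * w u * (2 + x * val g BQ u x)) (val_T_gradient BR x v) v"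
    proof -
      have "val_T_gradient BR x v = (\<lambda>i. - 1 * w v * (0 + (x * ev g BQ x i + val g BQ v x * 0))
          + (2 + x * val g BQ v x) * (- 1 * dw i + w v * 0))"
        by (simp add: fun_eq_iff algebra_simps)
      then show ?thesis
        using has_gradient_mult[OF m[OF has_gradient_w[OF v], of "- 1"] has_gradient_add[OF c[of 2] m[OF h[of BQ x], of x]]]
        by simp
    qed
    then show ?thesis unfolding BR by (rule cong) (simp add: val_T x)
  qed
qed

lemma pair_val_T_upper:
  assumes v: "v \<in> carrier_vec n" and w: "w v \<noteq> 0" and x: "x \<noteq> 0" and y: "y \<noteq> 0" and xy: "x \<noteq> y"
    and ab: "(a, b) \<in> upper"
  shows "pair n \<pi> v (val_T_gradient a x v) (val_T_gradient b y v) = pair n \<pi> (T v) (ev g a x) (ev g b y)"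
proof -
  have yx: "y \<noteq> x" using xy by simp
  note anti = pair_antisym[OF v, of dw] pair_antisym[OF v, of "ev g BQ x" "ev g BP y"]
    pair_antisym[OF v, of "ev g BR x" "ev g BP y"] pair_antisym[OF v, of "ev g BR x" "ev g BQ y"]
  note expand = val_T_gradient.simps pair_add_left pair_smult_left pair_add_right pair_smult_right
    pair_self[OF v] anti pair_dw[OF v x] pair_dw[OF v y] pair_ev_eqs(1-3)
    pair_ev_eqs(4-6)[OF xy] pair_ev_eqs(4-6)[OF yx] val_T[OF w x] val_T[OF w y]
  show ?thesis
    using ab unfolding upper_def
    by (elim insertE emptyE; clarify; unfold expand; insert w x y xy yx; simp add: divide_simps;
        (simp add: algebra_simps)?)
qed

lemma pair_val_T:
  assumes v: "v \<in> carrier_vec n" and w: "w v \<noteq> 0" and x: "x \<noteq> 0" and y: "y \<noteq> 0" and xy: "x \<noteq> y"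
  shows "pair n \<pi> v (val_T_gradient a x v) (val_T_gradient b y v) = pair n \<pi> (T v) (ev g a x) (ev g b y)"
proof (cases "(a, b) \<in> upper")
  case True
  then show ?thesis by (rule pair_val_T_upper[OF assms])
next
  case False
  then have "(b, a) \<in> upper" using upper_cases by blast
  then show ?thesis
    using pair_val_T_upper[OF v w y x xy[symmetric]]
    by (subst pair_antisym[OF v], subst pair_antisym[OF T_carrier]) simp
qed

lemma T_has_gradient:
  assumes v: "v \<in> carrier_vec n" and w: "w v \<noteq> 0"
  obtains DT where "\<And>k. k < n \<Longrightarrow> has_gradient n (\<lambda>u. T u $ k) (DT k) v"
proof -
  have "\<exists>D. has_gradient n (\<lambda>u. T u $ k) D v" if "k < n" for k
  proof -
    from T_component[OF that] obtain a where a: "a \<in> polyfun n"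
      "\<And>u. u \<in> carrier_vec n \<Longrightarrow> w u \<noteq> 0 \<Longrightarrow> T u $ k = a u / w u" by blast
    from has_gradient_rational[OF a(1) polyfun_w v w a(2)] show ?thesis by blast
  qed
  then show ?thesis using that by metis
qed

lemma pair_T_components:
  assumes v: "v \<in> carrier_vec n" and w: "w v \<noteq> 0"
    and DT: "\<And>k. k < n \<Longrightarrow> has_gradient n (\<lambda>u. T u $ k) (DT k) v"
    and kl: "k < n" "l < n"
  shows "pair n \<pi> v (DT k) (DT l) = \<pi> k l (T v)"
proof -
  define a where "a k l = pair n \<pi> v (DT k) (DT l) - \<pi> k l (T v)" for k l
  \<comment> \<open>The same function has the explicit gradient of
    \<open>has_gradient_val_T\<close>. Equating the two expressions for one bracket gives the
    pairings of the rows of the unknown Jacobian \<open>DT\<close>.\<close>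
  have comp: "has_gradient n (\<lambda>u. val g b (T u) x) (\<lambda>i. \<Sum>k<n. ev g b x k * DT k i) v" for b x
    using has_gradient_comp[OF has_gradient_val[OF T_carrier] v T_carrier DT] by (simp add: comp_def)
  have 1: "(\<Sum>k<n. \<Sum>l<n. a k l * ev g c x k * ev g b y l) = 0" if "x \<noteq> 0" "y \<noteq> 0" "x \<noteq> y" for c b x y
  proof -
    have "pair n \<pi> (T v) (ev g c x) (ev g b y)
        = bracket n \<pi> (\<lambda>u. val g c (T u) x) (\<lambda>u. val g b (T u) y) v"
      using that v w
      by (simp only: bracket_eq_pair[OF has_gradient_val_T has_gradient_val_T] pair_val_T simp_thms)
    also have "\<dots> = (\<Sum>k<n. ev g c x k * (\<Sum>l<n. ev g b y l * pair n \<pi> v (DT k) (DT l)))"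
      unfolding bracket_eq_pair[OF comp comp] pair_sum_left pair_sum_right ..
    finally have "(\<Sum>k<n. ev g c x k * (\<Sum>l<n. ev g b y l * pair n \<pi> v (DT k) (DT l)))
        - pair n \<pi> (T v) (ev g c x) (ev g b y) = 0" by simp
    moreover have "(\<Sum>k<n. ev g c x k * (\<Sum>l<n. ev g b y l * pair n \<pi> v (DT k) (DT l)))
        - pair n \<pi> (T v) (ev g c x) (ev g b y) = (\<Sum>k<n. \<Sum>l<n. a k l * ev g c x k * ev g b y l)"
      unfolding pair_def[of n \<pi> "T v"] sum_distrib_left sum_subtractf[symmetric] a_def
      by (intro sum.cong refl) (simp only: algebra_simps)
    ultimately show ?thesis by simp
  qed
  have 2: "(\<Sum>k<n. a k l * ev g c x k) = 0" if "x \<notin> {0}" for c x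
  proof (rule ev_extract[OF _ _ kl(2)])
    fix b y assume "y \<notin> {0, x}"
    then have "(\<Sum>k<n. \<Sum>l<n. a k l * ev g c x k * ev g b y l) = 0" using that by (intro 1) auto
    then show "(\<Sum>l<n. (\<Sum>k<n. a k l * ev g c x k) * ev g b y l) = 0"
      unfolding sum_distrib_right by (subst sum.swap)
  qed simp
  have "a k l = 0"
    by (rule ev_extract[OF _ _ kl(1), of "{0}"]) (use 2 in simp_all)
  then show ?thesis by (simp add: a_def)
qed

lemma poisson_map: "poisson_map n \<pi> T"
  unfolding poisson_map_def
proof (intro allI impI)
  fix F H assume "rational_fun n F" "rational_fun n H"
  then obtain a d b e x y
    where F: "a \<in> polyfun n" "d \<in> polyfun n" "x \<in> carrier_vec n" "d x \<noteq> 0"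
        "\<And>v. v \<in> carrier_vec n \<Longrightarrow> d v \<noteq> 0 \<Longrightarrow> F v = a v / d v"
      and H: "b \<in> polyfun n" "e \<in> polyfun n" "y \<in> carrier_vec n" "e y \<noteq> 0"
        "\<And>v. v \<in> carrier_vec n \<Longrightarrow> e v \<noteq> 0 \<Longrightarrow> H v = b v / e v"
    unfolding rational_fun_def by blast
  show "generically n (\<lambda>v. bracket n \<pi> (F \<circ> T) (H \<circ> T) v = bracket n \<pi> F H (T v))"
  \<comment> \<open>F and H are controlled only off the zeros of d and e, so v must be such that
    \<open>T v\<close> avoids these; dominance of T makes this a generic condition.\<close>
  proof (rule generically_mp2[OF generically_T[OF F(2-4)] generically_T[OF H(2-4)]])
    fix v assume v: "v \<in> carrier_vec n" and *: "w v \<noteq> 0 \<and> d (T v) \<noteq> 0" "w v \<noteq> 0 \<and> e (T v) \<noteq> 0"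
    obtain D where D: "has_gradient n F D (T v)"
      using has_gradient_rational[OF F(1,2) T_carrier _ F(5)] * by blast
    obtain E where E: "has_gradient n H E (T v)"
      using has_gradient_rational[OF H(1,2) T_carrier _ H(5)] * by blast
    obtain DT where DT: "\<And>k. k < n \<Longrightarrow> has_gradient n (\<lambda>u. T u $ k) (DT k) v"
      using T_has_gradient[OF v] * by blast
    have FT: "has_gradient n (F \<circ> T) (\<lambda>i. \<Sum>k<n. D k * DT k i) v"
      by (rule has_gradient_comp[OF D v T_carrier DT])
    have HT: "has_gradient n (H \<circ> T) (\<lambda>i. \<Sum>k<n. E k * DT k i) v"
      by (rule has_gradient_comp[OF E v T_carrier DT])
    have "bracket n \<pi> (F \<circ> T) (H \<circ> T) v = (\<Sum>k<n. D k * (\<Sum>l<n. E l * pair n \<pi> v (DT k) (DT l)))"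
      unfolding bracket_eq_pair[OF FT HT] pair_sum_left pair_sum_right ..
    also have "\<dots> = (\<Sum>k<n. \<Sum>l<n. \<pi> k l (T v) * D k * E l)"
      unfolding sum_distrib_left
      by (intro sum.cong refl) (use pair_T_components[OF v _ DT] * in simp)
    also have "\<dots> = bracket n \<pi> F H (T v)"
      unfolding bracket_eq_pair[OF D E] pair_def ..
    finally show "bracket n \<pi> (F \<circ> T) (H \<circ> T) v = bracket n \<pi> F H (T v)" .
  qed
qed

section \<open>The invariants\<close>

text \<open>Counted from 0: \<open>H k\<close> belongs to x^(k + 1), so the indices below 2 g + 1
  cover all non-constant coefficients.\<close>

definition H :: "nat \<Rightarrow> cfun" where
  "H k v = coeff (poly_P g v * poly_P g v + poly_Q g v * poly_R g v) (k + 1)"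

lemma polyfun_H: "H k \<in> polyfun n"
  unfolding H_def[abs_def] coeff_add coeff_mult by (intro polyfun_intros polyfun_coeffs)

text \<open>The factor - w x cancels in the product of the new Q and the new R, which leaves (Q -
  P)^2 + (2 P - Q + R) Q = P^2 + Q R.\<close>

lemma H_T: "w v \<noteq> 0 \<Longrightarrow> H k (T v) = H k v"
proof -
  assume w: "w v \<noteq> 0"
  have "Polynomial.smult (- (1 / w v)) (s v) * ([:0, - w v:] * poly_Q g v) = pCons 0 (s v) * poly_Q g v"
    using w by simp
  then have "poly_P g (T v) * poly_P g (T v) + poly_Q g (T v) * poly_R g (T v)
      = poly_P g v * poly_P g v + poly_Q g v * poly_R g v"
    unfolding triplet_T[OF w] s_shift[symmetric] by (simp add: algebra_simps)
  then show ?thesis by (simp add: H_def)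
qed

lemma sum_H: "(\<Sum>k<2 * g + 1. H k v * x ^ Suc k)
    = (1 + x * val g BP v x) * (1 + x * val g BP v x) + (2 + x * val g BQ v x) * (x * val g BR v x) - 1"
proof -
  define h where "h = poly_P g v * poly_P g v + poly_Q g v * poly_R g v"
  have "coeff h i = 0" if "i \<ge> Suc (2 * g + 1)" for i
  proof -
    have "degree (poly_P g v) \<le> g" "degree (poly_Q g v) \<le> g" "degree (poly_R g v) \<le> g + 1"
      by (auto intro!: degree_le simp: coeff_poly_P coeff_poly_Q coeff_poly_R)
    then have "degree (poly_P g v * poly_P g v) \<le> 2 * g + 1" "degree (poly_Q g v * poly_R g v) \<le> 2 * g + 1"
      using degree_mult_le[of "poly_P g v" "poly_P g v"] degree_mult_le[of "poly_Q g v" "poly_R g v"] by linarith+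
    then have "degree h \<le> 2 * g + 1" unfolding h_def by (rule degree_add_le)
    then show ?thesis using that by (intro coeff_eq_0) simp
  qed
  then have "poly h x = (\<Sum>i<Suc (2 * g + 1). coeff h i * x ^ i)" by (rule poly_altdef_lessThan)
  also have "\<dots> = coeff h 0 + (\<Sum>k<2 * g + 1. H k v * x ^ Suc k)"
    by (subst sum.lessThan_Suc_shift) (simp add: H_def h_def del: sum.lessThan_Suc)
  also have "coeff h 0 = 1" by (simp add: h_def coeff_mult coeff_poly_P coeff_poly_R)
  finally show ?thesis by (simp add: h_def poly_P_eq poly_Q_eq poly_R_eq)
qed

text \<open>The differential 2 P dP + R dQ + Q dR of the generating function at x; each of dP, dQ,
  dR is x times an evaluation covector.\<close>

definition dH :: "complex \<Rightarrow> complex Matrix.vec \<Rightarrow> nat \<Rightarrow> complex" where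
  "dH x v i = 2 * (1 + x * val g BP v x) * x * ev g BP x i + x * x * val g BR v x * ev g BQ x i
     + (2 + x * val g BQ v x) * x * ev g BR x i"

lemma partial_deriv_H:
  assumes v: "v \<in> carrier_vec n" and i: "i < n"
  shows "(\<Sum>k<2 * g + 1. partial_deriv i (H k) v * x ^ Suc k) = dH x v i"
proof -
  have sum: "has_gradient n (\<lambda>u. \<Sum>k<m. H k u * x ^ Suc k) (\<lambda>i. \<Sum>k<m. partial_deriv i (H k) v * x ^ Suc k) v" for m
  proof (induction m)
    case 0
    show ?case using has_gradient_const[OF v, of 0] by simp
  next
    case (Suc m)
    then show ?case
      using has_gradient_add[OF Suc has_gradient_mult[OF has_gradient_polyfun[OF polyfun_H v] has_gradient_const[OF v, of "x ^ Suc m"]]]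
      by (simp add: mult_ac)
  qed
  have lin: "has_gradient n (\<lambda>u. c + x * val g b u x) (\<lambda>i. x * ev g b x i) v" for c b
    using has_gradient_add[OF has_gradient_const[OF v, of c]
        has_gradient_mult[OF has_gradient_const[OF v, of x] has_gradient_val[OF v, of b x]]]
    by (simp only: mult_zero_right add_0_right add_0_left)
  have "has_gradient n (\<lambda>u. - 1 + ((1 + x * val g BP u x) * (1 + x * val g BP u x)
      + (2 + x * val g BQ u x) * (0 + x * val g BR u x)))
    (\<lambda>i. 0 + ((1 + x * val g BP v x) * (x * ev g BP x i) + (1 + x * val g BP v x) * (x * ev g BP x i)
      + ((2 + x * val g BQ v x) * (x * ev g BR x i) + (0 + x * val g BR v x) * (x * ev g BQ x i)))) v"
    by (intro has_gradient_add has_gradient_mult lin has_gradient_const v)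
  then have "has_gradient n (\<lambda>u. \<Sum>k<2 * g + 1. H k u * x ^ Suc k)
    (\<lambda>i. 0 + ((1 + x * val g BP v x) * (x * ev g BP x i) + (1 + x * val g BP v x) * (x * ev g BP x i)
      + ((2 + x * val g BQ v x) * (x * ev g BR x i) + (0 + x * val g BR v x) * (x * ev g BQ x i)))) v"
    by (rule has_gradient_cong_carrier) (simp only: sum_H, simp)
  from has_gradient_partial_deriv[OF this i] has_gradient_partial_deriv[OF sum i, of "2 * g + 1"]
  show ?thesis by (simp only: dH_def) (simp add: algebra_simps)
qed

lemma pair_dH:
  assumes v: "v \<in> carrier_vec n" and xy: "x \<noteq> y"
  shows "pair n \<pi> v (dH x v) (dH y v) = 0"
proof -
  have yx: "y \<noteq> x" using xy by simp
  note anti = pair_antisym[OF v, of "ev g BQ x" "ev g BP y"]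
    pair_antisym[OF v, of "ev g BR x" "ev g BP y"] pair_antisym[OF v, of "ev g BR x" "ev g BQ y"]
  show ?thesis
    unfolding dH_def[abs_def] pair_add_left pair_smult_left pair_add_right pair_smult_right
      anti pair_ev_eqs(1-3) pair_ev_eqs(4-6)[OF xy] pair_ev_eqs(4-6)[OF yx]
    using xy yx by (simp add: divide_simps) (simp add: algebra_simps)
qed

lemma involution:
  assumes v: "v \<in> carrier_vec n" and kl: "k < 2 * g + 1" "l < 2 * g + 1"
  shows "bracket n \<pi> (H k) (H l) v = 0"
proof -
  define D where "D k i = partial_deriv i (H k) v" for k i
  define b where "b k l = bracket n \<pi> (H k) (H l) v" for k l
  have b: "b k l = pair n \<pi> v (D k) (D l)" for k l
    unfolding b_def D_def
    by (rule bracket_eq_pair) (rule has_gradient_polyfun[OF polyfun_H v])+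
  \<comment> \<open>The generating function of the invariants starts with x^1, so a common factor x
    y has to be cancelled; this excludes the value 0.\<close>
  have 1: "(\<Sum>k<2 * g + 1. \<Sum>l<2 * g + 1. b k l * x ^ k * y ^ l) = 0" if "x \<noteq> 0" "y \<noteq> 0" "x \<noteq> y" for x y
  proof -
    have "0 = pair n \<pi> v (dH x v) (dH y v)" using pair_dH[OF v that(3)] by simp
    also have "\<dots> = pair n \<pi> v (\<lambda>i. \<Sum>k<2 * g + 1. x ^ Suc k * D k i) (\<lambda>i. \<Sum>l<2 * g + 1. y ^ Suc l * D l i)"
      by (rule pair_cong) (simp_all only: partial_deriv_H[OF v, symmetric] D_def mult.commute)
    also have "\<dots> = x * y * (\<Sum>k<2 * g + 1. \<Sum>l<2 * g + 1. b k l * x ^ k * y ^ l)"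
      unfolding pair_sum_left pair_sum_right b sum_distrib_left
      by (intro sum.cong refl) (simp only: power_Suc mult_ac)
    finally show ?thesis using that by simp
  qed
  have 2: "(\<Sum>k<2 * g + 1. b k l * x ^ k) = 0" if "x \<notin> {0}" for x
  proof (rule power_sum_extract[OF _ _ kl(2)])
    fix y assume "y \<notin> {0, x}"
    then have "(\<Sum>k<2 * g + 1. \<Sum>l<2 * g + 1. b k l * x ^ k * y ^ l) = 0" using that by (intro 1) auto
    then show "(\<Sum>l<2 * g + 1. (\<Sum>k<2 * g + 1. b k l * x ^ k) * y ^ l) = 0"
      unfolding sum_distrib_right by (subst sum.swap)
  qed simp
  have "b k l = 0" by (rule power_sum_extract[of "{0}", OF _ 2 kl(1)]) simp_all
  then show ?thesis by (simp add: b_def)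
qed

end

section \<open>Rank of a bivector\<close>

lemma sum_lessThan_add:
  fixes h :: "nat \<Rightarrow> 'a :: comm_monoid_add"
  shows "(\<Sum>k<a + b. h k) = (\<Sum>k<a. h k) + (\<Sum>k<b. h (a + k))"
  by (induction b) (simp_all add: add.assoc)

lemma rank_sum_products:
  fixes F G :: "nat \<Rightarrow> nat \<Rightarrow> complex"
  shows "vec_space.rank n (mat n n (\<lambda>(i, j). \<Sum>t<s. F t i * G t j)) \<le> s"
proof (induction s)
  case 0
  have "mat n n (\<lambda>(i, j). \<Sum>t<0. F t i * G t j) = 0\<^sub>m n n" by (intro eq_matI) auto
  then show ?case using vec_space.rank_0I[where 'a = complex, of n n] by (simp only: order_refl)
next
  case (Suc s)
  let ?A = "mat n n (\<lambda>(i, j). \<Sum>t<s. F t i * G t j)" and ?B = "mat n n (\<lambda>(i, j). F s i * G s j)"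
  have "mat n n (\<lambda>(i, j). \<Sum>t<Suc s. F t i * G t j) = ?A + ?B" by (intro eq_matI) auto
  moreover have "vec_space.rank n (?A + ?B) \<le> vec_space.rank n ?A + vec_space.rank n ?B"
    by (rule vec_space.rank_subadditive) auto
  ultimately have "vec_space.rank n (mat n n (\<lambda>(i, j). \<Sum>t<Suc s. F t i * G t j))
      \<le> vec_space.rank n ?A + vec_space.rank n ?B" by (simp only:)
  also have "\<dots> \<le> s + 1"
    by (intro add_mono Suc vec_space.rank_le_1_product_entries) auto
  finally show ?case by (simp only: Suc_eq_plus1)
qed

lemma rank_ge_leading_minor:
  fixes A :: "complex mat"
  assumes A: "A \<in> carrier_mat n n" and s: "s \<le> n"
    and det: "det (mat s s (\<lambda>(i, j). A $$ (i, j))) \<noteq> 0"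
  shows "s \<le> vec_space.rank n A"
proof -
  have pick: "pick {..<s} i = i" if "i < s" for i
  proof -
    have "{a \<in> {..<s}. a < i} = {..<i}" using that by auto
    then show ?thesis using pick_card_in_set[of i "{..<s}"] that by simp
  qed
  have "{i. i < n \<and> i \<in> {..<s}} = {..<s}" using s by auto
  then have c: "card {i. i < n \<and> i \<in> {..<s}} = s" by simp
  have "submatrix A {..<s} {..<s} = mat s s (\<lambda>(i, j). A $$ (i, j))"
    using A c by (intro eq_matI) (auto simp: submatrix_def pick)
  then have "det (submatrix A {..<s} {..<s}) \<noteq> 0" using det by simp
  from vec_space.rank_gt_minor[OF A this] show ?thesis unfolding c .
qed

text \<open>
  In a basis whose first \<open>m\<close> vectors span an isotropic subspace, the Gram matrix has a
  vanishing \<open>m \<times> m\<close> block.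
\<close>

lemma rank_le_isotropic:
  assumes det: "det (mat n n (\<lambda>(j, i). K i j)) \<noteq> 0" and n: "n = m + d"
    and iso: "\<And>k l. k < m \<Longrightarrow> l < m \<Longrightarrow> pair n \<pi> v (K k) (K l) = 0"
  shows "vec_space.rank n (mat n n (\<lambda>(i, j). \<pi> i j v)) \<le> 2 * d"
proof -
  define A where "A = mat n n (\<lambda>(j, i). K i j)"
  have A: "A \<in> carrier_mat n n" by (simp add: A_def)
  obtain B where B: "B \<in> carrier_mat n n" "A * B = 1\<^sub>m n"
    using det_non_zero_imp_unit[OF A, of "()"] det
    unfolding A_def[symmetric] Units_def ring_mat_def by auto
  \<comment> \<open>The columns of the inverse matrix expand the coordinate covectors in the basis
    K.\<close>
  define b where "b k i = B $$ (k, i)" for k i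
  have dual: "(\<Sum>k<n. b k i * K k j) = of_bool (j = i)" if "i < n" "j < n" for i j
  proof -
    have "(A * B) $$ (j, i) = (\<Sum>k<n. b k i * K k j)"
      using A B(1) that by (simp add: scalar_prod_def A_def b_def lessThan_atLeast0 mult.commute)
    then show ?thesis using B(2) that by (simp add: of_bool_def)
  qed
  define N where "N k l = pair n \<pi> v (K k) (K l)" for k l
  \<comment> \<open>The entry of \<pi> is the sum of b k i * N k l * b l j. The terms with k = m + t
    give d products; among those with k < m only l = m + t survives, which gives d more.\<close>
  define F where "F t i = (if t < d then b (m + t) i else \<Sum>k<m. b k i * N k (m + (t - d)))" for t i
  define G where "G t j = (if t < d then \<Sum>l<n. b l j * N (m + t) l else b (m + (t - d)) j)" for t j
  have "\<pi> i j v = (\<Sum>t<2 * d. F t i * G t j)" if ij: "i < n" "j < n" for i j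
  proof -
    have "\<pi> i j v = pair n \<pi> v (\<lambda>k. of_bool (k = i)) (\<lambda>k. of_bool (k = j))"
      using ij by (simp only: pair_of_bool)
    also have "\<dots> = pair n \<pi> v (\<lambda>r. \<Sum>k<n. b k i * K k r) (\<lambda>r. \<Sum>l<n. b l j * K l r)"
      by (rule pair_cong) (simp_all add: dual ij)
    also have "\<dots> = (\<Sum>k<m + d. b k i * (\<Sum>l<n. b l j * N k l))"
      unfolding pair_sum_left pair_sum_right N_def n ..
    also have "\<dots> = (\<Sum>k<m. b k i * (\<Sum>l<n. b l j * N k l)) + (\<Sum>t<d. F t i * G t j)"
      unfolding sum_lessThan_add by (simp add: F_def G_def)
    also have "(\<Sum>k<m. b k i * (\<Sum>l<n. b l j * N k l)) = (\<Sum>k<m. \<Sum>t<d. b k i * N k (m + t) * b (m + t) j)"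
    proof (intro sum.cong refl)
      fix k assume "k \<in> {..<m}"
      then have "(\<Sum>l<n. b l j * N k l) = (\<Sum>t<d. b (m + t) j * N k (m + t))"
        unfolding n sum_lessThan_add using iso by (simp add: N_def)
      then show "b k i * (\<Sum>l<n. b l j * N k l) = (\<Sum>t<d. b k i * N k (m + t) * b (m + t) j)"
        by (simp add: sum_distrib_left mult_ac)
    qed
    also have "\<dots> = (\<Sum>t<d. F (d + t) i * G (d + t) j)"
      by (subst sum.swap) (simp add: F_def G_def sum_distrib_right)
    also have "\<dots> + (\<Sum>t<d. F t i * G t j) = (\<Sum>t<2 * d. F t i * G t j)"
      unfolding mult_2 sum_lessThan_add by (rule add.commute)
    finally show ?thesis .
  qed
  then have "mat n n (\<lambda>(i, j). \<pi> i j v) = mat n n (\<lambda>(i, j). \<Sum>t<2 * d. F t i * G t j)"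
    by (intro eq_matI) auto
  then show ?thesis using rank_sum_products[of n F G "2 * d"] by simp
qed

section \<open>Determinants, kernels and genericity\<close>

lemma det_nonzeroI:
  fixes a :: "nat \<Rightarrow> nat \<Rightarrow> complex"
  assumes "\<And>c. (\<And>i. i < n \<Longrightarrow> (\<Sum>j<n. a i j * c j) = 0) \<Longrightarrow> (\<And>j. j < n \<Longrightarrow> c j = 0)"
  shows "det (mat n n (\<lambda>(i, j). a i j)) \<noteq> 0"
proof
  assume "det (mat n n (\<lambda>(i, j). a i j)) = 0"
  then obtain c where c: "c \<in> carrier_vec n" "c \<noteq> 0\<^sub>v n" "mat n n (\<lambda>(i, j). a i j) *\<^sub>v c = 0\<^sub>v n"
    using det_0_iff_vec_prod_zero[of "mat n n (\<lambda>(i, j). a i j)" n] by auto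
  have "(\<Sum>j<n. a i j * c $ j) = 0" if "i < n" for i
    using arg_cong[OF c(3), of "\<lambda>v. v $ i"] that c(1) by (simp add: scalar_prod_def lessThan_atLeast0)
  then have "c $ j = 0" if "j < n" for j using assms[of "\<lambda>j. c $ j"] that by blast
  then show False using c(1,2) by auto
qed

lemma det_nonzeroD:
  fixes a :: "nat \<Rightarrow> nat \<Rightarrow> complex"
  assumes det: "det (mat n n (\<lambda>(i, j). a i j)) \<noteq> 0"
    and z: "\<And>i. i < n \<Longrightarrow> (\<Sum>j<n. a i j * c j) = 0" and j: "j < n"
  shows "c j = 0"
proof (rule ccontr)
  assume "c j \<noteq> 0"
  then have "Matrix.vec n c \<noteq> 0\<^sub>v n" using j by (metis index_vec index_zero_vec(1))
  moreover have "mat n n (\<lambda>(i, j). a i j) *\<^sub>v Matrix.vec n c = 0\<^sub>v n"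
    using z by (intro eq_vecI) (auto simp: scalar_prod_def lessThan_atLeast0)
  ultimately have "det (mat n n (\<lambda>(i, j). a i j)) = 0"
    by (intro det_0_iff_vec_prod_zero[THEN iffD2] exI[of _ "Matrix.vec n c"]) auto
  then show False using det by simp
qed

lemma generically_det:
  assumes "\<And>i j. i < m \<Longrightarrow> j < m \<Longrightarrow> poly_on n (a i j)"
    and v: "v \<in> carrier_vec n" and det: "det (mat m m (\<lambda>(i, j). a i j v)) \<noteq> 0"
  shows "generically n (\<lambda>v. det (mat m m (\<lambda>(i, j). a i j v)) \<noteq> 0)"
proof -
  have "\<forall>i j. \<exists>b. i < m \<longrightarrow> j < m \<longrightarrow> b \<in> polyfun n \<and> (\<forall>v\<in>carrier_vec n. a i j v = b v)"
    using assms(1) unfolding poly_on_def by blast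
  then obtain b where b: "\<And>i j. i < m \<Longrightarrow> j < m \<Longrightarrow> b i j \<in> polyfun n"
    "\<And>i j v. i < m \<Longrightarrow> j < m \<Longrightarrow> v \<in> carrier_vec n \<Longrightarrow> a i j v = b i j v"
    by metis
  have eq: "mat m m (\<lambda>(i, j). a i j u) = mat m m (\<lambda>(i, j). b i j u)" if "u \<in> carrier_vec n" for u
    using b(2) that by (intro eq_matI) auto
  show ?thesis
    by (rule genericallyI[OF polyfun_det[OF b(1)] v]) (use eq det v in auto)
qed

section \<open>Independence of the invariants and rank\<close>

context volterra_bracket begin

text \<open>The differentials of the invariants are completed to a square matrix by the coordinate
  covectors of q, since at the test point they are already independent in the directions of p and
  r.\<close>

definition K :: "nat \<Rightarrow> nat \<Rightarrow> cfun" where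
  "K k i v = (if k < 2 * g + 1 then partial_deriv i (H k) v else of_bool (i = g + (k - (2 * g + 1))))"

lemma poly_on_K: "i < n \<Longrightarrow> poly_on n (K k i)"
proof -
  assume i: "i < n"
  have "poly_on n (partial_deriv i (H k))" using poly_on_polyfun[OF polyfun_H] i by (rule poly_on_partial_deriv)
  moreover have "poly_on n (\<lambda>v. of_bool (i = g + (k - (2 * g + 1))))"
    by (rule poly_on_polyfun) (rule polyfun.const)
  ultimately show ?thesis unfolding K_def[abs_def] by (cases "k < 2 * g + 1") simp_all
qed

lemma val_unit_vec:
  assumes "j < n"
  shows "val g b (unit_vec n j) x = ev g b x j"
proof -
  have "val g b (unit_vec n j) x = (\<Sum>k<n. unit_vec n j $ k * ev g b x k)"
    unfolding sum_ev val_def ..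
  also have "\<dots> = (\<Sum>k<n. if k = j then ev g b x k else 0)"
    by (intro sum.cong refl) (use assms in \<open>simp add: unit_vec_def\<close>)
  finally show ?thesis using assms by (simp add: sum.delta del: sum.lessThan_Suc)
qed

lemma det_K_nonzero:
  assumes g: "g \<ge> 1"
  defines "v \<equiv> unit_vec n (2 * g - 1)"
  shows "det (mat n n (\<lambda>(i, k). K k i v)) \<noteq> 0"
proof -
  have v: "v \<in> carrier_vec n" by (simp add: v_def)
  have j: "2 * g - 1 < n" by simp
  \<comment> \<open>Index \<open>2 * g - 1\<close> is the leading coefficient of Q. As R = 0 here,
    the dQ part of \<open>dH\<close> drops out.\<close>
  have val: "val g BP v x = 0" "val g BQ v x = x ^ (g - 1)" "val g BR v x = 0" for x
    unfolding v_def val_unit_vec[OF j] using g by (auto simp: ev_def intro: arg_cong[of _ _ "\<lambda>k. x ^ k"])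
  have dH: "dH x v i = x * (2 * ev g BP x i + (2 + x ^ g) * ev g BR x i)" for x i
  proof -
    have "x * x ^ (g - 1) = x ^ g" using g by (metis power_minus_mult mult.commute One_nat_def less_eq_Suc_le)
    then show ?thesis by (simp add: dH_def val algebra_simps)
  qed
  \<comment> \<open>Comparing coefficients for x \<noteq> 0 identifies the single partial
    derivatives; the cancelled factor x accounts for \<open>H k\<close> belonging to x^(k +
    1).\<close>
  have ext: "partial_deriv i (H k) v = b k"
    if i: "i < n" and k: "k < 2 * g + 1"
      and b: "\<And>x. (\<Sum>k<2 * g + 1. b k * x ^ k) = 2 * ev g BP x i + (2 + x ^ g) * ev g BR x i" for i k b
  proof -
    have "partial_deriv i (H k) v - b k = 0"
    proof (rule power_sum_extract[OF _ _ k])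
      fix x :: complex assume x: "x \<notin> {0}"
      have "x * (\<Sum>k<2 * g + 1. partial_deriv i (H k) v * x ^ k) = x * (\<Sum>k<2 * g + 1. b k * x ^ k)"
        unfolding b dH[symmetric] partial_deriv_H[OF v i, symmetric] sum_distrib_left
        by (simp only: power_Suc mult_ac)
      then have "(\<Sum>k<2 * g + 1. partial_deriv i (H k) v * x ^ k) = (\<Sum>k<2 * g + 1. b k * x ^ k)"
        using x by simp
      then show "(\<Sum>k<2 * g + 1. (partial_deriv i (H k) v - b k) * x ^ k) = 0"
        by (simp only: left_diff_distrib sum_subtractf diff_self)
    qed simp
    then show ?thesis by simp
  qed
  have delta: "(\<Sum>k<m. of_bool (k = i) * h k) = (h i :: complex)" if "i < m" for i m :: nat and h
    using that by (simp add: of_bool_def if_distrib[of "\<lambda>x. x * _"] sum.delta cong: if_cong)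
  have P: "partial_deriv i (H k) v = of_bool (k = i) * 2" if "i < g" "k < 2 * g + 1" for i k
  proof (rule ext)
    fix x :: complex
    have "(\<Sum>k<2 * g + 1. of_bool (k = i) * (2 * x ^ k)) = 2 * x ^ i" using that by (intro delta) simp
    then show "(\<Sum>k<2 * g + 1. of_bool (k = i) * 2 * x ^ k) = 2 * ev g BP x i + (2 + x ^ g) * ev g BR x i"
      using that by (simp add: ev_def mult.assoc del: sum.lessThan_Suc)
  qed (use that in simp_all)
  have R: "partial_deriv (2 * g + i) (H k) v = of_bool (k = i) * 2 + of_bool (k = i + g) * 1"
    if "i \<le> g" "k < 2 * g + 1" for i k
  proof (rule ext)
    fix x :: complex
    have "(\<Sum>k<2 * g + 1. of_bool (k = i) * (2 * x ^ k)) = 2 * x ^ i"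
      "(\<Sum>k<2 * g + 1. of_bool (k = i + g) * (1 * x ^ k)) = 1 * x ^ (i + g)"
      using that by (intro delta; simp)+
    then have "(\<Sum>k<2 * g + 1. (of_bool (k = i) * 2 + of_bool (k = i + g) * 1) * x ^ k) = 2 * x ^ i + 1 * x ^ (i + g)"
      by (simp only: distrib_right sum.distrib mult.assoc)
    also have "\<dots> = 2 * ev g BP x (2 * g + i) + (2 + x ^ g) * ev g BR x (2 * g + i)"
      using that g by (simp add: ev_def power_add algebra_simps)
    finally show "(\<Sum>k<2 * g + 1. (of_bool (k = i) * 2 + of_bool (k = i + g) * 1) * x ^ k)
      = 2 * ev g BP x (2 * g + i) + (2 + x ^ g) * ev g BR x (2 * g + i)" .
  qed (use that in simp_all)
  show ?thesis
  proof (rule det_nonzeroI)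
    fix c :: "nat \<Rightarrow> complex" and k
    assume z: "\<And>i. i < n \<Longrightarrow> (\<Sum>k<n. K k i v * c k) = 0" and k: "k < n"
    have n: "n = (2 * g + 1) + g" by simp
    have z': "(\<Sum>k<2 * g + 1. partial_deriv i (H k) v * c k) + (\<Sum>t<g. of_bool (i = g + t) * c (2 * g + 1 + t)) = 0"
      if "i < n" for i
    proof -
      have "(\<Sum>k<2 * g + 1. K k i v * c k) = (\<Sum>k<2 * g + 1. partial_deriv i (H k) v * c k)"
        by (intro sum.cong refl) (simp add: K_def)
      moreover have "(\<Sum>t<g. K (2 * g + 1 + t) i v * c (2 * g + 1 + t)) = (\<Sum>t<g. of_bool (i = g + t) * c (2 * g + 1 + t))"
        by (intro sum.cong refl) (simp add: K_def)
      ultimately show ?thesis using z[OF that] unfolding n sum_lessThan_add by (simp only:)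
    qed
    \<comment> \<open>A p row has the entry 2 at k = i only, an r row has 2 at k = i and 1 at k = i
      + g. So the p rows settle the first g unknowns, the r rows the other invariants, and the q
      rows the added covectors.\<close>
    have c0: "c i = 0" if "i < g" for i
    proof -
      have "(\<Sum>k<2 * g + 1. partial_deriv i (H k) v * c k) = (\<Sum>k<2 * g + 1. of_bool (k = i) * (2 * c k))"
        by (intro sum.cong refl) (use P that in simp)
      also have "\<dots> = 2 * c i" by (rule delta) (use that in simp)
      moreover have "(\<Sum>t<g. of_bool (i = g + t) * c (2 * g + 1 + t)) = 0"
        by (intro sum.neutral) (use that in simp)
      ultimately show ?thesis using z'[of i] that by simp
    qed
    have c1: "2 * c i + c (i + g) = 0" if "i \<le> g" for i
    proof -
      have "(\<Sum>k<2 * g + 1. partial_deriv (2 * g + i) (H k) v * c k)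
          = (\<Sum>k<2 * g + 1. of_bool (k = i) * (2 * c k)) + (\<Sum>k<2 * g + 1. of_bool (k = i + g) * c k)"
        unfolding sum.distrib[symmetric] by (intro sum.cong refl) (use R that in simp)
      also have "(\<Sum>k<2 * g + 1. of_bool (k = i) * (2 * c k)) = 2 * c i" by (rule delta) (use that in simp)
      also have "(\<Sum>k<2 * g + 1. of_bool (k = i + g) * c k) = c (i + g)" by (rule delta) (use that in simp)
      moreover have "(\<Sum>t<g. of_bool (2 * g + i = g + t) * c (2 * g + 1 + t)) = 0"
        by (intro sum.neutral) simp
      ultimately show ?thesis using z'[of "2 * g + i"] that by simp
    qed
    have c2: "c k = 0" if "k < 2 * g" for k
      using c0[of k] c0[of "k - g"] c1[of "k - g"] that by (cases "k < g") auto
    \<comment> \<open>The last r row involves the unknown with index g, which is already known to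
      vanish because g < 2 g.\<close>
    have "c (2 * g) = 0" using c1[of g] c2[of g] g by (simp add: mult_2)
    then have c3: "c k = 0" if "k < 2 * g + 1" for k
      using c2[of k] that by (cases "k = 2 * g") auto
    have c4: "c (2 * g + 1 + t) = 0" if "t < g" for t
    proof -
      have "(\<Sum>k<2 * g + 1. partial_deriv (g + t) (H k) v * c k) = 0"
        by (intro sum.neutral) (use c3 in simp)
      moreover have "(\<Sum>s<g. of_bool (g + t = g + s) * c (2 * g + 1 + s)) = (\<Sum>s<g. of_bool (s = t) * c (2 * g + 1 + s))"
        by (intro sum.cong refl) auto
      moreover have "\<dots> = c (2 * g + 1 + t)" by (rule delta) (rule that)
      ultimately show ?thesis using z'[of "g + t"] that by simp
    qed
    show "c k = 0" using c3[of k] c4[of "k - (2 * g + 1)"] k by (cases "k < 2 * g + 1") auto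
  qed
qed

lemma generically_det_K:
  assumes "g \<ge> 1"
  shows "generically n (\<lambda>v. det (mat n n (\<lambda>(i, k). K k i v)) \<noteq> 0)"
  by (rule generically_det[OF poly_on_K _ det_K_nonzero[OF assms]]) simp_all

lemma functionally_independent:
  assumes "g \<ge> 1"
  shows "functionally_independent n (2 * g + 1) H"
  unfolding functionally_independent_def
proof (rule generically_mp[OF generically_det_K[OF assms]]; intro allI impI)
  fix v and c :: "nat \<Rightarrow> complex" and k
  assume det: "det (mat n n (\<lambda>(i, k). K k i v)) \<noteq> 0" and k: "k < 2 * g + 1"
    and z: "\<forall>i<n. (\<Sum>k<2 * g + 1. c k * partial_deriv i (H k) v) = 0"
  \<comment> \<open>A linear relation among the invariants is extended by zero to the added
    covectors, so that the invertible square matrix applies.\<close>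
  define c' where "c' k = (if k < 2 * g + 1 then c k else 0)" for k
  have "(\<Sum>k<n. K k i v * c' k) = 0" if "i < n" for i
  proof -
    have "(\<Sum>k<n. K k i v * c' k) = (\<Sum>k<2 * g + 1. c k * partial_deriv i (H k) v)"
      by (rule sum.mono_neutral_cong_right) (auto simp: c'_def K_def)
    then show ?thesis using z that by simp
  qed
  then have "c' k = 0" using k det_nonzeroD[OF det, of c' k] by simp
  then show "c k = 0" using k by (simp add: c'_def)
qed

lemma rank_upper:
  assumes v: "v \<in> carrier_vec n" and det: "det (mat n n (\<lambda>(i, k). K k i v)) \<noteq> 0"
  shows "vec_space.rank n (mat n n (\<lambda>(i, j). \<pi> i j v)) \<le> 2 * g"
proof (rule rank_le_isotropic[OF det, of "2 * g + 1"])
  fix k l assume kl: "k < 2 * g + 1" "l < 2 * g + 1"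
  have "bracket n \<pi> (H k) (H l) v = pair n \<pi> v (\<lambda>i. partial_deriv i (H k) v) (\<lambda>i. partial_deriv i (H l) v)"
    by (rule bracket_eq_pair) (rule has_gradient_polyfun[OF polyfun_H v])+
  then show "pair n \<pi> v (\<lambda>i. K k i v) (\<lambda>i. K l i v) = 0"
    using involution[OF v kl] kl by (simp add: K_def)
qed simp

text \<open>
  At a point where \<open>Q\<close> has distinct roots \<open>a\<close> with \<open>f a \<noteq> 0\<close>, the Bezoutian of \<open>f\<close> and \<open>Q\<close>
  becomes diagonal in the basis \<open>Q / (y - a)\<close>.
\<close>

lemma det_PQ_nonzero:
  assumes f: "f \<noteq> 0"
  obtains v where "v \<in> carrier_vec n" "det (mat g g (\<lambda>(i, j). \<pi> i (g + j) v)) \<noteq> 0"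
proof -
  \<comment> \<open>The roots of Q have to be non-zero, so that Q can be scaled to the constant term
    2, and must not be roots of f.\<close>
  have "finite ({0} \<union> {x. poly f x = 0})" using f by (simp add: poly_roots_finite)
  then have "infinite (UNIV - ({0} \<union> {x. poly f x = 0}))"
    by (simp add: infinite_UNIV_char_0 Diff_infinite_finite)
  then obtain a :: "nat \<Rightarrow> complex" where a: "inj a" "range a \<subseteq> UNIV - ({0} \<union> {x. poly f x = 0})"
    using infinite_countable_subset by blast
  have a0: "a k \<noteq> 0" and fa: "poly f (a k) \<noteq> 0" for k using a(2) by auto
  define c where "c = 2 / (\<Prod>k<g. - a k)"
  have c: "c \<noteq> 0" using a0 by (simp add: c_def)
  define Q where "Q = Polynomial.smult c (\<Prod>k<g. [:- a k, 1:])"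
  define Q' where "Q' k = Polynomial.smult c (\<Prod>l\<in>{..<g} - {k}. [:- a l, 1:])" for k
  have QQ': "Q = [:- a k, 1:] * Q' k" if "k < g" for k
  proof -
    have "(\<Prod>l<g. [:- a l, 1:]) = [:- a k, 1:] * (\<Prod>l\<in>{..<g} - {k}. [:- a l, 1:])"
      using that by (intro prod.remove) auto
    then show ?thesis unfolding Q_def Q'_def by (simp only: mult_smult_right)
  qed
  have degQ: "degree Q \<le> g"
    unfolding Q_def by (rule order_trans[OF degree_smult_le], rule order_trans[OF degree_prod_sum_le]) auto
  have degQ': "coeff (Q' k) j = 0" if "k < g" "j \<ge> g" for k j
  proof -
    have "degree (Q' k) \<le> g - 1"
      unfolding Q'_def by (rule order_trans[OF degree_smult_le], rule order_trans[OF degree_prod_sum_le])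
        (use that in auto)
    then show ?thesis using that by (intro coeff_eq_0) linarith
  qed
  have Q0: "coeff Q 0 = 2"
    using a0 by (simp add: Q_def c_def poly_0_coeff_0[symmetric] poly_prod)
  define v where "v = coords g (1, Q, 0)"
  have v: "v \<in> carrier_vec n" unfolding v_def by (rule coords_carrier)
  have Qv: "poly_Q g v = Q"
    unfolding v_def by (rule triplet_coords) (use Q0 degQ in \<open>auto intro: coeff_eq_0\<close>)
  define B where "B i j = \<pi> i (g + j) v" for i j
  \<comment> \<open>As Q vanishes at x = a_k, the bracket of p(x) and q(y) collapses to f(a_k) Q(y)
    / (a_k - y), which is - f(a_k) times Q / (y - a_k).\<close>
  have B: "(\<Sum>i<g. B i j * a k ^ i) = - poly f (a k) * coeff (Q' k) j" if k: "k < g" and j: "j < g" for k j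
  proof -
    have "(\<Sum>i<g. B i j * a k ^ i) + poly f (a k) * coeff (Q' k) j = 0"
    proof (rule power_sum_extract[OF _ _ j, of "{a k}"])
      fix y assume y: "y \<notin> {a k}"
      have "poly Q (a k) = 0" "poly Q y = (y - a k) * poly (Q' k) y"
        by (simp_all add: QQ'[OF k] algebra_simps)
      then have "2 + a k * val g BQ v (a k) = 0" "2 + y * val g BQ v y = (y - a k) * poly (Q' k) y"
        using poly_Q_eq[of g v] Qv by simp_all
      then have "pair n \<pi> v (ev g BP (a k)) (ev g BQ y) = poly f (a k) * ((y - a k) * poly (Q' k) y) / (a k - y)"
        using y by (subst pair_ev_eqs(4)) auto
      also have "\<dots> = - poly f (a k) * poly (Q' k) y" using y by (simp add: field_simps)
      also have "poly (Q' k) y = (\<Sum>j<g. coeff (Q' k) j * y ^ j)"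
        by (rule poly_altdef_lessThan) (rule degQ'[OF k])
      finally have "(\<Sum>i<g. (\<Sum>j<g. B i j * y ^ j) * a k ^ i) = - poly f (a k) * (\<Sum>j<g. coeff (Q' k) j * y ^ j)"
        unfolding pair_ev by (simp add: B_def)
      moreover have "(\<Sum>i<g. (\<Sum>j<g. B i j * y ^ j) * a k ^ i) = (\<Sum>j<g. (\<Sum>i<g. B i j * a k ^ i) * y ^ j)"
        unfolding sum_distrib_right by (subst sum.swap) (simp only: mult_ac)
      ultimately show "(\<Sum>j<g. ((\<Sum>i<g. B i j * a k ^ i) + poly f (a k) * coeff (Q' k) j) * y ^ j) = 0"
        by (simp add: distrib_right sum.distrib sum_distrib_left sum_negf mult.assoc)
    qed simp
    then show ?thesis by (simp add: eq_neg_iff_add_eq_0)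
  qed
  have detC: "det (mat g g (\<lambda>(k, j). coeff (Q' k) j)) \<noteq> 0"
  proof -
    \<comment> \<open>The product with a Vandermonde matrix evaluates the polynomials Q / (y - a_k)
      at the roots, where they behave like unnormalised Lagrange polynomials and yield a diagonal
      matrix with non-zero entries.\<close>
    let ?C = "mat g g (\<lambda>(k, j). coeff (Q' k) j)" and ?W = "mat g g (\<lambda>(j, l). a l ^ j)"
    have CW: "(?C * ?W) $$ (k, l) = poly (Q' k) (a l)" if "k < g" "l < g" for k l
      using that degQ'[of k]
      by (subst poly_altdef_lessThan[of g]) (simp_all add: scalar_prod_def lessThan_atLeast0)
    have off: "poly (Q' k) (a l) = 0" if "k < g" "l < g" "k \<noteq> l" for k l
      using that by (auto simp: Q'_def poly_prod intro!: prod_zero bexI[of _ l])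
    have diag: "poly (Q' k) (a k) \<noteq> 0" for k
      using c a(1) by (auto simp: Q'_def poly_prod inj_eq)
    have "det (?C * ?W) = prod_list (diag_mat (?C * ?W))"
      by (rule det_lower_triangular[of g]) (use off in \<open>auto simp: CW simp del: index_mult_mat(1)\<close>)
    also have "\<dots> \<noteq> 0"
      by (auto simp: diag_mat_def prod_list_zero_iff CW diag simp del: index_mult_mat(1))
    finally show ?thesis using det_mult[of ?C g ?W] by auto
  qed
  have "det (mat g g (\<lambda>(i, j). B i j)) \<noteq> 0"
  proof (rule det_nonzeroI)
    fix u :: "nat \<Rightarrow> complex" and j assume z: "\<And>i. i < g \<Longrightarrow> (\<Sum>j<g. B i j * u j) = 0" and j: "j < g"
    show "u j = 0"
    proof (rule det_nonzeroD[OF detC _ j])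
      fix k assume k: "k < g"
      \<comment> \<open>Adding the equations for u with the weights a_k^i produces row k of C up to
        the non-zero factor - f(a_k).\<close>
      have "- poly f (a k) * (\<Sum>j<g. coeff (Q' k) j * u j) = (\<Sum>j<g. (\<Sum>i<g. B i j * a k ^ i) * u j)"
        unfolding sum_distrib_left by (intro sum.cong refl) (use B k in simp)
      also have "\<dots> = (\<Sum>i<g. (\<Sum>j<g. B i j * u j) * a k ^ i)"
        unfolding sum_distrib_right by (subst sum.swap) (simp only: mult_ac)
      also have "\<dots> = 0" using z by simp
      finally show "(\<Sum>j<g. coeff (Q' k) j * u j) = 0" using fa by simp
    qed
  qed
  then show ?thesis using that[OF v] by (simp add: B_def)
qed

text \<open>The brackets within p and within q vanish, so the leading minor of size 2 g has only the
  blocks B and minus the transpose of B off the diagonal, and a vector in its kernel splits into one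
  in the kernel of B and one in that of its transpose.\<close>

lemma generically_rank_lower:
  assumes f: "f \<noteq> 0"
  shows "generically n (\<lambda>v. 2 * g \<le> vec_space.rank n (mat n n (\<lambda>(i, j). \<pi> i j v)))"
proof -
  obtain u where u: "u \<in> carrier_vec n" "det (mat g g (\<lambda>(i, j). \<pi> i (g + j) u)) \<noteq> 0"
    using det_PQ_nonzero[OF f] by blast
  have "generically n (\<lambda>v. det (mat g g (\<lambda>(i, j). \<pi> i (g + j) v)) \<noteq> 0)"
    by (rule generically_det[of g n "\<lambda>i j. \<pi> i (g + j)", OF _ u]) (rule entries; simp)
  then show ?thesis
  proof (rule generically_mp)
    fix v assume v: "v \<in> carrier_vec n" and det: "det (mat g g (\<lambda>(i, j). \<pi> i (g + j) v)) \<noteq> 0"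
    have "mat g g (\<lambda>(i, j). \<pi> j (g + i) v) = transpose_mat (mat g g (\<lambda>(i, j). \<pi> i (g + j) v))"
      by (intro eq_matI) auto
    then have det': "det (mat g g (\<lambda>(i, j). \<pi> j (g + i) v)) \<noteq> 0"
      using det det_transpose[of "mat g g (\<lambda>(i, j). \<pi> i (g + j) v)" g] by simp
    have PP: "\<pi> i j v = 0" if "i < g" "j < g" for i j
      using that by (simp add: volterra_poisson_def)
    have QQ: "\<pi> (g + i) (g + j) v = 0" if "i < g" "j < g" for i j
      using that by (simp add: volterra_poisson_def)
    have "det (mat (2 * g) (2 * g) (\<lambda>(i, j). \<pi> i j v)) \<noteq> 0"
    proof (rule det_nonzeroI)
      fix c :: "nat \<Rightarrow> complex" and k
      assume z: "\<And>i. i < 2 * g \<Longrightarrow> (\<Sum>j<2 * g. \<pi> i j v * c j) = 0" and k: "k < 2 * g"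
      have z': "(\<Sum>j<g. \<pi> i j v * c j) + (\<Sum>j<g. \<pi> i (g + j) v * c (g + j)) = 0" if "i < 2 * g" for i
        using z[OF that] unfolding mult_2 sum_lessThan_add .
      have Q: "c (g + j) = 0" if "j < g" for j
      proof (rule det_nonzeroD[OF det _ that])
        fix i assume i: "i < g"
        have "(\<Sum>j<g. \<pi> i j v * c j) = 0" by (intro sum.neutral) (use PP i in simp)
        then show "(\<Sum>j<g. \<pi> i (g + j) v * c (g + j)) = 0" using z'[of i] i by simp
      qed
      have P: "c j = 0" if "j < g" for j
      proof (rule det_nonzeroD[OF det' _ that])
        fix i assume i: "i < g"
        have "(\<Sum>j<g. \<pi> (g + i) (g + j) v * c (g + j)) = 0" by (intro sum.neutral) (use QQ i in simp)
        then have "(\<Sum>j<g. \<pi> (g + i) j v * c j) = 0" using z'[of "g + i"] i by simp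
        moreover have "(\<Sum>j<g. \<pi> (g + i) j v * c j) = (\<Sum>j<g. - (\<pi> j (g + i) v * c j))"
        proof (intro sum.cong refl)
          fix j assume "j \<in> {..<g}"
          then show "\<pi> (g + i) j v * c j = - (\<pi> j (g + i) v * c j)"
            using \<pi>_antisym[of "g + i" j v] i by simp
        qed
        ultimately show "(\<Sum>j<g. \<pi> j (g + i) v * c j) = 0" by (simp add: sum_negf)
      qed
      show "c k = 0" using P[of k] Q[of "k - g"] k by (cases "k < g") auto
    qed
    moreover have "mat (2 * g) (2 * g) (\<lambda>(i, j). mat n n (\<lambda>(i, j). \<pi> i j v) $$ (i, j))
        = mat (2 * g) (2 * g) (\<lambda>(i, j). \<pi> i j v)"
      by (intro eq_matI) auto
    ultimately show "2 * g \<le> vec_space.rank n (mat n n (\<lambda>(i, j). \<pi> i j v))"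
      by (intro rank_ge_leading_minor) simp_all
  qed
qed

lemma poisson_rank:
  assumes "f \<noteq> 0" "g \<ge> 1"
  shows "poisson_rank n \<pi> (2 * g)"
  unfolding poisson_rank_def
  by (rule generically_mp2[OF generically_rank_lower[OF assms(1)] generically_det_K[OF assms(2)]])
    (rule order_antisym[OF rank_upper])

lemma liouville_integrable:
  assumes "f \<noteq> 0" "g \<ge> 1"
  shows "liouville_integrable n \<pi> T"
proof -
  have n: "n - g = 2 * g + 1" by simp
  show ?thesis
    unfolding liouville_integrable_def
  proof (intro conjI exI[of _ g] exI[of _ H]; (unfold n)?)
    show "\<forall>k<2 * g + 1. rational_fun n (H k)" using rational_fun_polyfun[OF polyfun_H] by blast
    show "\<forall>k<2 * g + 1. generically n (\<lambda>v. H k (T v) = H k v)"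
      by (intro allI impI generically_mp[OF generically_w]) (rule H_T)
    show "\<forall>k<2 * g + 1. \<forall>l<2 * g + 1. generically n (\<lambda>v. bracket n \<pi> (H k) (H l) v = 0)"
      by (intro allI impI generically_all involution)
    show "functionally_independent n (2 * g + 1) H" by (rule functionally_independent[OF assms(2)])
  qed (rule poisson_structure birational_map poisson_map poisson_rank[OF assms])+
qed

end

theorem proposition4p9:
  fixes g :: nat and \<phi> :: "complex poly"
  assumes "g \<ge> 1"
    and "\<phi> \<noteq> 0" and "degree \<phi> \<le> g + 1" and "poly \<phi> 0 = 0"
  shows "liouville_integrable (3 * g + 1) (volterra_poisson g \<phi>) (volterra_map g)"
proof -
  obtain c f where cf: "\<phi> = pCons c f" by (rule pCons_cases)
  \<comment> \<open>The vanishing at 0 makes \<phi> divisible by x, and the quotient f has degree at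
    most g.\<close>
  with assms(4) have \<phi>: "\<phi> = pCons 0 f" by simp
  with assms(2) have f: "f \<noteq> 0" by auto
  with assms(3) \<phi> have "degree f \<le> g" by simp
  then interpret volterra_bracket g f by unfold_locales
  show ?thesis using liouville_integrable[OF f assms(1)] unfolding \<phi> .
qed

end
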